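(* Let $B=A^{\mathrm{co}H}\subseteq A$ be a faithfully flat Hopf--Galois extension. (i) If $(\Gamma_H,\Gamma_A)$ is a quantum principal bundle à la Brzeziński--Majid on $A$ (with $\Gamma_H$ a bicovariant first order differential calculus on $H$ and $\Gamma_A$ a right $H$-covariant first order differential calculus on $A$), then the maximal prolongation of $\Gamma_A$ is first order complete. (ii) If $\Omega^\bullet(A)$ is a first order complete differential calculus on $A$ with corresponding differential calculus $\Omega^\bullet(H)$ on $H$ ($\Omega^1(H)$ being bicovariant), then the truncation $(\Omega^1(H),\Omega^1(A))$ is a quantum principal bundle à la Brzeziński--Majid if and only if $A\,\mathrm{d}(B)A=\mathrm{hor}^1$.
   Context: Conventions: $\Bbbk$ is a field; everything is $\Bbbk$-linear; algebras are associative and unital. $H$ is a Hopf algebra with invertible antipode $S$, $\Delta(h)=h_1\otimes h_2$; right coactions are written $m_0\otimes m_1$. Differential calculi: A first order differential calculus (FODC) on an algebra $A$ is an $A$-bimodule $\Gamma$ with a linear map $\mathrm{d}\colon A\to\Gamma$ satisfying the Leibniz rule and $\Gamma=\mathrm{span}\{a\,\mathrm{d}a'\}$. A differential calculus (DC) on $A$ is an $\mathbb{N}_0$-graded differential graded algebra $(\Omega^\bullet,\wedge,\mathrm{d})$ with $\Omega^0=A$ and $\Omega^k=\mathrm{span}\{a^0\mathrm{d}a^1\wedge\ldots\wedge\mathrm{d}a^k\}$; its truncation is the FODC $(\Omega^1,\mathrm{d}|_A)$. The maximal prolongation of a FODC $(\Gamma,\mathrm{d})$ is the DC obtained as the quotient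 of the tensor algebra $\bigoplus_k\Gamma^{\otimes_A k}$ by the ideal generated by all $\sum_i\mathrm{d}a^i\otimes_A\mathrm{d}b^i$ with $\sum_i a^i\mathrm{d}b^i=0$. A FODC on a right $H$-comodule algebra $A$ is right $H$-covariant if $a\,\mathrm{d}a'\mapsto a_0\mathrm{d}a'_0\otimes a_1a'_1$ is well defined; a FODC on $H$ is bicovariant if $h\,\mathrm{d}g\mapsto h_1\mathrm{d}g_1\otimes h_2g_2$ and $h\,\mathrm{d}g\mapsto h_1g_1\otimes h_2\mathrm{d}g_2$ are well defined. A morphism of FODCi over an algebra map $\phi\colon A\to A'$ is an $A$-bimodule map $\Phi\colon\Gamma\to\Gamma'$ with $\Phi\circ\mathrm{d}=\mathrm{d}'\circ\phi$. Faithfully flat Hopf--Galois extension: $A$ is a right $H$-comodule algebra with coaction $\Delta_A$, $B=A^{\mathrm{co}H}$, the map $A\otimes_BA\to A\otimes H$, $a\otimes_Ba'\mapsto aa'_0\otimes a'_1$, is bijective, and $A$ is faithfully flat as a right $B$-module. First order complete: a DC $\Omega^\bullet(A)$ is first order complete (with respect to a DC on $H$ with bicovariant $1$-forms $\Omega^1(H)$) if $\Delta_A$ extends to a morphism of FODCi $\Delta_A^1\colon\Omega^1(A)\to(\Omega^1(A)\otimes H)\oplus(A\otimes\Omega^1(H))$, where the target is the FODC on $A\otimes H$ with differential $\mathrm{d}_\otimes(a\otimes h)=\mathrm{d}a\otimes h+a\otimes\mathrm{d}h$; in (i) one uses $\Omega^1(H)=\Gamma_H$. In that case $\mathrm{hor}^1=\{\omega\in\Omega^1(A):\Delta_A^1(\omega)\in\Omega^1(A)\otimes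 H\}$. Quantum principal bundle à la Brzeziński--Majid: for a right $H$-covariant FODC $(\Gamma_A,\mathrm{d}_A)$ on $A$ and a bicovariant FODC $(\Gamma_H,\mathrm{d}_H)$ on $H$ with space $\Lambda^1$ of left coinvariant $1$-forms, this means that the map $\mathrm{ver}_{\mathrm{BM}}\colon\Gamma_A\to A\otimes\Lambda^1$, $a\,\mathrm{d}_A(a')\mapsto aa'_0\otimes S(a'_1)\mathrm{d}_H(a'_2)$, is well defined and the sequence $0\to A\,\mathrm{d}_A(B)A\hookrightarrow\Gamma_A\xrightarrow{\mathrm{ver}_{\mathrm{BM}}}A\otimes\Lambda^1\to0$ is exact. *)

theory Defs
  imports "HOL-Algebra.Module" "HOL-Algebra.Free_Abelian_Groups" "HOL-Algebra.QuotRing"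
begin

section \<open>Linear maps, spans, algebras\<close>

definition lin_map ::
  "('k, 'x) ring_scheme \<Rightarrow> ('k, 'm, 'y) module_scheme \<Rightarrow> ('k, 'n, 'z) module_scheme \<Rightarrow> ('m \<Rightarrow> 'n) \<Rightarrow> bool"
  where "lin_map R M N f \<longleftrightarrow>
    f \<in> carrier M \<rightarrow> carrier N \<and>
    (\<forall>x\<in>carrier M. \<forall>y\<in>carrier M. f (x \<oplus>\<^bsub>M\<^esub> y) = f x \<oplus>\<^bsub>N\<^esub> f y) \<and>
    (\<forall>c\<in>carrier R. \<forall>x\<in>carrier M. f (c \<odot>\<^bsub>M\<^esub> x) = c \<odot>\<^bsub>N\<^esub> f x)"

definition lspan :: "('k, 'x) ring_scheme \<Rightarrow> ('k, 'm, 'y) module_scheme \<Rightarrow> 'm set \<Rightarrow> 'm set"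
  where "lspan K M X = \<Inter>{N. submodule N K M \<and> X \<subseteq> N}"

text \<open>The locale \<^locale>\<open>algebra\<close> of HOL-Algebra is restricted to commutative algebras.\<close>

definition unital_algebra :: "('k, 'x) ring_scheme \<Rightarrow> ('k, 'a, 'y) module_scheme \<Rightarrow> bool"
  where "unital_algebra K A \<longleftrightarrow>
    module K A \<and> ring A \<and>
    (\<forall>c\<in>carrier K. \<forall>a\<in>carrier A. \<forall>b\<in>carrier A.
      (c \<odot>\<^bsub>A\<^esub> a) \<otimes>\<^bsub>A\<^esub> b = c \<odot>\<^bsub>A\<^esub> (a \<otimes>\<^bsub>A\<^esub> b) \<and>
      a \<otimes>\<^bsub>A\<^esub> (c \<odot>\<^bsub>A\<^esub> b) = c \<odot>\<^bsub>A\<^esub> (a \<otimes>\<^bsub>A\<^esub> b))"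

definition algebra_map ::
  "('k, 'x) ring_scheme \<Rightarrow> ('k, 'a, 'y) module_scheme \<Rightarrow> ('k, 'b, 'z) module_scheme \<Rightarrow> ('a \<Rightarrow> 'b) \<Rightarrow> bool"
  where "algebra_map K A B f \<longleftrightarrow> f \<in> ring_hom A B \<and> lin_map K A B f"

definition short_exact ::
  "('k, 'x) ring_scheme \<Rightarrow> ('k, 'l, 'u) module_scheme \<Rightarrow> ('l \<Rightarrow> 'm) \<Rightarrow> ('k, 'm, 'v) module_scheme
    \<Rightarrow> ('m \<Rightarrow> 'n) \<Rightarrow> ('k, 'n, 'w) module_scheme \<Rightarrow> bool"
  where "short_exact K L f M g N \<longleftrightarrow>
    lin_map K L M f \<and> lin_map K M N g \<and>
    inj_on f (carrier L) \<and>
    f ` carrier L = {m \<in> carrier M. g m = \<zero>\<^bsub>N\<^esub>} \<and>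
    g ` carrier M = carrier N"


section \<open>Tensor products\<close>

definition tensor_rel ::
  "'s set \<Rightarrow> ('m, 'x) ring_scheme \<Rightarrow> ('m \<Rightarrow> 's \<Rightarrow> 'm) \<Rightarrow> ('n, 'y) ring_scheme \<Rightarrow> ('s \<Rightarrow> 'n \<Rightarrow> 'n)
    \<Rightarrow> ('m \<times> 'n \<Rightarrow>\<^sub>0 int) set"
  where "tensor_rel S M r N l =
    {frag_of (m \<oplus>\<^bsub>M\<^esub> m', n) - frag_of (m, n) - frag_of (m', n) | m m' n.
       m \<in> carrier M \<and> m' \<in> carrier M \<and> n \<in> carrier N} \<union>
    {frag_of (m, n \<oplus>\<^bsub>N\<^esub> n') - frag_of (m, n) - frag_of (m, n') | m n n'.
       m \<in> carrier M \<and> n \<in> carrier N \<and> n' \<in> carrier N} \<union>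
    {frag_of (r m s, n) - frag_of (m, l s n) | m s n.
       m \<in> carrier M \<and> s \<in> S \<and> n \<in> carrier N}"

text \<open>
  The balanced tensor product \<open>M \<otimes>\<^bsub>S\<^esub> N\<close> of a right module (action \<open>r\<close>) and a left module
  (action \<open>l\<close>), as an additive group.  The multiplicative fields of the record carry no meaning.
\<close>

definition balanced_tensor ::
  "'s set \<Rightarrow> ('m, 'x) ring_scheme \<Rightarrow> ('m \<Rightarrow> 's \<Rightarrow> 'm) \<Rightarrow> ('n, 'y) ring_scheme \<Rightarrow> ('s \<Rightarrow> 'n \<Rightarrow> 'n)
    \<Rightarrow> ('m \<times> 'n \<Rightarrow>\<^sub>0 int) set ring"
  where "balanced_tensor S M r N l =
    (let F = free_Abelian_group (carrier M \<times> carrier N);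
         Q = F Mod generate F (tensor_rel S M r N l)
     in \<lparr>carrier = carrier Q, monoid.mult = undefined, one = undefined,
         ring.zero = one Q, add = monoid.mult Q\<rparr>)"

text \<open>The class of \<open>m \<otimes> n\<close>; unique since the elements of a tensor product partition the free group.\<close>

definition pure_tensor ::
  "(('m \<times> 'n \<Rightarrow>\<^sub>0 int) set, 'x) ring_scheme \<Rightarrow> 'm \<Rightarrow> 'n \<Rightarrow> ('m \<times> 'n \<Rightarrow>\<^sub>0 int) set"
  where "pure_tensor T m n = (THE X. X \<in> carrier T \<and> frag_of (m, n) \<in> X)"

text \<open>
  \<open>tensor_lift P t f\<close> is the value at \<open>t\<close> of the additive map into \<open>P\<close> induced by the balanced
  biadditive map \<open>f\<close>.  If \<open>t\<close> is a coproduct or coaction, written \<open>x\<^sub>0 \<otimes> x\<^sub>1\<close>, this is the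
  element of \<open>P\<close> written \<open>f x\<^sub>0 x\<^sub>1\<close> in Sweedler notation.
\<close>

definition tensor_lift ::
  "('p, 'x) ring_scheme \<Rightarrow> ('m \<times> 'n \<Rightarrow>\<^sub>0 int) set \<Rightarrow> ('m \<Rightarrow> 'n \<Rightarrow> 'p) \<Rightarrow> 'p"
  where "tensor_lift P t f = the_elem
    ((\<lambda>x. finsum P (\<lambda>p. add_pow P (Poly_Mapping.lookup x p) (f (fst p) (snd p))) (Poly_Mapping.keys x)) ` t)"

text \<open>
  Tensor product of \<open>K\<close>-modules.  The ring operations are the usual ones when \<open>M\<close> and \<open>N\<close>
  are algebras, and are ignored otherwise.
\<close>

definition tensor ::
  "('k, 'x) ring_scheme \<Rightarrow> ('k, 'm, 'y) module_scheme \<Rightarrow> ('k, 'n, 'z) module_scheme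
    \<Rightarrow> ('k, ('m \<times> 'n \<Rightarrow>\<^sub>0 int) set) module"
  where "tensor K M N =
    (let T = balanced_tensor (carrier K) M (\<lambda>m c. c \<odot>\<^bsub>M\<^esub> m) N (\<lambda>c n. c \<odot>\<^bsub>N\<^esub> n)
     in \<lparr>carrier = carrier T,
         monoid.mult = (\<lambda>s t. tensor_lift T s (\<lambda>m n. tensor_lift T t (\<lambda>m' n'.
           pure_tensor T (m \<otimes>\<^bsub>M\<^esub> m') (n \<otimes>\<^bsub>N\<^esub> n')))),
         one = pure_tensor T \<one>\<^bsub>M\<^esub> \<one>\<^bsub>N\<^esub>,
         ring.zero = ring.zero T, add = add T,
         smult = (\<lambda>c t. tensor_lift T t (\<lambda>m n. pure_tensor T (c \<odot>\<^bsub>M\<^esub> m) n))\<rparr>)"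


section \<open>Hopf algebras and comodule algebras\<close>

record ('k, 'h) hopf = "('k, 'h) module" +
  comult :: "'h \<Rightarrow> ('h \<times> 'h \<Rightarrow>\<^sub>0 int) set"
  counit :: "'h \<Rightarrow> 'k"
  antipode :: "'h \<Rightarrow> 'h"

text \<open>Coassociativity is stated in \<open>H \<otimes> (H \<otimes> H)\<close>, with the associator built into its left-hand side.\<close>

definition hopf_algebra :: "('k, 'x) ring_scheme \<Rightarrow> ('k, 'h) hopf \<Rightarrow> bool"
  where "hopf_algebra K H \<longleftrightarrow>
    (let HH = tensor K H H; HHH = tensor K H HH in
      unital_algebra K H \<and>
      algebra_map K H HH (comult H) \<and>
      (counit H \<in> ring_hom H K \<and>
        (\<forall>c\<in>carrier K. \<forall>h\<in>carrier H. counit H (c \<odot>\<^bsub>H\<^esub> h) = c \<otimes>\<^bsub>K\<^esub> counit H h)) \<and>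
      (\<forall>h\<in>carrier H.
        tensor_lift HHH (comult H h) (\<lambda>x y. tensor_lift HHH (comult H x)
          (\<lambda>u v. pure_tensor HHH u (pure_tensor HH v y))) =
        tensor_lift HHH (comult H h) (\<lambda>x y. pure_tensor HHH x (comult H y))) \<and>
      (\<forall>h\<in>carrier H.
        tensor_lift H (comult H h) (\<lambda>x y. counit H x \<odot>\<^bsub>H\<^esub> y) = h \<and>
        tensor_lift H (comult H h) (\<lambda>x y. counit H y \<odot>\<^bsub>H\<^esub> x) = h) \<and>
      lin_map K H H (antipode H) \<and>
      (\<forall>h\<in>carrier H.
        tensor_lift H (comult H h) (\<lambda>x y. antipode H x \<otimes>\<^bsub>H\<^esub> y) = counit H h \<odot>\<^bsub>H\<^esub> \<one>\<^bsub>H\<^esub> \<and>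
        tensor_lift H (comult H h) (\<lambda>x y. x \<otimes>\<^bsub>H\<^esub> antipode H y) = counit H h \<odot>\<^bsub>H\<^esub> \<one>\<^bsub>H\<^esub>) \<and>
      bij_betw (antipode H) (carrier H) (carrier H))"

definition comodule_algebra ::
  "('k, 'x) ring_scheme \<Rightarrow> ('k, 'h) hopf \<Rightarrow> ('k, 'a, 'y) module_scheme
    \<Rightarrow> ('a \<Rightarrow> ('a \<times> 'h \<Rightarrow>\<^sub>0 int) set) \<Rightarrow> bool"
  where "comodule_algebra K H A \<delta> \<longleftrightarrow>
    (let AH = tensor K A H; HH = tensor K H H; AHH = tensor K A HH in
      unital_algebra K A \<and>
      algebra_map K A AH \<delta> \<and>
      (\<forall>a\<in>carrier A.
        tensor_lift AHH (\<delta> a) (\<lambda>x h. tensor_lift AHH (\<delta> x)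
          (\<lambda>y g. pure_tensor AHH y (pure_tensor HH g h))) =
        tensor_lift AHH (\<delta> a) (\<lambda>x h. pure_tensor AHH x (comult H h))) \<and>
      (\<forall>a\<in>carrier A. tensor_lift A (\<delta> a) (\<lambda>x h. counit H h \<odot>\<^bsub>A\<^esub> x) = a))"

definition coinv ::
  "('k, 'x) ring_scheme \<Rightarrow> ('k, 'h) hopf \<Rightarrow> ('k, 'a, 'y) module_scheme
    \<Rightarrow> ('a \<Rightarrow> ('a \<times> 'h \<Rightarrow>\<^sub>0 int) set) \<Rightarrow> 'a set"
  where "coinv K H A \<delta> = {a \<in> carrier A. \<delta> a = pure_tensor (tensor K A H) a \<one>\<^bsub>H\<^esub>}"


section \<open>Faithfully flat Hopf--Galois extensions\<close>

text \<open>The locale \<^locale>\<open>module\<close> of HOL-Algebra requires commutative scalars.\<close>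

definition left_module :: "('b, 'x) ring_scheme \<Rightarrow> ('b, 'm) module \<Rightarrow> bool"
  where "left_module B M \<longleftrightarrow>
    abelian_group M \<and>
    (\<forall>b\<in>carrier B. \<forall>x\<in>carrier M. b \<odot>\<^bsub>M\<^esub> x \<in> carrier M) \<and>
    (\<forall>b\<in>carrier B. \<forall>c\<in>carrier B. \<forall>x\<in>carrier M.
      (b \<oplus>\<^bsub>B\<^esub> c) \<odot>\<^bsub>M\<^esub> x = b \<odot>\<^bsub>M\<^esub> x \<oplus>\<^bsub>M\<^esub> c \<odot>\<^bsub>M\<^esub> x) \<and>
    (\<forall>b\<in>carrier B. \<forall>x\<in>carrier M. \<forall>y\<in>carrier M.
      b \<odot>\<^bsub>M\<^esub> (x \<oplus>\<^bsub>M\<^esub> y) = b \<odot>\<^bsub>M\<^esub> x \<oplus>\<^bsub>M\<^esub> b \<odot>\<^bsub>M\<^esub> y) \<and>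
    (\<forall>b\<in>carrier B. \<forall>c\<in>carrier B. \<forall>x\<in>carrier M.
      (b \<otimes>\<^bsub>B\<^esub> c) \<odot>\<^bsub>M\<^esub> x = b \<odot>\<^bsub>M\<^esub> (c \<odot>\<^bsub>M\<^esub> x)) \<and>
    (\<forall>x\<in>carrier M. \<one>\<^bsub>B\<^esub> \<odot>\<^bsub>M\<^esub> x = x)"

definition exact_at ::
  "('l, 'u) ring_scheme \<Rightarrow> ('l \<Rightarrow> 'm) \<Rightarrow> ('m, 'v) ring_scheme \<Rightarrow> ('m \<Rightarrow> 'n) \<Rightarrow> ('n, 'w) ring_scheme \<Rightarrow> bool"
  where "exact_at L f M g N \<longleftrightarrow> f ` carrier L = {m \<in> carrier M. g m = \<zero>\<^bsub>N\<^esub>}"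

text \<open>
  \<open>A\<close> is a faithfully flat right module over its subring \<open>B\<close>: a sequence \<open>L \<rightarrow> M \<rightarrow> N\<close> of left
  \<open>B\<close>-modules is exact iff \<open>A \<otimes>\<^bsub>B\<^esub> L \<rightarrow> A \<otimes>\<^bsub>B\<^esub> M \<rightarrow> A \<otimes>\<^bsub>B\<^esub> N\<close> is exact.  As HOL cannot quantify over
  types, the test modules have their elements in the type \<^typ>\<open>'a set\<close>.  Nothing is lost: flatness
  can be tested on the inclusions of left ideals \<open>I \<rightarrow> B\<close>, and faithfulness of a flat module on the
  cyclic modules \<open>B/I\<close>, all of which have copies in this type (singletons and cosets).
\<close>

definition faithfully_flat_right :: "'a set \<Rightarrow> ('k, 'a, 'x) module_scheme \<Rightarrow> bool"
  where "faithfully_flat_right B A \<longleftrightarrow>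
    (let R = A\<lparr>carrier := B\<rparr>;
         tens = (\<lambda>M :: ('a, 'a set) module. balanced_tensor B A (\<lambda>a b. a \<otimes>\<^bsub>A\<^esub> b) M (\<lambda>b m. b \<odot>\<^bsub>M\<^esub> m));
         tens_map = (\<lambda>M f t. tensor_lift (tens M) t (\<lambda>a x. pure_tensor (tens M) a (f x)))
     in \<forall>L M N f g.
       left_module R L \<and> left_module R M \<and> left_module R N \<and> lin_map R L M f \<and> lin_map R M N g \<longrightarrow>
       (exact_at L f M g N \<longleftrightarrow>
        exact_at (tens L) (tens_map M f) (tens M) (tens_map N g) (tens N)))"

definition hopf_galois ::
  "('k, 'x) ring_scheme \<Rightarrow> ('k, 'h) hopf \<Rightarrow> ('k, 'a, 'y) module_scheme
    \<Rightarrow> ('a \<Rightarrow> ('a \<times> 'h \<Rightarrow>\<^sub>0 int) set) \<Rightarrow> bool"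
  where "hopf_galois K H A \<delta> \<longleftrightarrow>
    (let AH = tensor K A H;
         ABA = balanced_tensor (coinv K H A \<delta>) A (\<lambda>a b. a \<otimes>\<^bsub>A\<^esub> b) A (\<lambda>b a. b \<otimes>\<^bsub>A\<^esub> a)
     in bij_betw
       (\<lambda>t. tensor_lift AH t (\<lambda>a a'. tensor_lift AH (\<delta> a') (\<lambda>x h. pure_tensor AH (a \<otimes>\<^bsub>A\<^esub> x) h)))
       (carrier ABA) (carrier AH))"

definition ff_hopf_galois ::
  "('k, 'x) ring_scheme \<Rightarrow> ('k, 'h) hopf \<Rightarrow> ('k, 'a, 'y) module_scheme
    \<Rightarrow> ('a \<Rightarrow> ('a \<times> 'h \<Rightarrow>\<^sub>0 int) set) \<Rightarrow> bool"
  where "ff_hopf_galois K H A \<delta> \<longleftrightarrow>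
    comodule_algebra K H A \<delta> \<and> hopf_galois K H A \<delta> \<and> faithfully_flat_right (coinv K H A \<delta>) A"


section \<open>First order differential calculi\<close>

record ('k, 'a, 'g) fodc = "('k, 'g) module" +
  lact :: "'a \<Rightarrow> 'g \<Rightarrow> 'g"
  ract :: "'g \<Rightarrow> 'a \<Rightarrow> 'g"
  dif :: "'a \<Rightarrow> 'g"

definition bimodule ::
  "('k, 'x) ring_scheme \<Rightarrow> ('k, 'a, 'y) module_scheme \<Rightarrow> ('k, 'a, 'g) fodc \<Rightarrow> bool"
  where "bimodule K A \<Gamma> \<longleftrightarrow>
    module K \<Gamma> \<and>
    (\<forall>a\<in>carrier A. lin_map K \<Gamma> \<Gamma> (\<lambda>x. lact \<Gamma> a x)) \<and>
    (\<forall>x\<in>carrier \<Gamma>. lin_map K A \<Gamma> (\<lambda>a. lact \<Gamma> a x)) \<and>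
    (\<forall>a\<in>carrier A. lin_map K \<Gamma> \<Gamma> (\<lambda>x. ract \<Gamma> x a)) \<and>
    (\<forall>x\<in>carrier \<Gamma>. lin_map K A \<Gamma> (\<lambda>a. ract \<Gamma> x a)) \<and>
    (\<forall>x\<in>carrier \<Gamma>. lact \<Gamma> \<one>\<^bsub>A\<^esub> x = x \<and> ract \<Gamma> x \<one>\<^bsub>A\<^esub> = x) \<and>
    (\<forall>a\<in>carrier A. \<forall>b\<in>carrier A. \<forall>x\<in>carrier \<Gamma>.
      lact \<Gamma> (a \<otimes>\<^bsub>A\<^esub> b) x = lact \<Gamma> a (lact \<Gamma> b x) \<and>
      ract \<Gamma> x (a \<otimes>\<^bsub>A\<^esub> b) = ract \<Gamma> (ract \<Gamma> x a) b \<and>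
      ract \<Gamma> (lact \<Gamma> a x) b = lact \<Gamma> a (ract \<Gamma> x b))"

definition is_fodc ::
  "('k, 'x) ring_scheme \<Rightarrow> ('k, 'a, 'y) module_scheme \<Rightarrow> ('k, 'a, 'g) fodc \<Rightarrow> bool"
  where "is_fodc K A \<Gamma> \<longleftrightarrow>
    bimodule K A \<Gamma> \<and>
    lin_map K A \<Gamma> (dif \<Gamma>) \<and>
    (\<forall>a\<in>carrier A. \<forall>b\<in>carrier A.
      dif \<Gamma> (a \<otimes>\<^bsub>A\<^esub> b) = ract \<Gamma> (dif \<Gamma> a) b \<oplus>\<^bsub>\<Gamma>\<^esub> lact \<Gamma> a (dif \<Gamma> b)) \<and>
    carrier \<Gamma> = lspan K \<Gamma> {lact \<Gamma> a (dif \<Gamma> a') | a a'. a \<in> carrier A \<and> a' \<in> carrier A}"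

definition fodc_map ::
  "('k, 'x) ring_scheme \<Rightarrow> ('k, 'a, 'y) module_scheme \<Rightarrow> ('a \<Rightarrow> 'b)
    \<Rightarrow> ('k, 'a, 'g) fodc \<Rightarrow> ('k, 'b, 'e) fodc \<Rightarrow> ('g \<Rightarrow> 'e) \<Rightarrow> bool"
  where "fodc_map K A \<phi> \<Gamma> \<Gamma>' \<Phi> \<longleftrightarrow>
    lin_map K \<Gamma> \<Gamma>' \<Phi> \<and>
    (\<forall>a\<in>carrier A. \<forall>x\<in>carrier \<Gamma>.
      \<Phi> (lact \<Gamma> a x) = lact \<Gamma>' (\<phi> a) (\<Phi> x) \<and> \<Phi> (ract \<Gamma> x a) = ract \<Gamma>' (\<Phi> x) (\<phi> a)) \<and>
    (\<forall>a\<in>carrier A. \<Phi> (dif \<Gamma> a) = dif \<Gamma>' (\<phi> a))"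

text \<open>
  As \<open>\<Gamma>\<close> is spanned by the elements \<open>a da'\<close>, an assignment \<open>a da' \<mapsto> \<dots>\<close> is well defined iff
  some linear map on \<open>\<Gamma>\<close> has these values, and this map is then unique on \<open>carrier \<Gamma>\<close>.
\<close>

definition is_right_coaction ::
  "('k, 'x) ring_scheme \<Rightarrow> ('k, 'h) hopf \<Rightarrow> ('k, 'a, 'y) module_scheme
    \<Rightarrow> ('a \<Rightarrow> ('a \<times> 'h \<Rightarrow>\<^sub>0 int) set) \<Rightarrow> ('k, 'a, 'g) fodc
    \<Rightarrow> ('g \<Rightarrow> ('g \<times> 'h \<Rightarrow>\<^sub>0 int) set) \<Rightarrow> bool"
  where "is_right_coaction K H A \<delta> \<Gamma> \<rho> \<longleftrightarrow>
    (let T = tensor K \<Gamma> H in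
      lin_map K \<Gamma> T \<rho> \<and>
      (\<forall>a\<in>carrier A. \<forall>a'\<in>carrier A.
        \<rho> (lact \<Gamma> a (dif \<Gamma> a')) =
        tensor_lift T (\<delta> a) (\<lambda>a\<^sub>0 a\<^sub>1. tensor_lift T (\<delta> a') (\<lambda>a'\<^sub>0 a'\<^sub>1.
          pure_tensor T (lact \<Gamma> a\<^sub>0 (dif \<Gamma> a'\<^sub>0)) (a\<^sub>1 \<otimes>\<^bsub>H\<^esub> a'\<^sub>1)))))"

definition right_covariant ::
  "('k, 'x) ring_scheme \<Rightarrow> ('k, 'h) hopf \<Rightarrow> ('k, 'a, 'y) module_scheme
    \<Rightarrow> ('a \<Rightarrow> ('a \<times> 'h \<Rightarrow>\<^sub>0 int) set) \<Rightarrow> ('k, 'a, 'g) fodc \<Rightarrow> bool"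
  where "right_covariant K H A \<delta> \<Gamma> \<longleftrightarrow> (\<exists>\<rho>. is_right_coaction K H A \<delta> \<Gamma> \<rho>)"

definition is_left_coaction ::
  "('k, 'x) ring_scheme \<Rightarrow> ('k, 'h) hopf \<Rightarrow> ('k, 'h, 'g) fodc
    \<Rightarrow> ('g \<Rightarrow> ('h \<times> 'g \<Rightarrow>\<^sub>0 int) set) \<Rightarrow> bool"
  where "is_left_coaction K H \<Gamma> \<rho> \<longleftrightarrow>
    (let T = tensor K H \<Gamma> in
      lin_map K \<Gamma> T \<rho> \<and>
      (\<forall>h\<in>carrier H. \<forall>g\<in>carrier H.
        \<rho> (lact \<Gamma> h (dif \<Gamma> g)) =
        tensor_lift T (comult H h) (\<lambda>h\<^sub>1 h\<^sub>2. tensor_lift T (comult H g) (\<lambda>g\<^sub>1 g\<^sub>2.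
          pure_tensor T (h\<^sub>1 \<otimes>\<^bsub>H\<^esub> g\<^sub>1) (lact \<Gamma> h\<^sub>2 (dif \<Gamma> g\<^sub>2))))))"

definition bicovariant ::
  "('k, 'x) ring_scheme \<Rightarrow> ('k, 'h) hopf \<Rightarrow> ('k, 'h, 'g) fodc \<Rightarrow> bool"
  where "bicovariant K H \<Gamma> \<longleftrightarrow>
    right_covariant K H H (comult H) \<Gamma> \<and> (\<exists>\<rho>. is_left_coaction K H \<Gamma> \<rho>)"

definition left_coaction ::
  "('k, 'x) ring_scheme \<Rightarrow> ('k, 'h) hopf \<Rightarrow> ('k, 'h, 'g) fodc \<Rightarrow> 'g \<Rightarrow> ('h \<times> 'g \<Rightarrow>\<^sub>0 int) set"
  where "left_coaction K H \<Gamma> = (SOME \<rho>. is_left_coaction K H \<Gamma> \<rho>)"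

definition coinv_forms ::
  "('k, 'x) ring_scheme \<Rightarrow> ('k, 'h) hopf \<Rightarrow> ('k, 'h, 'g) fodc \<Rightarrow> ('k, 'h, 'g) fodc"
  where "coinv_forms K H \<Gamma> =
    \<Gamma>\<lparr>carrier := {x \<in> carrier \<Gamma>. left_coaction K H \<Gamma> x = pure_tensor (tensor K H \<Gamma>) \<one>\<^bsub>H\<^esub> x}\<rparr>"


section \<open>Quantum principal bundles\<close>

text \<open>The sub-bimodule \<open>A d(B) A\<close>.\<close>

definition base_forms ::
  "('k, 'x) ring_scheme \<Rightarrow> ('k, 'h) hopf \<Rightarrow> ('k, 'a, 'y) module_scheme
    \<Rightarrow> ('a \<Rightarrow> ('a \<times> 'h \<Rightarrow>\<^sub>0 int) set) \<Rightarrow> ('k, 'a, 'g) fodc \<Rightarrow> 'g set"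
  where "base_forms K H A \<delta> \<Gamma> = lspan K \<Gamma>
    {ract \<Gamma> (lact \<Gamma> a (dif \<Gamma> b)) a' | a b a'.
      a \<in> carrier A \<and> b \<in> coinv K H A \<delta> \<and> a' \<in> carrier A}"

text \<open>In \<open>a a'\<^sub>0 \<otimes> S(a'\<^sub>1) d(a'\<^sub>2)\<close> only the sum \<open>S(h\<^sub>1) d(h\<^sub>2)\<close> is left coinvariant, not its
  summands; it is therefore formed in \<open>\<Gamma>H\<close> before tensoring with \<open>A\<close>.\<close>

definition is_ver ::
  "('k, 'x) ring_scheme \<Rightarrow> ('k, 'h) hopf \<Rightarrow> ('k, 'a, 'y) module_scheme
    \<Rightarrow> ('a \<Rightarrow> ('a \<times> 'h \<Rightarrow>\<^sub>0 int) set) \<Rightarrow> ('k, 'h, 'gh) fodc \<Rightarrow> ('k, 'a, 'ga) fodc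
    \<Rightarrow> ('ga \<Rightarrow> ('a \<times> 'gh \<Rightarrow>\<^sub>0 int) set) \<Rightarrow> bool"
  where "is_ver K H A \<delta> \<Gamma>H \<Gamma>A v \<longleftrightarrow>
    (let T = tensor K A (coinv_forms K H \<Gamma>H) in
      lin_map K \<Gamma>A T v \<and>
      (\<forall>a\<in>carrier A. \<forall>a'\<in>carrier A.
        v (lact \<Gamma>A a (dif \<Gamma>A a')) =
        tensor_lift T (\<delta> a') (\<lambda>a'\<^sub>0 h. pure_tensor T (a \<otimes>\<^bsub>A\<^esub> a'\<^sub>0)
          (tensor_lift \<Gamma>H (comult H h) (\<lambda>h\<^sub>1 h\<^sub>2. lact \<Gamma>H (antipode H h\<^sub>1) (dif \<Gamma>H h\<^sub>2))))))"

definition bm_bundle ::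
  "('k, 'x) ring_scheme \<Rightarrow> ('k, 'h) hopf \<Rightarrow> ('k, 'a, 'y) module_scheme
    \<Rightarrow> ('a \<Rightarrow> ('a \<times> 'h \<Rightarrow>\<^sub>0 int) set) \<Rightarrow> ('k, 'h, 'gh) fodc \<Rightarrow> ('k, 'a, 'ga) fodc \<Rightarrow> bool"
  where "bm_bundle K H A \<delta> \<Gamma>H \<Gamma>A \<longleftrightarrow>
    is_fodc K H \<Gamma>H \<and> bicovariant K H \<Gamma>H \<and>
    is_fodc K A \<Gamma>A \<and> right_covariant K H A \<delta> \<Gamma>A \<and>
    (\<exists>v. is_ver K H A \<delta> \<Gamma>H \<Gamma>A v \<and>
      short_exact K (\<Gamma>A\<lparr>carrier := base_forms K H A \<delta> \<Gamma>A\<rparr>) (\<lambda>x. x) \<Gamma>A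
        v (tensor K A (coinv_forms K H \<Gamma>H)))"


section \<open>Differential calculi of higher order\<close>

text \<open>
  A differential calculus \<open>\<Omega>\<close> on \<open>A\<close> is the total space of a graded algebra: multiplication is
  \<open>\<and>\<close>, \<open>degr \<Omega> n\<close> is \<open>\<Omega>\<^sup>n\<close>, \<open>dd \<Omega> n\<close> is the differential \<open>\<Omega>\<^sup>n \<rightarrow> \<Omega>\<^sup>n\<^sup>+\<^sup>1\<close>, and the
  identification of \<open>A\<close> with \<open>\<Omega>\<^sup>0\<close> is the algebra isomorphism \<open>emb \<Omega>\<close>.
\<close>

record ('k, 'a, 'w) dcalc = "('k, 'w) module" +
  degr :: "nat \<Rightarrow> 'w set"
  dd :: "nat \<Rightarrow> 'w \<Rightarrow> 'w"
  emb :: "'a \<Rightarrow> 'w"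

definition wedge_list :: "('k, 'w, 'x) module_scheme \<Rightarrow> 'w list \<Rightarrow> 'w"
  where "wedge_list \<Omega> ws = foldr (\<lambda>v w. v \<otimes>\<^bsub>\<Omega>\<^esub> w) ws \<one>\<^bsub>\<Omega>\<^esub>"

definition diff_calculus ::
  "('k, 'x) ring_scheme \<Rightarrow> ('k, 'a, 'y) module_scheme \<Rightarrow> ('k, 'a, 'w) dcalc \<Rightarrow> bool"
  where "diff_calculus K A \<Omega> \<longleftrightarrow>
    unital_algebra K \<Omega> \<and>
    (\<forall>n. submodule (degr \<Omega> n) K \<Omega>) \<and>
    (\<forall>w\<in>carrier \<Omega>. \<exists>!f. (\<forall>n. f n \<in> degr \<Omega> n) \<and> finite {n. f n \<noteq> \<zero>\<^bsub>\<Omega>\<^esub>} \<and>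
      w = finsum \<Omega> f {n. f n \<noteq> \<zero>\<^bsub>\<Omega>\<^esub>}) \<and>
    (\<forall>m n. \<forall>v\<in>degr \<Omega> m. \<forall>w\<in>degr \<Omega> n. v \<otimes>\<^bsub>\<Omega>\<^esub> w \<in> degr \<Omega> (m + n)) \<and>
    algebra_map K A \<Omega> (emb \<Omega>) \<and> bij_betw (emb \<Omega>) (carrier A) (degr \<Omega> 0) \<and>
    (\<forall>n. lin_map K (\<Omega>\<lparr>carrier := degr \<Omega> n\<rparr>) (\<Omega>\<lparr>carrier := degr \<Omega> (Suc n)\<rparr>) (dd \<Omega> n)) \<and>
    (\<forall>n. \<forall>w\<in>degr \<Omega> n. dd \<Omega> (Suc n) (dd \<Omega> n w) = \<zero>\<^bsub>\<Omega>\<^esub>) \<and>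
    (\<forall>m n. \<forall>v\<in>degr \<Omega> m. \<forall>w\<in>degr \<Omega> n.
      dd \<Omega> (m + n) (v \<otimes>\<^bsub>\<Omega>\<^esub> w) =
      dd \<Omega> m v \<otimes>\<^bsub>\<Omega>\<^esub> w \<oplus>\<^bsub>\<Omega>\<^esub> add_pow \<Omega> ((- 1 :: int) ^ m) (v \<otimes>\<^bsub>\<Omega>\<^esub> dd \<Omega> n w)) \<and>
    (\<forall>n. degr \<Omega> n = lspan K \<Omega>
      {emb \<Omega> a \<otimes>\<^bsub>\<Omega>\<^esub> wedge_list \<Omega> (map (\<lambda>a'. dd \<Omega> 0 (emb \<Omega> a')) as) | a as.
        a \<in> carrier A \<and> as \<in> lists (carrier A) \<and> length as = n})"

definition truncation :: "('k, 'a, 'w) dcalc \<Rightarrow> ('k, 'a, 'w) fodc"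
  where "truncation \<Omega> =
    \<lparr>carrier = degr \<Omega> 1, monoid.mult = monoid.mult \<Omega>, one = one \<Omega>, ring.zero = ring.zero \<Omega>, add = add \<Omega>,
     smult = smult \<Omega>,
     lact = (\<lambda>a w. emb \<Omega> a \<otimes>\<^bsub>\<Omega>\<^esub> w), ract = (\<lambda>w a. w \<otimes>\<^bsub>\<Omega>\<^esub> emb \<Omega> a), dif = (\<lambda>a. dd \<Omega> 0 (emb \<Omega> a))\<rparr>"


subsection \<open>The maximal prolongation\<close>

text \<open>
  The tensor algebra \<open>\<Oplus>\<^sub>n \<Gamma> \<otimes>\<^bsub>A\<^esub> \<dots> \<otimes>\<^bsub>A\<^esub> \<Gamma>\<close> is realised as the ring of integral combinations of words in
  letters from \<open>A\<close> and \<open>\<Gamma>\<close>, modulo additivity in each letter and the relations which turn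
  juxtaposition of letters into the multiplication of \<open>A\<close> and into its actions on \<open>\<Gamma>\<close>
  (so that words are balanced over \<open>A\<close>).  The \<open>n\<close>-fold tensor power consists of the classes of
  combinations of words with exactly \<open>n\<close> letters from \<open>\<Gamma>\<close>.
\<close>

definition word_ring :: "'a set \<Rightarrow> 'g set \<Rightarrow> (('a + 'g) list \<Rightarrow>\<^sub>0 int) ring"
  where "word_ring A G =
    \<lparr>carrier = {c. Poly_Mapping.keys c \<subseteq> lists (A <+> G)},
     monoid.mult = (\<lambda>x y. frag_extend (\<lambda>u. frag_extend (\<lambda>v. frag_of (u @ v)) y) x),
     one = frag_of [], ring.zero = 0, add = (+)\<rparr>"

definition word_rel ::
  "('k, 'a, 'y) module_scheme \<Rightarrow> ('k, 'a, 'g) fodc \<Rightarrow> (('a + 'g) list \<Rightarrow>\<^sub>0 int) set"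
  where "word_rel A \<Gamma> =
    {frag_of [Inl (a \<oplus>\<^bsub>A\<^esub> b)] - frag_of [Inl a] - frag_of [Inl b] | a b.
       a \<in> carrier A \<and> b \<in> carrier A} \<union>
    {frag_of [Inl (a \<otimes>\<^bsub>A\<^esub> b)] - frag_of [Inl a, Inl b] | a b.
       a \<in> carrier A \<and> b \<in> carrier A} \<union>
    {frag_of [Inl \<one>\<^bsub>A\<^esub>] - frag_of []} \<union>
    {frag_of [Inr (x \<oplus>\<^bsub>\<Gamma>\<^esub> y)] - frag_of [Inr x] - frag_of [Inr y] | x y.
       x \<in> carrier \<Gamma> \<and> y \<in> carrier \<Gamma>} \<union>
    {frag_of [Inr (lact \<Gamma> a x)] - frag_of [Inl a, Inr x] | a x.
       a \<in> carrier A \<and> x \<in> carrier \<Gamma>} \<union>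
    {frag_of [Inr (ract \<Gamma> x a)] - frag_of [Inr x, Inl a] | x a.
       x \<in> carrier \<Gamma> \<and> a \<in> carrier A}"

definition tensor_algebra_class ::
  "('k, 'a, 'y) module_scheme \<Rightarrow> ('k, 'a, 'g) fodc
    \<Rightarrow> (('a + 'g) list \<Rightarrow>\<^sub>0 int) \<Rightarrow> (('a + 'g) list \<Rightarrow>\<^sub>0 int) set"
  where "tensor_algebra_class A \<Gamma> x =
    (let F = word_ring (carrier A) (carrier \<Gamma>) in (Idl\<^bsub>F\<^esub> (word_rel A \<Gamma>)) +>\<^bsub>F\<^esub> x)"

definition tensor_algebra ::
  "('k, 'a, 'y) module_scheme \<Rightarrow> ('k, 'a, 'g) fodc \<Rightarrow> (('a + 'g) list \<Rightarrow>\<^sub>0 int) set ring"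
  where "tensor_algebra A \<Gamma> =
    (let F = word_ring (carrier A) (carrier \<Gamma>) in F Quot (Idl\<^bsub>F\<^esub> (word_rel A \<Gamma>)))"

definition prolongation_ideal ::
  "('k, 'a, 'y) module_scheme \<Rightarrow> ('k, 'a, 'g) fodc \<Rightarrow> (('a + 'g) list \<Rightarrow>\<^sub>0 int) set set"
  where "prolongation_ideal A \<Gamma> =
    (let T = tensor_algebra A \<Gamma>;
         \<gamma> = (\<lambda>x. tensor_algebra_class A \<Gamma> (frag_of [Inr x]))
     in Idl\<^bsub>T\<^esub> {finsum T (\<lambda>i. \<gamma> (dif \<Gamma> (a i)) \<otimes>\<^bsub>T\<^esub> \<gamma> (dif \<Gamma> (b i))) {..<n} | (n :: nat) a b.
          a \<in> {..<n} \<rightarrow> carrier A \<and> b \<in> {..<n} \<rightarrow> carrier A \<and>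
          finsum \<Gamma> (\<lambda>i. lact \<Gamma> (a i) (dif \<Gamma> (b i))) {..<n} = \<zero>\<^bsub>\<Gamma>\<^esub>})"

text \<open>The differential is
  \<open>\<Sum>\<^sub>i a\<^sub>i da\<^sub>i\<^sub>1 \<and> \<dots> \<and> da\<^sub>i\<^sub>n \<mapsto> \<Sum>\<^sub>i da\<^sub>i \<and> da\<^sub>i\<^sub>1 \<and> \<dots> \<and> da\<^sub>i\<^sub>n\<close>.\<close>

definition max_prolongation ::
  "('k, 'x) ring_scheme \<Rightarrow> ('k, 'a, 'y) module_scheme \<Rightarrow> ('k, 'a, 'g) fodc
    \<Rightarrow> ('k, 'a, (('a + 'g) list \<Rightarrow>\<^sub>0 int) set set) dcalc"
  where "max_prolongation K A \<Gamma> =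
    (let T = tensor_algebra A \<Gamma>;
         I = prolongation_ideal A \<Gamma>;
         Q = T Quot I;
         cls = (\<lambda>x. I +>\<^bsub>T\<^esub> tensor_algebra_class A \<Gamma> x);
         \<alpha> = (\<lambda>a. cls (frag_of [Inl a]));
         da = (\<lambda>a. cls (frag_of [Inr (dif \<Gamma> a)]));
         wedge = (\<lambda>ws. foldr (\<lambda>v w. v \<otimes>\<^bsub>Q\<^esub> w) ws \<one>\<^bsub>Q\<^esub>)
     in \<lparr>carrier = carrier Q, monoid.mult = monoid.mult Q, one = one Q, ring.zero = ring.zero Q, add = add Q,
         smult = (\<lambda>c w. \<alpha> (c \<odot>\<^bsub>A\<^esub> \<one>\<^bsub>A\<^esub>) \<otimes>\<^bsub>Q\<^esub> w),
         degr = (\<lambda>n. {cls x | x. x \<in> carrier (word_ring (carrier A) (carrier \<Gamma>)) \<and>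
           (\<forall>u\<in>Poly_Mapping.keys x. length (filter (\<lambda>s. \<not> isl s) u) = n)}),
         dd = (\<lambda>n w. THE w'. \<exists>m (a :: nat \<Rightarrow> 'a) as.
           (\<forall>i<m. a i \<in> carrier A \<and> as i \<in> lists (carrier A) \<and> length (as i) = n) \<and>
           w = finsum Q (\<lambda>i. \<alpha> (a i) \<otimes>\<^bsub>Q\<^esub> wedge (map da (as i))) {..<m} \<and>
           w' = finsum Q (\<lambda>i. da (a i) \<otimes>\<^bsub>Q\<^esub> wedge (map da (as i))) {..<m}),
         emb = \<alpha>\<rparr>)"


section \<open>First order completeness\<close>

text \<open>The calculus \<open>(\<Gamma>A \<otimes> H) \<oplus> (A \<otimes> \<Gamma>H)\<close> on \<open>A \<otimes> H\<close>, with componentwise bimodule structure.\<close>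

definition tensor_fodc ::
  "('k, 'x) ring_scheme \<Rightarrow> ('k, 'a, 'y) module_scheme \<Rightarrow> ('k, 'h, 'z) module_scheme
    \<Rightarrow> ('k, 'a, 'ga) fodc \<Rightarrow> ('k, 'h, 'gh) fodc
    \<Rightarrow> ('k, ('a \<times> 'h \<Rightarrow>\<^sub>0 int) set, ('ga \<times> 'h \<Rightarrow>\<^sub>0 int) set \<times> ('a \<times> 'gh \<Rightarrow>\<^sub>0 int) set) fodc"
  where "tensor_fodc K A H \<Gamma>A \<Gamma>H =
    (let P = tensor K \<Gamma>A H; Q = tensor K A \<Gamma>H in
      \<lparr>carrier = carrier P \<times> carrier Q,
       monoid.mult = undefined, one = undefined,
       ring.zero = (\<zero>\<^bsub>P\<^esub>, \<zero>\<^bsub>Q\<^esub>),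
       add = (\<lambda>(p, q) (p', q'). (p \<oplus>\<^bsub>P\<^esub> p', q \<oplus>\<^bsub>Q\<^esub> q')),
       smult = (\<lambda>c (p, q). (c \<odot>\<^bsub>P\<^esub> p, c \<odot>\<^bsub>Q\<^esub> q)),
       lact = (\<lambda>t (p, q).
         (tensor_lift P t (\<lambda>a h. tensor_lift P p (\<lambda>x g. pure_tensor P (lact \<Gamma>A a x) (h \<otimes>\<^bsub>H\<^esub> g))),
          tensor_lift Q t (\<lambda>a h. tensor_lift Q q (\<lambda>b y. pure_tensor Q (a \<otimes>\<^bsub>A\<^esub> b) (lact \<Gamma>H h y))))),
       ract = (\<lambda>(p, q) t.
         (tensor_lift P t (\<lambda>a h. tensor_lift P p (\<lambda>x g. pure_tensor P (ract \<Gamma>A x a) (g \<otimes>\<^bsub>H\<^esub> h))),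
          tensor_lift Q t (\<lambda>a h. tensor_lift Q q (\<lambda>b y. pure_tensor Q (b \<otimes>\<^bsub>A\<^esub> a) (ract \<Gamma>H y h))))),
       dif = (\<lambda>t.
         (tensor_lift P t (\<lambda>a h. pure_tensor P (dif \<Gamma>A a) h),
          tensor_lift Q t (\<lambda>a h. pure_tensor Q a (dif \<Gamma>H h))))\<rparr>)"

definition is_first_order_coaction ::
  "('k, 'x) ring_scheme \<Rightarrow> ('k, 'h) hopf \<Rightarrow> ('k, 'a, 'y) module_scheme
    \<Rightarrow> ('a \<Rightarrow> ('a \<times> 'h \<Rightarrow>\<^sub>0 int) set) \<Rightarrow> ('k, 'h, 'gh) fodc \<Rightarrow> ('k, 'a, 'w) dcalc
    \<Rightarrow> ('w \<Rightarrow> ('w \<times> 'h \<Rightarrow>\<^sub>0 int) set \<times> ('a \<times> 'gh \<Rightarrow>\<^sub>0 int) set) \<Rightarrow> bool"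
  where "is_first_order_coaction K H A \<delta> \<Gamma>H \<Omega> \<Phi> \<longleftrightarrow>
    fodc_map K A \<delta> (truncation \<Omega>) (tensor_fodc K A H (truncation \<Omega>) \<Gamma>H) \<Phi>"

definition first_order_complete ::
  "('k, 'x) ring_scheme \<Rightarrow> ('k, 'h) hopf \<Rightarrow> ('k, 'a, 'y) module_scheme
    \<Rightarrow> ('a \<Rightarrow> ('a \<times> 'h \<Rightarrow>\<^sub>0 int) set) \<Rightarrow> ('k, 'h, 'gh) fodc \<Rightarrow> ('k, 'a, 'w) dcalc \<Rightarrow> bool"
  where "first_order_complete K H A \<delta> \<Gamma>H \<Omega> \<longleftrightarrow> (\<exists>\<Phi>. is_first_order_coaction K H A \<delta> \<Gamma>H \<Omega> \<Phi>)"

definition horizontal_forms ::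
  "('k, 'x) ring_scheme \<Rightarrow> ('k, 'h) hopf \<Rightarrow> ('k, 'a, 'y) module_scheme
    \<Rightarrow> ('a \<Rightarrow> ('a \<times> 'h \<Rightarrow>\<^sub>0 int) set) \<Rightarrow> ('k, 'h, 'gh) fodc \<Rightarrow> ('k, 'a, 'w) dcalc \<Rightarrow> 'w set"
  where "horizontal_forms K H A \<delta> \<Gamma>H \<Omega> =
    (let \<Phi> = (SOME \<Phi>. is_first_order_coaction K H A \<delta> \<Gamma>H \<Omega> \<Phi>) in
      {w \<in> degr \<Omega> 1.
        \<Phi> w \<in> carrier (tensor K (truncation \<Omega>) H) \<times> {\<zero>\<^bsub>tensor K A \<Gamma>H\<^esub>}})"

end

theory Submission
  imports Defs
begin

text \<open>
  For \<open>h\<close> in \<open>H\<close> put \<open>\<varpi> h = S h\<^sub>1 d h\<^sub>2\<close>, a left coinvariant form with \<open>d h = h\<^sub>1 \<varpi> h\<^sub>2\<close>, and let \<open>\<pi>\<close> be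
  the projection \<open>\<omega> \<mapsto> S (\<omega>\<^sub>-\<^sub>1) \<omega>\<^sub>0\<close> of \<open>\<Gamma>H\<close> onto the left coinvariant forms, so that
  \<open>\<pi> (h d g) = \<epsilon> h \<varpi> g\<close>.  The \<open>A \<otimes> \<Gamma>H\<close>-component of the first order coaction and the vertical map
  are \<open>a d a' \<mapsto> a\<^sub>0 a'\<^sub>0 \<otimes> a\<^sub>1 d a'\<^sub>1\<close> and \<open>a d a' \<mapsto> a a'\<^sub>0 \<otimes> \<varpi> a'\<^sub>1\<close>.  Applying \<open>id \<otimes> \<pi>\<close> to the first
  gives the second, and applying \<open>a \<otimes> \<omega> \<mapsto> a\<^sub>0 \<otimes> a\<^sub>1 \<omega>\<close> to the second gives the first: each exists
  as soon as the other does, and they have the same kernel.  The vertical map is onto because the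
  canonical map of the Hopf--Galois extension is onto and every left coinvariant form is some \<open>\<varpi> h\<close>.
  For the maximal prolongation it remains to see that its forms of degree one are those of \<open>\<Gamma>A\<close>:
  they are detected by the homomorphism from words to the square-zero extension of \<open>A\<close> by \<open>\<Gamma>A\<close>.
\<close>


section \<open>Balanced tensor products\<close>

text \<open>Every map on a calculus is prescribed only on the forms \<open>a d b\<close>, which span
  it but satisfy unknown relations, so a formula on them defines nothing. Existence has to come from
  composing maps that are already given; uniqueness is free, since linear maps with equal values on
  a spanning set agree. For this reason the kernels are compared without computing any composite of
  the two transfer maps.

  The usual computation that \<open>varpi h\<close> is coinvariant uses that the antipode reverses
  the coproduct. That law is not among the axioms of \<open>hopf_algebra\<close>; it is avoided by
  cancelling in the convolution product, where the antipode is by definition inverse to the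
  identity.

  A map known on the forms \<open>a d b\<close> must also respect right multiplication, which does
  not preserve them; the Leibniz rule supplies this.

  The forms of degree one of the maximal prolongation are classes of combinations of words, not
  elements of the given calculus, so all structure is carried over along an isomorphism. The
  differential of the prolongation is a definite description over all presentations of an element,
  so already its value on functions needs \<open>A\<close> to embed.\<close>

definition balanced_map ::
  "'s set \<Rightarrow> ('m, 'x) ring_scheme \<Rightarrow> ('m \<Rightarrow> 's \<Rightarrow> 'm) \<Rightarrow> ('n, 'y) ring_scheme \<Rightarrow> ('s \<Rightarrow> 'n \<Rightarrow> 'n)
    \<Rightarrow> ('p, 'z) ring_scheme \<Rightarrow> ('m \<Rightarrow> 'n \<Rightarrow> 'p) \<Rightarrow> bool"
  where "balanced_map S M r N l P f \<longleftrightarrow>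
    (\<forall>m\<in>carrier M. \<forall>n\<in>carrier N. f m n \<in> carrier P) \<and>
    (\<forall>m\<in>carrier M. \<forall>m'\<in>carrier M. \<forall>n\<in>carrier N. f (m \<oplus>\<^bsub>M\<^esub> m') n = f m n \<oplus>\<^bsub>P\<^esub> f m' n) \<and>
    (\<forall>m\<in>carrier M. \<forall>n\<in>carrier N. \<forall>n'\<in>carrier N. f m (n \<oplus>\<^bsub>N\<^esub> n') = f m n \<oplus>\<^bsub>P\<^esub> f m n') \<and>
    (\<forall>m\<in>carrier M. \<forall>s\<in>S. \<forall>n\<in>carrier N. f (r m s) n = f m (l s n))"

text \<open>The additive extension of \<open>f\<close> to integral combinations.
  \<open>tensor_lift\<close> applies this sum to all representatives of a tensor, and the words of
  the maximal prolongation are evaluated by it as well.\<close>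

definition frag_eval :: "('p, 'z) ring_scheme \<Rightarrow> ('i \<Rightarrow> 'p) \<Rightarrow> ('i \<Rightarrow>\<^sub>0 int) \<Rightarrow> 'p"
  where "frag_eval P f x = finsum P (\<lambda>i. add_pow P (Poly_Mapping.lookup x i) (f i)) (Poly_Mapping.keys x)"

text \<open>Two combinations have different supports, so their sums can be added only over a common
  finite index set; indices outside the support have coefficient 0 and contribute nothing.\<close>

lemma (in abelian_group) frag_eval_superset:
  assumes "finite I" "Poly_Mapping.keys x \<subseteq> I" "f \<in> I \<rightarrow> carrier G"
  shows "frag_eval G f x = finsum G (\<lambda>i. add_pow G (Poly_Mapping.lookup x i) (f i)) I"
proof -
  have "add_pow G (0 :: int) y = \<zero>" for y by (simp add: add_pow_def)
  then show ?thesis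
    unfolding frag_eval_def
    by (intro add.finprod_mono_neutral_cong_left) (use assms in \<open>auto simp: in_keys_iff Pi_iff\<close>)
qed

lemma (in abelian_group) frag_eval_closed:
  assumes "Poly_Mapping.keys x \<subseteq> I" "f \<in> I \<rightarrow> carrier G"
  shows "frag_eval G f x \<in> carrier G"
  unfolding frag_eval_def using assms by (intro finsum_closed) auto

lemma (in abelian_group) frag_eval_add:
  assumes "Poly_Mapping.keys x \<subseteq> I" "Poly_Mapping.keys y \<subseteq> I" "f \<in> I \<rightarrow> carrier G"
  shows "frag_eval G f (x + y) = frag_eval G f x \<oplus> frag_eval G f y"
proof -
  let ?J = "Poly_Mapping.keys x \<union> Poly_Mapping.keys y"
  have J: "finite ?J" "f \<in> ?J \<rightarrow> carrier G" "Poly_Mapping.keys (x + y) \<subseteq> ?J"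
    using assms keys_add[of x y] by auto
  have "frag_eval G f (x + y) = (\<Oplus>i\<in>?J. add_pow G (Poly_Mapping.lookup x i) (f i) \<oplus>
      add_pow G (Poly_Mapping.lookup y i) (f i))"
    unfolding frag_eval_superset[OF J(1,3,2)]
    by (rule finsum_cong') (use J(2) in \<open>auto simp: lookup_add add.int_pow_mult Pi_iff\<close>)
  also have "\<dots> = frag_eval G f x \<oplus> frag_eval G f y"
    unfolding frag_eval_superset[OF J(1) Un_upper1 J(2)] frag_eval_superset[OF J(1) Un_upper2 J(2)]
    by (rule finsum_addf) (use J(2) in auto)
  finally show ?thesis .
qed

lemma (in abelian_group) frag_eval_of:
  "f i \<in> carrier G \<Longrightarrow> frag_eval G f (frag_of i) = f i"
  unfolding frag_eval_def by simp

lemma (in abelian_group) frag_eval_zero: "frag_eval G f 0 = \<zero>"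
  unfolding frag_eval_def by simp

text \<open>Additivity applied to \<open>x = (x - y) + y\<close>, so that negatives need no law of
  their own.\<close>

lemma (in abelian_group) frag_eval_diff:
  assumes "Poly_Mapping.keys x \<subseteq> I" "Poly_Mapping.keys y \<subseteq> I" "f \<in> I \<rightarrow> carrier G"
  shows "frag_eval G f (x - y) = frag_eval G f x \<ominus> frag_eval G f y"
proof -
  have *: "Poly_Mapping.keys (x - y) \<subseteq> I" using assms keys_diff[of x y] by auto
  have "frag_eval G f x = frag_eval G f (x - y) \<oplus> frag_eval G f y"
    using frag_eval_add[OF * assms(2,3)] by simp
  then show ?thesis
    using frag_eval_closed[OF * assms(3)] frag_eval_closed[OF assms(2,3)]
    by (simp add: a_minus_def a_assoc r_neg)
qed

section \<open>The balanced tensor product as a quotient group, with its universal property\<close>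

locale balanced_data =
  M: abelian_group M + N: abelian_group N
  for S :: "'s set" and M :: "('m, 'x) ring_scheme" and r and N :: "('n, 'y) ring_scheme" and l +
  assumes r_closed: "m \<in> carrier M \<Longrightarrow> s \<in> S \<Longrightarrow> r m s \<in> carrier M"
    and l_closed: "n \<in> carrier N \<Longrightarrow> s \<in> S \<Longrightarrow> l s n \<in> carrier N"
begin

abbreviation "F \<equiv> free_Abelian_group (carrier M \<times> carrier N)"
abbreviation "U \<equiv> generate F (tensor_rel S M r N l)"
abbreviation "T \<equiv> balanced_tensor S M r N l"

lemma rel_closed: "tensor_rel S M r N l \<subseteq> carrier F"
proof
  fix x assume "x \<in> tensor_rel S M r N l"
  then show "x \<in> carrier F"
    unfolding tensor_rel_def using r_closed l_closed
    by (auto dest!: subsetD[OF keys_diff] split: if_splits)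
qed

lemma subgroup_U: "subgroup U F"
  by (rule group.generate_is_subgroup[OF group_free_Abelian_group rel_closed])

lemma normal_U: "U \<lhd> F"
  by (simp add: abelian_free_Abelian_group comm_group.subgroup_imp_normal subgroup_U)

lemma carrier_T: "carrier T = (\<lambda>x. U #>\<^bsub>F\<^esub> x) ` carrier F"
  by (simp add: balanced_tensor_def Let_def carrier_FactGroup)

lemma coset_eqI: "x \<in> U #>\<^bsub>F\<^esub> y \<Longrightarrow> y \<in> carrier F \<Longrightarrow> U #>\<^bsub>F\<^esub> y = U #>\<^bsub>F\<^esub> x"
  by (rule group.repr_independence[OF group_free_Abelian_group _ _ subgroup_U])

lemma coset_self: "x \<in> carrier F \<Longrightarrow> x \<in> U #>\<^bsub>F\<^esub> x"
  by (rule group.rcos_self[OF group_free_Abelian_group _ subgroup_U])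

lemma add_coset:
  "x \<in> carrier F \<Longrightarrow> y \<in> carrier F \<Longrightarrow> (U #>\<^bsub>F\<^esub> x) \<oplus>\<^bsub>T\<^esub> (U #>\<^bsub>F\<^esub> y) = U #>\<^bsub>F\<^esub> (x + y)"
  using normal.rcos_sum[OF normal_U, of x y] by (simp add: balanced_tensor_def Let_def)

lemma abelian_group_T: "abelian_group T"
proof -
  have "comm_group (F Mod U)"
    by (rule comm_group.abelian_FactGroup[OF abelian_free_Abelian_group subgroup_U])
  moreover have "add_monoid T = F Mod U"
    by (simp add: balanced_tensor_def Let_def FactGroup_def)
  ultimately show ?thesis
    by (simp add: abelian_group_def abelian_monoid_def abelian_group_axioms_def comm_group_def)
qed

lemma pure_coset:
  assumes "m \<in> carrier M" "n \<in> carrier N"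
  shows "pure_tensor T m n = U #>\<^bsub>F\<^esub> frag_of (m, n)"
  unfolding pure_tensor_def
proof (rule the_equality)
  have f: "frag_of (m, n) \<in> carrier F" using assms by simp
  show "U #>\<^bsub>F\<^esub> frag_of (m, n) \<in> carrier T \<and> frag_of (m, n) \<in> U #>\<^bsub>F\<^esub> frag_of (m, n)"
    using f coset_self[OF f] by (auto simp: carrier_T simp del: frag_of_in_free_Abelian_group)
  show "X = U #>\<^bsub>F\<^esub> frag_of (m, n)" if "X \<in> carrier T \<and> frag_of (m, n) \<in> X" for X
    using that coset_eqI by (auto simp: carrier_T)
qed

lemma pure_closed: "m \<in> carrier M \<Longrightarrow> n \<in> carrier N \<Longrightarrow> pure_tensor T m n \<in> carrier T"
  by (simp add: pure_coset carrier_T image_iff) (metis carrier_free_Abelian_group_iff frag_of_in_free_Abelian_group mem_Sigma_iff)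

lemma coset_rel:
  assumes "x \<in> carrier F" "y \<in> carrier F" "x - y \<in> tensor_rel S M r N l"
  shows "U #>\<^bsub>F\<^esub> x = U #>\<^bsub>F\<^esub> y"
proof -
  have "x = (x - y) \<otimes>\<^bsub>F\<^esub> y" by simp
  moreover have "x - y \<in> U" using assms(3) by (rule generate.incl)
  ultimately have "x \<in> U #>\<^bsub>F\<^esub> y" unfolding r_coset_def by blast
  then show ?thesis using assms(2) coset_eqI by metis
qed

lemma balanced_pure: "balanced_map S M r N l T (pure_tensor T)"
  unfolding balanced_map_def
proof (intro conjI ballI)
  fix m m' n assume *: "m \<in> carrier M" "m' \<in> carrier M" "n \<in> carrier N"
  have "U #>\<^bsub>F\<^esub> frag_of (m \<oplus>\<^bsub>M\<^esub> m', n) = U #>\<^bsub>F\<^esub> (frag_of (m, n) + frag_of (m', n))"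
    using * keys_add[of "frag_of (m, n)" "frag_of (m', n)"]
    by (intro coset_rel) (auto simp: tensor_rel_def diff_diff_eq split: if_splits)
  then show "pure_tensor T (m \<oplus>\<^bsub>M\<^esub> m') n = pure_tensor T m n \<oplus>\<^bsub>T\<^esub> pure_tensor T m' n"
    using * by (simp add: pure_coset add_coset)
next
  fix m n n' assume *: "m \<in> carrier M" "n' \<in> carrier N" "n \<in> carrier N"
  have "U #>\<^bsub>F\<^esub> frag_of (m, n \<oplus>\<^bsub>N\<^esub> n') = U #>\<^bsub>F\<^esub> (frag_of (m, n) + frag_of (m, n'))"
    using * keys_add[of "frag_of (m, n)" "frag_of (m, n')"]
    by (intro coset_rel) (auto simp: tensor_rel_def diff_diff_eq split: if_splits)
  then show "pure_tensor T m (n \<oplus>\<^bsub>N\<^esub> n') = pure_tensor T m n \<oplus>\<^bsub>T\<^esub> pure_tensor T m n'"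
    using * by (simp add: pure_coset add_coset)
next
  fix m s n assume *: "m \<in> carrier M" "s \<in> S" "n \<in> carrier N"
  have "U #>\<^bsub>F\<^esub> frag_of (r m s, n) = U #>\<^bsub>F\<^esub> frag_of (m, l s n)"
    using * r_closed l_closed
    by (intro coset_rel) (auto simp: tensor_rel_def)
  then show "pure_tensor T (r m s) n = pure_tensor T m (l s n)"
    using * r_closed l_closed by (simp add: pure_coset)
qed (simp add: pure_closed)

text \<open>Zero and negatives need no case of their own: zero is the pure tensor of two zeros, and
  the negative of a pure tensor is pure because the sign moves into the first factor.\<close>

lemma tensor_induct:
  assumes t: "t \<in> carrier T"
    and P: "\<And>m n. m \<in> carrier M \<Longrightarrow> n \<in> carrier N \<Longrightarrow> P (pure_tensor T m n)"
    and add: "\<And>s t. s \<in> carrier T \<Longrightarrow> t \<in> carrier T \<Longrightarrow> P s \<Longrightarrow> P t \<Longrightarrow> P (s \<oplus>\<^bsub>T\<^esub> t)"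
  shows "P t"
proof -
  interpret T: abelian_group T by (rule abelian_group_T)
  have b: "pure_tensor T (m \<oplus>\<^bsub>M\<^esub> m') n = pure_tensor T m n \<oplus>\<^bsub>T\<^esub> pure_tensor T m' n"
    if "m \<in> carrier M" "m' \<in> carrier M" "n \<in> carrier N" for m m' n
    using balanced_pure that unfolding balanced_map_def by blast
  have zero: "pure_tensor T \<zero>\<^bsub>M\<^esub> n = \<zero>\<^bsub>T\<^esub>" if n: "n \<in> carrier N" for n
    using b[of "\<zero>\<^bsub>M\<^esub>" "\<zero>\<^bsub>M\<^esub>" n] n pure_closed[of "\<zero>\<^bsub>M\<^esub>" n]
    by (simp add: T.add.l_cancel_one')
  have neg: "\<ominus>\<^bsub>T\<^esub> pure_tensor T m n = pure_tensor T (\<ominus>\<^bsub>M\<^esub> m) n"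
    if m: "m \<in> carrier M" and n: "n \<in> carrier N" for m n
    using b[of "\<ominus>\<^bsub>M\<^esub> m" m n] m n zero[OF n] pure_closed[of _ n] by (simp add: M.l_neg T.minus_equality)
  have z: "\<zero>\<^bsub>T\<^esub> = U #>\<^bsub>F\<^esub> 0"
    using subgroup.rcos_const[OF subgroup_U group_free_Abelian_group, of 0] subgroup.one_closed[OF subgroup_U]
    by (simp add: balanced_tensor_def Let_def)
  have P0: "P \<zero>\<^bsub>T\<^esub>"
    using P[of "\<zero>\<^bsub>M\<^esub>" "\<zero>\<^bsub>N\<^esub>"] zero[of "\<zero>\<^bsub>N\<^esub>"] by simp
  obtain x where x: "x \<in> carrier F" "t = U #>\<^bsub>F\<^esub> x" using t by (auto simp: carrier_T)
  have closed: "U #>\<^bsub>F\<^esub> y \<in> carrier T" if "y \<in> carrier F" for y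
    using that unfolding carrier_T by blast
  have neg': "U #>\<^bsub>F\<^esub> (- y) = \<ominus>\<^bsub>T\<^esub> (U #>\<^bsub>F\<^esub> y)" if "y \<in> carrier F" for y
  proof -
    have y: "- y \<in> carrier F" using that by simp
    show ?thesis
      by (rule T.minus_equality[symmetric]) (use that y closed add_coset[OF y that] z in auto)
  qed
  have "Poly_Mapping.keys x \<subseteq> carrier M \<times> carrier N" using x(1) by simp
  \<comment> \<open>The induction on the free group runs over differences, so the claim is carried
    for a coset together with its negative.\<close>
  then have "P (U #>\<^bsub>F\<^esub> x) \<and> P (\<ominus>\<^bsub>T\<^esub> (U #>\<^bsub>F\<^esub> x))"
  proof (induction x rule: free_Abelian_group_induct[consumes 1, case_names zero diff of])
    case zero
    have "\<ominus>\<^bsub>T\<^esub> \<zero>\<^bsub>T\<^esub> = \<zero>\<^bsub>T\<^esub>" by (rule T.minus_equality) simp_all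
    then show ?case using P0 z by simp
  next
    case (diff x y)
    have xy: "x \<in> carrier F" "y \<in> carrier F" "- x \<in> carrier F" "- y \<in> carrier F" using diff by auto
    have e: "U #>\<^bsub>F\<^esub> (x - y) = (U #>\<^bsub>F\<^esub> x) \<oplus>\<^bsub>T\<^esub> \<ominus>\<^bsub>T\<^esub> (U #>\<^bsub>F\<^esub> y)"
      using add_coset[OF xy(1,4)] neg'[OF xy(2)] by simp
    have e': "\<ominus>\<^bsub>T\<^esub> (U #>\<^bsub>F\<^esub> (x - y)) = \<ominus>\<^bsub>T\<^esub> (U #>\<^bsub>F\<^esub> x) \<oplus>\<^bsub>T\<^esub> (U #>\<^bsub>F\<^esub> y)"
      unfolding e using closed[OF xy(1)] closed[OF xy(2)] by (simp add: T.minus_add)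
    show ?case unfolding e' unfolding e
      using diff closed[OF xy(1)] closed[OF xy(2)] by (auto intro!: add)
  next
    case (of p)
    then obtain m n where "p = (m, n)" "m \<in> carrier M" "n \<in> carrier N" by auto
    then show ?case using P neg by (simp add: pure_coset[symmetric])
  qed
  then show ?thesis using x by simp
qed

context
  fixes P :: "('p, 'z) ring_scheme" and f
  assumes P: "abelian_group P" and f: "balanced_map S M r N l P f"
begin

interpretation P: abelian_group P by (rule P)

lemma eval_funcset: "(\<lambda>p. f (fst p) (snd p)) \<in> carrier M \<times> carrier N \<rightarrow> carrier P"
  using f unfolding balanced_map_def by auto

lemmas eval_add = P.frag_eval_add[OF _ _ eval_funcset]
lemmas eval_diff = P.frag_eval_diff[OF _ _ eval_funcset]
lemmas eval_closed = P.frag_eval_closed[OF _ eval_funcset]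

lemma eval_of:
  "m \<in> carrier M \<Longrightarrow> n \<in> carrier N \<Longrightarrow> frag_eval P (\<lambda>p. f (fst p) (snd p)) (frag_of (m, n)) = f m n"
  using f by (subst P.frag_eval_of) (auto simp: balanced_map_def)

lemma eval_rel:
  assumes "u \<in> tensor_rel S M r N l"
  shows "frag_eval P (\<lambda>p. f (fst p) (snd p)) u = \<zero>\<^bsub>P\<^esub>"
proof -
  have k: "Poly_Mapping.keys (frag_of p - frag_of q) \<subseteq> carrier M \<times> carrier N"
    if "p \<in> carrier M \<times> carrier N" "q \<in> carrier M \<times> carrier N" for p q :: "'m \<times> 'n"
    using keys_diff[of "frag_of p" "frag_of q"] that by auto
  have fc: "f m n \<in> carrier P" if "m \<in> carrier M" "n \<in> carrier N" for m n
    using f that unfolding balanced_map_def by auto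
  have fl: "f (m \<oplus>\<^bsub>M\<^esub> m') n = f m n \<oplus>\<^bsub>P\<^esub> f m' n"
    if "m \<in> carrier M" "m' \<in> carrier M" "n \<in> carrier N" for m m' n
    using f that unfolding balanced_map_def by auto
  have fr: "f m (n \<oplus>\<^bsub>N\<^esub> n') = f m n \<oplus>\<^bsub>P\<^esub> f m n'"
    if "m \<in> carrier M" "n' \<in> carrier N" "n \<in> carrier N" for m n n'
    using f that unfolding balanced_map_def by auto
  have fs: "f (r m s) n = f m (l s n)"
    if "m \<in> carrier M" "s \<in> S" "n \<in> carrier N" for m n s
    using f that unfolding balanced_map_def by auto
  have c: "a \<oplus>\<^bsub>P\<^esub> b \<ominus>\<^bsub>P\<^esub> a \<ominus>\<^bsub>P\<^esub> b = \<zero>\<^bsub>P\<^esub>" if "a \<in> carrier P" "b \<in> carrier P" for a b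
  proof -
    have "a \<oplus>\<^bsub>P\<^esub> b \<ominus>\<^bsub>P\<^esub> a \<ominus>\<^bsub>P\<^esub> b = (a \<oplus>\<^bsub>P\<^esub> b) \<oplus>\<^bsub>P\<^esub> \<ominus>\<^bsub>P\<^esub> (a \<oplus>\<^bsub>P\<^esub> b)"
      using that by (simp add: a_minus_def P.minus_add P.a_assoc)
    then show ?thesis using that by (simp add: P.r_neg)
  qed
  show ?thesis
    using assms unfolding tensor_rel_def
  proof (elim UnE CollectE exE conjE)
    fix m m' n assume *: "u = frag_of (m \<oplus>\<^bsub>M\<^esub> m', n) - frag_of (m, n) - frag_of (m', n)"
      "m \<in> carrier M" "m' \<in> carrier M" "n \<in> carrier N"
    then show ?thesis by (simp add: eval_diff k eval_of fl c fc)
  next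
    fix m n n' assume *: "u = frag_of (m, n \<oplus>\<^bsub>N\<^esub> n') - frag_of (m, n) - frag_of (m, n')"
      "m \<in> carrier M" "n \<in> carrier N" "n' \<in> carrier N"
    then show ?thesis by (simp add: eval_diff k eval_of fr c fc)
  next
    fix m s n assume *: "u = frag_of (r m s, n) - frag_of (m, l s n)"
      "m \<in> carrier M" "s \<in> S" "n \<in> carrier N"
    then show ?thesis
      by (simp add: eval_diff eval_of r_closed l_closed fs fc a_minus_def P.r_neg)
  qed
qed

text \<open>Membership in the free group is carried along because the evaluation is additive only on
  combinations supported on the two carriers.\<close>

lemma eval_generate:
  assumes "u \<in> U"
  shows "frag_eval P (\<lambda>p. f (fst p) (snd p)) u = \<zero>\<^bsub>P\<^esub> \<and> u \<in> carrier F"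
  using assms
proof (induction u rule: generate.induct)
  case (inv h)
  then have h: "Poly_Mapping.keys h \<subseteq> carrier M \<times> carrier N"
    using subsetD[OF rel_closed inv] by simp
  have "frag_eval P (\<lambda>p. f (fst p) (snd p)) (0 - h) = \<zero>\<^bsub>P\<^esub>"
    using h eval_diff[of 0 h] eval_rel[OF inv] by (simp add: P.frag_eval_zero a_minus_def)
  then show ?case using h by simp
next
  case (eng h1 h2)
  then show ?case using keys_add[of h1 h2] by (auto simp: eval_add)
next
  case (incl h)
  then show ?case using subsetD[OF rel_closed incl] by (simp add: eval_rel)
qed (simp add: P.frag_eval_zero)

text \<open>The relations evaluate to zero, so all representatives of a tensor have the same value
  and \<open>the_elem\<close> reads it off a singleton.\<close>

lemma lift_coset:
  assumes "x \<in> carrier F"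
  shows "tensor_lift P (U #>\<^bsub>F\<^esub> x) f = frag_eval P (\<lambda>p. f (fst p) (snd p)) x"
proof -
  have x: "Poly_Mapping.keys x \<subseteq> carrier M \<times> carrier N" using assms by simp
  have "frag_eval P (\<lambda>p. f (fst p) (snd p)) ` (U #>\<^bsub>F\<^esub> x) = {frag_eval P (\<lambda>p. f (fst p) (snd p)) x}"
  proof (intro equalityI subsetI)
    fix y assume "y \<in> frag_eval P (\<lambda>p. f (fst p) (snd p)) ` (U #>\<^bsub>F\<^esub> x)"
    then obtain u where u: "u \<in> U" "y = frag_eval P (\<lambda>p. f (fst p) (snd p)) (u + x)"
      unfolding r_coset_def by auto
    then show "y \<in> {frag_eval P (\<lambda>p. f (fst p) (snd p)) x}"
      using eval_generate[OF u(1)] x by (simp add: eval_add eval_closed)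
  next
    fix y assume "y \<in> {frag_eval P (\<lambda>p. f (fst p) (snd p)) x}"
    then show "y \<in> frag_eval P (\<lambda>p. f (fst p) (snd p)) ` (U #>\<^bsub>F\<^esub> x)"
      using coset_self[OF assms] by auto
  qed
  then show ?thesis by (simp add: tensor_lift_def frag_eval_def)
qed

lemma lift_closed: "t \<in> carrier T \<Longrightarrow> tensor_lift P t f \<in> carrier P"
  by (auto simp: carrier_T lift_coset eval_closed)

lemma lift_add:
  "s \<in> carrier T \<Longrightarrow> t \<in> carrier T \<Longrightarrow>
    tensor_lift P (s \<oplus>\<^bsub>T\<^esub> t) f = tensor_lift P s f \<oplus>\<^bsub>P\<^esub> tensor_lift P t f"
  using keys_add
  by (auto simp: carrier_T add_coset) (subst (1 2 3) lift_coset; fastforce simp: eval_add)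

lemma lift_pure:
  "m \<in> carrier M \<Longrightarrow> n \<in> carrier N \<Longrightarrow> tensor_lift P (pure_tensor T m n) f = f m n"
  by (simp add: pure_coset lift_coset eval_of)

end

end

section \<open>Linear and bilinear maps\<close>

lemma lin_mapI:
  assumes "\<And>x. x \<in> carrier M \<Longrightarrow> f x \<in> carrier N"
    and "\<And>x y. x \<in> carrier M \<Longrightarrow> y \<in> carrier M \<Longrightarrow> f (x \<oplus>\<^bsub>M\<^esub> y) = f x \<oplus>\<^bsub>N\<^esub> f y"
    and "\<And>c x. c \<in> carrier R \<Longrightarrow> x \<in> carrier M \<Longrightarrow> f (c \<odot>\<^bsub>M\<^esub> x) = c \<odot>\<^bsub>N\<^esub> f x"
  shows "lin_map R M N f"
  using assms unfolding lin_map_def by auto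

lemma lin_map_closed: "lin_map R M N f \<Longrightarrow> x \<in> carrier M \<Longrightarrow> f x \<in> carrier N"
  and lin_map_add: "lin_map R M N f \<Longrightarrow> x \<in> carrier M \<Longrightarrow> y \<in> carrier M \<Longrightarrow> f (x \<oplus>\<^bsub>M\<^esub> y) = f x \<oplus>\<^bsub>N\<^esub> f y"
  and lin_map_smult: "lin_map R M N f \<Longrightarrow> c \<in> carrier R \<Longrightarrow> x \<in> carrier M \<Longrightarrow> f (c \<odot>\<^bsub>M\<^esub> x) = c \<odot>\<^bsub>N\<^esub> f x"
  unfolding lin_map_def by auto

lemma lin_map_zero:
  assumes "lin_map R M N f" "abelian_group M" "abelian_group N"
  shows "f \<zero>\<^bsub>M\<^esub> = \<zero>\<^bsub>N\<^esub>"
proof -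
  interpret M: abelian_group M by fact
  interpret N: abelian_group N by fact
  have "f \<zero>\<^bsub>M\<^esub> \<oplus>\<^bsub>N\<^esub> f \<zero>\<^bsub>M\<^esub> = f \<zero>\<^bsub>M\<^esub>"
    using lin_map_add[OF assms(1) M.zero_closed M.zero_closed] by simp
  then show ?thesis
    using lin_map_closed[OF assms(1) M.zero_closed] by (simp add: N.add.l_cancel_one')
qed

lemma lin_map_minus:
  assumes "lin_map R M N f" "abelian_group M" "abelian_group N" "x \<in> carrier M" "y \<in> carrier M"
  shows "f (x \<ominus>\<^bsub>M\<^esub> y) = f x \<ominus>\<^bsub>N\<^esub> f y"
proof -
  interpret M: abelian_group M by fact
  interpret N: abelian_group N by fact
  note c = lin_map_closed[OF assms(1)]
  have "f x = f (x \<ominus>\<^bsub>M\<^esub> y) \<oplus>\<^bsub>N\<^esub> f y"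
    using lin_map_add[OF assms(1), of "x \<ominus>\<^bsub>M\<^esub> y" y] assms(4,5)
    by (simp add: a_minus_def M.a_assoc M.l_neg)
  then show ?thesis
    using assms(4,5) c by (simp add: a_minus_def N.a_assoc N.r_neg)
qed

lemma lin_map_ident: "lin_map R M M (\<lambda>x. x)"
  unfolding lin_map_def by auto

lemma lin_map_comp:
  "lin_map R N P g \<Longrightarrow> lin_map R M N f \<Longrightarrow> lin_map R M P (\<lambda>x. g (f x))"
  by (rule lin_mapI) (simp_all add: lin_map_closed lin_map_add[of R M N f] lin_map_add[of R N P g]
      lin_map_smult[of R M N f] lin_map_smult[of R N P g])

lemma lin_map_cong:
  assumes "lin_map R M N f" "\<And>x. x \<in> carrier M \<Longrightarrow> g x = f x" "module R M"
  shows "lin_map R M N g"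
proof -
  interpret module R M by fact
  show ?thesis using assms(1,2) unfolding lin_map_def by auto
qed

lemma module_carrier_lin_smult:
  assumes "module K M" "c \<in> carrier K"
  shows "lin_map K M M (\<lambda>x. c \<odot>\<^bsub>M\<^esub> x)"
proof -
  interpret module K M by fact
  show ?thesis
    by (rule lin_mapI) (use assms(2) in \<open>simp_all add: smult_r_distr smult_assoc1[symmetric] R.m_comm\<close>)
qed

text \<open>The \<open>K\<close>-linear counterpart of \<open>balanced_map\<close>: homogeneity in
  both arguments yields the balance over \<open>K\<close>, and it makes the induced map on the
  tensor product linear instead of merely additive.\<close>

definition bilin ::
  "('k, 'x) ring_scheme \<Rightarrow> ('k, 'm, 'y) module_scheme \<Rightarrow> ('k, 'n, 'z) module_scheme
    \<Rightarrow> ('k, 'p, 'w) module_scheme \<Rightarrow> ('m \<Rightarrow> 'n \<Rightarrow> 'p) \<Rightarrow> bool"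
  where "bilin R M N P f \<longleftrightarrow>
    (\<forall>n\<in>carrier N. lin_map R M P (\<lambda>m. f m n)) \<and> (\<forall>m\<in>carrier M. lin_map R N P (f m))"

lemma bilinI:
  assumes "\<And>n. n \<in> carrier N \<Longrightarrow> lin_map R M P (\<lambda>m. f m n)"
    and "\<And>m. m \<in> carrier M \<Longrightarrow> lin_map R N P (\<lambda>n. f m n)"
  shows "bilin R M N P f"
  using assms unfolding bilin_def by auto

lemma bilin_left: "bilin R M N P f \<Longrightarrow> n \<in> carrier N \<Longrightarrow> lin_map R M P (\<lambda>m. f m n)"
  and bilin_right: "bilin R M N P f \<Longrightarrow> m \<in> carrier M \<Longrightarrow> lin_map R N P (\<lambda>n. f m n)"
  and bilin_closed: "bilin R M N P f \<Longrightarrow> m \<in> carrier M \<Longrightarrow> n \<in> carrier N \<Longrightarrow> f m n \<in> carrier P"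
  unfolding bilin_def lin_map_def by auto

lemma bilin_cong:
  assumes "bilin R M N P f" "\<And>m n. m \<in> carrier M \<Longrightarrow> n \<in> carrier N \<Longrightarrow> g m n = f m n"
    "module R M" "module R N"
  shows "bilin R M N P g"
  by (intro bilinI lin_map_cong[OF bilin_left[OF assms(1)]] lin_map_cong[OF bilin_right[OF assms(1)]])
    (use assms in auto)

lemma lin_map_bilin1:
  "bilin R M N P f \<Longrightarrow> lin_map R X M g \<Longrightarrow> n \<in> carrier N \<Longrightarrow> lin_map R X P (\<lambda>x. f (g x) n)"
  by (rule lin_map_comp[OF bilin_left])

lemma lin_map_bilin2:
  "bilin R M N P f \<Longrightarrow> lin_map R X N g \<Longrightarrow> m \<in> carrier M \<Longrightarrow> lin_map R X P (\<lambda>x. f m (g x))"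
  by (rule lin_map_comp[OF bilin_right])

lemma bilin_comp:
  assumes "bilin R M N P f" "lin_map R X M g" "lin_map R Y N h"
  shows "bilin R X Y P (\<lambda>x y. f (g x) (h y))"
  by (intro bilinI lin_map_bilin1[OF assms(1,2)] lin_map_bilin2[OF assms(1,3)])
    (use assms(2,3) in \<open>auto dest: lin_map_closed\<close>)

lemma bilin_lin_comp:
  assumes "lin_map R P Q g" "bilin R M N P f"
  shows "bilin R M N Q (\<lambda>x y. g (f x y))"
  by (intro bilinI lin_map_comp[OF assms(1)] bilin_left[OF assms(2)] bilin_right[OF assms(2)])

lemma bilin_flip: "bilin R M N P f \<Longrightarrow> bilin R N M P (\<lambda>x y. f y x)"
  unfolding bilin_def by auto

lemma lin_map_add_maps:
  assumes "module K X" "module K P" "lin_map K X P f" "lin_map K X P g"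
  shows "lin_map K X P (\<lambda>x. f x \<oplus>\<^bsub>P\<^esub> g x)"
proof (rule lin_mapI)
  interpret X: module K X by fact
  interpret P: module K P by fact
  show "f x \<oplus>\<^bsub>P\<^esub> g x \<in> carrier P" if "x \<in> carrier X" for x
    using that lin_map_closed[OF assms(3)] lin_map_closed[OF assms(4)] by simp
  show "f (x \<oplus>\<^bsub>X\<^esub> y) \<oplus>\<^bsub>P\<^esub> g (x \<oplus>\<^bsub>X\<^esub> y) = (f x \<oplus>\<^bsub>P\<^esub> g x) \<oplus>\<^bsub>P\<^esub> (f y \<oplus>\<^bsub>P\<^esub> g y)"
    if "x \<in> carrier X" "y \<in> carrier X" for x y
    using that lin_map_closed[OF assms(3)] lin_map_closed[OF assms(4)]
    by (simp add: lin_map_add[OF assms(3)] lin_map_add[OF assms(4)] P.a_ac)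
  show "f (c \<odot>\<^bsub>X\<^esub> x) \<oplus>\<^bsub>P\<^esub> g (c \<odot>\<^bsub>X\<^esub> x) = c \<odot>\<^bsub>P\<^esub> (f x \<oplus>\<^bsub>P\<^esub> g x)"
    if "c \<in> carrier K" "x \<in> carrier X" for c x
    using that lin_map_closed[OF assms(3)] lin_map_closed[OF assms(4)]
    by (simp add: lin_map_smult[OF assms(3)] lin_map_smult[OF assms(4)] P.smult_r_distr)
qed

lemma bilin_add_maps:
  assumes "module K M" "module K N" "module K P" "bilin K M N P f" "bilin K M N P g"
  shows "bilin K M N P (\<lambda>x y. f x y \<oplus>\<^bsub>P\<^esub> g x y)"
  by (intro bilinI lin_map_add_maps assms(1-3) bilin_left[OF assms(4)] bilin_left[OF assms(5)]
      bilin_right[OF assms(4)] bilin_right[OF assms(5)])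

subsection \<open>Tensor products of modules\<close>

lemma carrier_tensor: "carrier (tensor K M N) =
    carrier (balanced_tensor (carrier K) M (\<lambda>m c. c \<odot>\<^bsub>M\<^esub> m) N (\<lambda>c n. c \<odot>\<^bsub>N\<^esub> n))"
  and add_tensor: "add (tensor K M N) =
    add (balanced_tensor (carrier K) M (\<lambda>m c. c \<odot>\<^bsub>M\<^esub> m) N (\<lambda>c n. c \<odot>\<^bsub>N\<^esub> n))"
  and zero_tensor: "\<zero>\<^bsub>tensor K M N\<^esub> =
    \<zero>\<^bsub>balanced_tensor (carrier K) M (\<lambda>m c. c \<odot>\<^bsub>M\<^esub> m) N (\<lambda>c n. c \<odot>\<^bsub>N\<^esub> n)\<^esub>"
  by (simp_all add: tensor_def Let_def)

lemma pure_tensor_cong: "carrier T = carrier T' \<Longrightarrow> pure_tensor T = pure_tensor T'"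
  by (intro ext) (simp add: pure_tensor_def)

lemma finprod_cong_monoid:
  assumes "carrier G = carrier G'" "monoid.mult G = monoid.mult G'" "one G = one G'" "f = f'"
  shows "finprod G f I = finprod G' f' I"
  using assms by (simp add: finprod_def)

lemma int_pow_cong_monoid:
  assumes "carrier G = carrier G'" "monoid.mult G = monoid.mult G'" "one G = one G'"
  shows "pow G x (n :: int) = pow G' x n"
proof -
  have "m_inv G = m_inv G'" using assms by (intro ext) (simp add: m_inv_def)
  then show ?thesis using assms by (simp add: int_pow_def nat_pow_def Let_def)
qed

text \<open>\<open>finsum\<close> and \<open>add_pow\<close> see only the carrier, the addition and
  the zero. Hence results on \<open>balanced_tensor\<close> carry over to \<open>tensor\<close>, a
  different record whose product and scalars are defined by means of the former.\<close>

lemma tensor_lift_cong_ring: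
  "carrier P = carrier P' \<Longrightarrow> add P = add P' \<Longrightarrow> \<zero>\<^bsub>P\<^esub> = \<zero>\<^bsub>P'\<^esub> \<Longrightarrow> tensor_lift P = tensor_lift P'"
  unfolding tensor_lift_def finsum_def add_pow_def
  by (intro ext arg_cong[where f = the_elem] image_cong refl finprod_cong_monoid int_pow_cong_monoid) simp_all

lemma pure_tensor_tensor: "pure_tensor (tensor K M N) =
    pure_tensor (balanced_tensor (carrier K) M (\<lambda>m c. c \<odot>\<^bsub>M\<^esub> m) N (\<lambda>c n. c \<odot>\<^bsub>N\<^esub> n))"
  by (rule pure_tensor_cong[OF carrier_tensor])

lemma tensor_lift_tensor: "tensor_lift (tensor K M N) =
    tensor_lift (balanced_tensor (carrier K) M (\<lambda>m c. c \<odot>\<^bsub>M\<^esub> m) N (\<lambda>c n. c \<odot>\<^bsub>N\<^esub> n))"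
  by (rule tensor_lift_cong_ring[OF carrier_tensor add_tensor zero_tensor])

lemma smult_tensor: "c \<odot>\<^bsub>tensor K M N\<^esub> t =
    tensor_lift (tensor K M N) t (\<lambda>m n. pure_tensor (tensor K M N) (c \<odot>\<^bsub>M\<^esub> m) n)"
  unfolding tensor_lift_tensor pure_tensor_tensor by (simp add: tensor_def Let_def)

lemma mult_tensor: "s \<otimes>\<^bsub>tensor K M N\<^esub> t =
    tensor_lift (tensor K M N) s (\<lambda>m n. tensor_lift (tensor K M N) t (\<lambda>m' n'.
      pure_tensor (tensor K M N) (m \<otimes>\<^bsub>M\<^esub> m') (n \<otimes>\<^bsub>N\<^esub> n')))"
  unfolding tensor_lift_tensor pure_tensor_tensor by (simp add: tensor_def Let_def)

lemma one_tensor: "\<one>\<^bsub>tensor K M N\<^esub> = pure_tensor (tensor K M N) \<one>\<^bsub>M\<^esub> \<one>\<^bsub>N\<^esub>"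
  unfolding pure_tensor_tensor by (simp add: tensor_def Let_def)

lemma module_abelian_group: "module K M \<Longrightarrow> abelian_group M"
  by (rule module.axioms(2))

context
  fixes K :: "('k, 'x) ring_scheme" and M :: "('k, 'm, 'y) module_scheme"
    and N :: "('k, 'n, 'z) module_scheme"
  assumes M: "module K M" and N: "module K N"
begin

interpretation M: module K M by (rule M)
interpretation N: module K N by (rule N)

interpretation BT: balanced_data "carrier K" M "\<lambda>m c. c \<odot>\<^bsub>M\<^esub> m" N "\<lambda>c n. c \<odot>\<^bsub>N\<^esub> n"
  by unfold_locales auto

private abbreviation (input) "TT \<equiv> tensor K M N"

lemma abelian_group_tensor: "abelian_group TT"
proof -
  interpret T: abelian_group BT.T by (rule BT.abelian_group_T)
  show ?thesis
    by (rule abelian_groupI) (auto simp: carrier_tensor add_tensor zero_tensor T.a_ac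
      intro: T.l_neg[of "\<ominus>\<^bsub>BT.T\<^esub> x" for x] T.l_neg bexI[of _ "\<ominus>\<^bsub>BT.T\<^esub> x" for x])
qed

lemma tensor_pure_closed [intro]:
  "m \<in> carrier M \<Longrightarrow> n \<in> carrier N \<Longrightarrow> pure_tensor TT m n \<in> carrier TT"
  unfolding carrier_tensor pure_tensor_tensor by (rule BT.pure_closed)

lemma tensor_pure_add_left:
  "m \<in> carrier M \<Longrightarrow> m' \<in> carrier M \<Longrightarrow> n \<in> carrier N \<Longrightarrow>
    pure_tensor TT (m \<oplus>\<^bsub>M\<^esub> m') n = pure_tensor TT m n \<oplus>\<^bsub>TT\<^esub> pure_tensor TT m' n"
  using BT.balanced_pure unfolding pure_tensor_tensor add_tensor balanced_map_def by blast

lemma tensor_pure_add_right: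
  "m \<in> carrier M \<Longrightarrow> n \<in> carrier N \<Longrightarrow> n' \<in> carrier N \<Longrightarrow>
    pure_tensor TT m (n \<oplus>\<^bsub>N\<^esub> n') = pure_tensor TT m n \<oplus>\<^bsub>TT\<^esub> pure_tensor TT m n'"
  using BT.balanced_pure unfolding pure_tensor_tensor add_tensor balanced_map_def by blast

lemma tensor_pure_swap:
  "m \<in> carrier M \<Longrightarrow> n \<in> carrier N \<Longrightarrow> c \<in> carrier K \<Longrightarrow>
    pure_tensor TT (c \<odot>\<^bsub>M\<^esub> m) n = pure_tensor TT m (c \<odot>\<^bsub>N\<^esub> n)"
  using BT.balanced_pure unfolding pure_tensor_tensor balanced_map_def by blast

lemma tensor_induct [consumes 1, case_names pure add]:
  assumes "t \<in> carrier TT"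
    and "\<And>m n. m \<in> carrier M \<Longrightarrow> n \<in> carrier N \<Longrightarrow> Q (pure_tensor TT m n)"
    and "\<And>s t. s \<in> carrier TT \<Longrightarrow> t \<in> carrier TT \<Longrightarrow> Q s \<Longrightarrow> Q t \<Longrightarrow> Q (s \<oplus>\<^bsub>TT\<^esub> t)"
  shows "Q t"
  using assms unfolding carrier_tensor pure_tensor_tensor add_tensor by (rule BT.tensor_induct)

context
  fixes P :: "('p, 'v) ring_scheme" and f
  assumes P: "abelian_group P"
    and f: "balanced_map (carrier K) M (\<lambda>m c. c \<odot>\<^bsub>M\<^esub> m) N (\<lambda>c n. c \<odot>\<^bsub>N\<^esub> n) P f"
begin

lemma balanced_lift_closed: "t \<in> carrier TT \<Longrightarrow> tensor_lift P t f \<in> carrier P"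
  unfolding carrier_tensor by (rule BT.lift_closed[OF P f])

lemma balanced_lift_add:
  "s \<in> carrier TT \<Longrightarrow> t \<in> carrier TT \<Longrightarrow>
    tensor_lift P (s \<oplus>\<^bsub>TT\<^esub> t) f = tensor_lift P s f \<oplus>\<^bsub>P\<^esub> tensor_lift P t f"
  unfolding carrier_tensor add_tensor by (rule BT.lift_add[OF P f])

lemma balanced_lift_pure:
  "m \<in> carrier M \<Longrightarrow> n \<in> carrier N \<Longrightarrow> tensor_lift P (pure_tensor TT m n) f = f m n"
  unfolding pure_tensor_tensor by (rule BT.lift_pure[OF P f])

end

context
  fixes c assumes c: "c \<in> carrier K"
begin

text \<open>Commutativity of \<open>K\<close> is what makes the scalar action on the first factor
  balanced: \<open>c\<close> has to pass the scalar that is moved across the tensor sign.\<close>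

lemma balanced_smult: "balanced_map (carrier K) M (\<lambda>m c. c \<odot>\<^bsub>M\<^esub> m) N (\<lambda>c n. c \<odot>\<^bsub>N\<^esub> n) TT
    (\<lambda>m n. pure_tensor TT (c \<odot>\<^bsub>M\<^esub> m) n)"
  unfolding balanced_map_def using c
  by (auto simp: M.smult_r_distr tensor_pure_add_left tensor_pure_add_right tensor_pure_swap
      M.smult_assoc1[symmetric] N.smult_assoc1[symmetric] M.R.m_comm)

lemma smult_tensor_closed: "t \<in> carrier TT \<Longrightarrow> c \<odot>\<^bsub>TT\<^esub> t \<in> carrier TT"
  unfolding smult_tensor by (rule balanced_lift_closed[OF abelian_group_tensor balanced_smult])

lemma smult_tensor_add: "s \<in> carrier TT \<Longrightarrow> t \<in> carrier TT \<Longrightarrow>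
    c \<odot>\<^bsub>TT\<^esub> (s \<oplus>\<^bsub>TT\<^esub> t) = c \<odot>\<^bsub>TT\<^esub> s \<oplus>\<^bsub>TT\<^esub> c \<odot>\<^bsub>TT\<^esub> t"
  unfolding smult_tensor by (rule balanced_lift_add[OF abelian_group_tensor balanced_smult])

lemma smult_tensor_pure: "m \<in> carrier M \<Longrightarrow> n \<in> carrier N \<Longrightarrow>
    c \<odot>\<^bsub>TT\<^esub> pure_tensor TT m n = pure_tensor TT (c \<odot>\<^bsub>M\<^esub> m) n"
  unfolding smult_tensor by (rule balanced_lift_pure[OF abelian_group_tensor balanced_smult])

end

lemma module_tensor: "module K TT"
proof -
  interpret T: abelian_group TT by (rule abelian_group_tensor)
  note sm = smult_tensor_closed smult_tensor_add smult_tensor_pure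
  show ?thesis
  proof (rule moduleI)
    fix a b x assume a: "a \<in> carrier K" and b: "b \<in> carrier K" and x: "x \<in> carrier TT"
    from x show "(a \<oplus>\<^bsub>K\<^esub> b) \<odot>\<^bsub>TT\<^esub> x = a \<odot>\<^bsub>TT\<^esub> x \<oplus>\<^bsub>TT\<^esub> b \<odot>\<^bsub>TT\<^esub> x"
    proof (induction x rule: tensor_induct)
      case (pure m n)
      then show ?case using a b by (simp add: sm M.smult_l_distr tensor_pure_add_left)
    next
      case (add s t)
      then show ?case using a b by (simp add: sm T.a_ac)
    qed
    from x show "(a \<otimes>\<^bsub>K\<^esub> b) \<odot>\<^bsub>TT\<^esub> x = a \<odot>\<^bsub>TT\<^esub> (b \<odot>\<^bsub>TT\<^esub> x)"
    proof (induction x rule: tensor_induct)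
      case (pure m n)
      then show ?case using a b by (simp add: sm M.smult_assoc1)
    next
      case (add s t)
      then show ?case using a b by (simp add: sm)
    qed
  next
    fix x assume "x \<in> carrier TT"
    then show "\<one>\<^bsub>K\<^esub> \<odot>\<^bsub>TT\<^esub> x = x"
      by (induction x rule: tensor_induct) (simp_all add: sm)
  qed (simp_all add: M.R.is_cring abelian_group_tensor sm)
qed

lemma bilin_pure: "bilin K M N TT (pure_tensor TT)"
  unfolding bilin_def lin_map_def
  by (auto simp: tensor_pure_add_left tensor_pure_add_right tensor_pure_closed smult_tensor_pure
      tensor_pure_swap)

lemma bilin_balanced:
  "bilin K M N P f \<Longrightarrow> balanced_map (carrier K) M (\<lambda>m c. c \<odot>\<^bsub>M\<^esub> m) N (\<lambda>c n. c \<odot>\<^bsub>N\<^esub> n) P f"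
  unfolding bilin_def lin_map_def balanced_map_def by auto

lemma lift_pure:
  "module K P \<Longrightarrow> bilin K M N P f \<Longrightarrow> m \<in> carrier M \<Longrightarrow> n \<in> carrier N \<Longrightarrow>
    tensor_lift P (pure_tensor TT m n) f = f m n"
  by (rule balanced_lift_pure[OF module_abelian_group bilin_balanced])

lemma lin_map_lift:
  assumes P: "module K P" and f: "bilin K M N P f"
  shows "lin_map K TT P (\<lambda>t. tensor_lift P t f)"
proof (rule lin_mapI)
  interpret P: module K P by (rule P)
  note bal = module_abelian_group[OF P] bilin_balanced[OF f]
  show "tensor_lift P t f \<in> carrier P" if "t \<in> carrier TT" for t
    using bal that by (rule balanced_lift_closed)
  show "tensor_lift P (s \<oplus>\<^bsub>TT\<^esub> t) f = tensor_lift P s f \<oplus>\<^bsub>P\<^esub> tensor_lift P t f"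
    if "s \<in> carrier TT" "t \<in> carrier TT" for s t
    using bal that by (rule balanced_lift_add)
  show "tensor_lift P (c \<odot>\<^bsub>TT\<^esub> t) f = c \<odot>\<^bsub>P\<^esub> tensor_lift P t f" if c: "c \<in> carrier K" and "t \<in> carrier TT" for c t
    using that(2)
  proof (induction t rule: tensor_induct)
    case (pure m n)
    then show ?case
      using c lin_map_smult[OF bilin_left[OF f] c]
      by (simp add: smult_tensor_pure balanced_lift_pure[OF bal])
  next
    case (add s t)
    then show ?case
      using c by (simp add: smult_tensor_add smult_tensor_closed balanced_lift_add[OF bal]
          balanced_lift_closed[OF bal] P.smult_r_distr)
  qed
qed

lemma lift_closed:
  "module K P \<Longrightarrow> bilin K M N P f \<Longrightarrow> t \<in> carrier TT \<Longrightarrow> tensor_lift P t f \<in> carrier P"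
  by (rule lin_map_closed[OF lin_map_lift])

lemma tensor_ext:
  assumes "lin_map K TT P f" "lin_map K TT P g"
    and "\<And>m n. m \<in> carrier M \<Longrightarrow> n \<in> carrier N \<Longrightarrow> f (pure_tensor TT m n) = g (pure_tensor TT m n)"
    and "t \<in> carrier TT"
  shows "f t = g t"
  using assms(4)
  by (induction t rule: tensor_induct)
    (simp_all add: assms(3) lin_map_add[OF assms(1)] lin_map_add[OF assms(2)])

text \<open>Rewriting under the binder of a Sweedler sum. Agreement on the carriers is enough, as
  the new integrand inherits bilinearity from the old one.\<close>

lemma lift_cong:
  assumes "module K P" "bilin K M N P f" "t \<in> carrier TT"
    and "\<And>m n. m \<in> carrier M \<Longrightarrow> n \<in> carrier N \<Longrightarrow> g m n = f m n"
  shows "tensor_lift P t g = tensor_lift P t f"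
proof (rule tensor_ext[OF _ _ _ assms(3)])
  have g: "bilin K M N P g" using bilin_cong[OF assms(2,4) M N] .
  show "lin_map K TT P (\<lambda>t. tensor_lift P t g)" "lin_map K TT P (\<lambda>t. tensor_lift P t f)"
    by (rule lin_map_lift[OF assms(1) g] lin_map_lift[OF assms(1,2)])+
  fix m n assume "m \<in> carrier M" "n \<in> carrier N"
  then show "tensor_lift P (pure_tensor TT m n) g = tensor_lift P (pure_tensor TT m n) f"
    using assms(4) by (simp add: lift_pure[OF assms(1)] assms(2) g)
qed

text \<open>Moves a linear map inside a Sweedler sum; both sides are linear in \<open>t\<close>, so
  pure tensors decide.\<close>

lemma lin_map_lift_commute:
  assumes "module K P" "module K Q" "lin_map K P Q g" "bilin K M N P f" "t \<in> carrier TT"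
  shows "g (tensor_lift P t f) = tensor_lift Q t (\<lambda>m n. g (f m n))"
proof (rule tensor_ext[OF _ _ _ assms(5)])
  note b = bilin_lin_comp[OF assms(3,4)]
  show "lin_map K TT Q (\<lambda>t. tensor_lift Q t (\<lambda>m n. g (f m n)))"
    by (rule lin_map_lift[OF assms(2) b])
  show "lin_map K TT Q (\<lambda>t. g (tensor_lift P t f))"
    by (rule lin_map_comp[OF assms(3) lin_map_lift[OF assms(1,4)]])
  fix m n assume "m \<in> carrier M" "n \<in> carrier N"
  then show "g (tensor_lift P (pure_tensor TT m n) f) =
      tensor_lift Q (pure_tensor TT m n) (\<lambda>m n. g (f m n))"
    by (simp add: lift_pure[OF assms(1,4)] lift_pure[OF assms(2) b])
qed

text \<open>In a nested Sweedler sum the inner integrand depends on the outer legs. Linearity of the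
  inner sum in such a parameter \<open>x\<close> is what makes the outer integrand bilinear.\<close>

lemma lin_map_lift_param:
  assumes P: "module K P" and X: "module K X" and t: "t \<in> carrier TT"
    and f: "\<And>x. x \<in> carrier X \<Longrightarrow> bilin K M N P (f x)"
    and g: "\<And>m n. m \<in> carrier M \<Longrightarrow> n \<in> carrier N \<Longrightarrow> lin_map K X P (\<lambda>x. f x m n)"
  shows "lin_map K X P (\<lambda>x. tensor_lift P t (f x))"
proof (rule lin_mapI)
  interpret P: module K P by (rule P)
  interpret X: module K X by (rule X)
  note add = lin_map_add[OF lin_map_lift[OF P f]]
  show "tensor_lift P t (f x) \<in> carrier P" if "x \<in> carrier X" for x
    by (rule lift_closed[OF P f[OF that] t])
  show "tensor_lift P t (f (x \<oplus>\<^bsub>X\<^esub> y)) = tensor_lift P t (f x) \<oplus>\<^bsub>P\<^esub> tensor_lift P t (f y)"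
    if xy: "x \<in> carrier X" "y \<in> carrier X" for x y
    using t
  proof (induction t rule: tensor_induct)
    case (pure m n)
    then show ?case using xy lin_map_add[OF g[OF pure]] by (simp add: lift_pure[OF P f])
  next
    case (add s t)
    then show ?case using xy by (simp add: lin_map_add[OF lin_map_lift[OF P f]] P.a_ac
      lift_closed[OF P f])
  qed
  show "tensor_lift P t (f (c \<odot>\<^bsub>X\<^esub> x)) = c \<odot>\<^bsub>P\<^esub> tensor_lift P t (f x)"
    if c: "c \<in> carrier K" and x: "x \<in> carrier X" for x c
    using t
  proof (induction t rule: tensor_induct)
    case (pure m n)
    then show ?case using x c lin_map_smult[OF g[OF pure]] by (simp add: lift_pure[OF P f])
  next
    case (add s t)
    then show ?case using x c by (simp add: lin_map_add[OF lin_map_lift[OF P f]] P.smult_r_distr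
      lift_closed[OF P f])
  qed
qed

end

lemma lin_map_lift_comp:
  assumes "module K M" "module K N" "module K P" "bilin K M N P f" "lin_map K X (tensor K M N) g"
  shows "lin_map K X P (\<lambda>x. tensor_lift P (g x) f)"
  by (rule lin_map_comp[OF lin_map_lift[OF assms(1-4)] assms(5)])

subsection \<open>Tensor products of bilinear maps\<close>

text \<open>The product of \<open>A \<otimes> H\<close>, the left and right actions of
  \<open>A \<otimes> H\<close> on both summands of \<open>tensor_fodc\<close>, and the action of
  \<open>H\<close> on \<open>H \<otimes> \<Gamma>\<close> through the coproduct are all instances of
  it.\<close>

definition tensor_bimap ::
  "(('p \<times> 'q \<Rightarrow>\<^sub>0 int) set, 'z) ring_scheme \<Rightarrow> ('a \<Rightarrow> 'm \<Rightarrow> 'p) \<Rightarrow> ('h \<Rightarrow> 'n \<Rightarrow> 'q)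
    \<Rightarrow> ('a \<times> 'h \<Rightarrow>\<^sub>0 int) set \<Rightarrow> ('m \<times> 'n \<Rightarrow>\<^sub>0 int) set \<Rightarrow> ('p \<times> 'q \<Rightarrow>\<^sub>0 int) set"
  where "tensor_bimap P f g s t =
    tensor_lift P s (\<lambda>a h. tensor_lift P t (\<lambda>m n. pure_tensor P (f a m) (g h n)))"

context
  fixes K :: "('k, 'x) ring_scheme"
    and A :: "('k, 'a, 'xa) module_scheme" and H :: "('k, 'h, 'xh) module_scheme"
    and M :: "('k, 'm, 'xm) module_scheme" and N :: "('k, 'n, 'xn) module_scheme"
    and P :: "('k, 'p, 'xp) module_scheme" and Q :: "('k, 'q, 'xq) module_scheme"
    and f g
  assumes mod: "module K A" "module K H" "module K M" "module K N" "module K P" "module K Q"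
    and f: "bilin K A M P f" and g: "bilin K H N Q g"
begin

lemma bilin_bimap_inner1:
  "a \<in> carrier A \<Longrightarrow> h \<in> carrier H \<Longrightarrow> bilin K M N (tensor K P Q) (\<lambda>m n. pure_tensor (tensor K P Q) (f a m) (g h n))"
  by (rule bilin_comp[OF bilin_pure[OF mod(5,6)] bilin_right[OF f] bilin_right[OF g]])

lemma bilin_bimap_inner2:
  "m \<in> carrier M \<Longrightarrow> n \<in> carrier N \<Longrightarrow> bilin K A H (tensor K P Q) (\<lambda>a h. pure_tensor (tensor K P Q) (f a m) (g h n))"
  by (rule bilin_comp[OF bilin_pure[OF mod(5,6)] bilin_left[OF f] bilin_left[OF g]])

lemma bilin_bimap_outer:
  assumes "t \<in> carrier (tensor K M N)"
  shows "bilin K A H (tensor K P Q)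
    (\<lambda>a h. tensor_lift (tensor K P Q) t (\<lambda>m n. pure_tensor (tensor K P Q) (f a m) (g h n)))"
  by (intro bilinI lin_map_lift_param[OF mod(3,4) module_tensor[OF mod(5,6)] mod(1) assms]
      lin_map_lift_param[OF mod(3,4) module_tensor[OF mod(5,6)] mod(2) assms] bilin_bimap_inner1
      bilin_left[OF bilin_bimap_inner2] bilin_right[OF bilin_bimap_inner2])

lemma bilin_bimap:
  "bilin K (tensor K A H) (tensor K M N) (tensor K P Q) (tensor_bimap (tensor K P Q) f g)"
proof (rule bilinI)
  fix t assume t: "t \<in> carrier (tensor K M N)"
  show "lin_map K (tensor K A H) (tensor K P Q) (\<lambda>s. tensor_bimap (tensor K P Q) f g s t)"
    unfolding tensor_bimap_def
    by (rule lin_map_lift[OF mod(1,2) module_tensor[OF mod(5,6)] bilin_bimap_outer[OF t]])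
next
  fix s assume s: "s \<in> carrier (tensor K A H)"
  show "lin_map K (tensor K M N) (tensor K P Q) (\<lambda>t. tensor_bimap (tensor K P Q) f g s t)"
    unfolding tensor_bimap_def
    by (rule lin_map_lift_param[OF mod(1,2) module_tensor[OF mod(5,6)] module_tensor[OF mod(3,4)] s bilin_bimap_outer])
      (simp_all add: lin_map_lift[OF mod(3,4) module_tensor[OF mod(5,6)]] bilin_bimap_inner1)
qed

lemma bimap_pure_left:
  assumes "a \<in> carrier A" "h \<in> carrier H" "t \<in> carrier (tensor K M N)"
  shows "tensor_bimap (tensor K P Q) f g (pure_tensor (tensor K A H) a h) t =
    tensor_lift (tensor K P Q) t (\<lambda>m n. pure_tensor (tensor K P Q) (f a m) (g h n))"
  unfolding tensor_bimap_def
  by (rule lift_pure[OF mod(1,2) module_tensor[OF mod(5,6)] bilin_bimap_outer]) fact+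

lemma bimap_pure:
  assumes "a \<in> carrier A" "h \<in> carrier H" "m \<in> carrier M" "n \<in> carrier N"
  shows "tensor_bimap (tensor K P Q) f g (pure_tensor (tensor K A H) a h) (pure_tensor (tensor K M N) m n) =
    pure_tensor (tensor K P Q) (f a m) (g h n)"
  using assms tensor_pure_closed[OF mod(3,4)]
  by (simp add: bimap_pure_left lift_pure[OF mod(3,4) module_tensor[OF mod(5,6)]] bilin_bimap_inner1)

end

lemma tensor_ext2:
  assumes "module K A" "module K H" "module K M" "module K N"
    and "bilin K (tensor K A H) (tensor K M N) P f" "bilin K (tensor K A H) (tensor K M N) P g"
    and "\<And>a h m n. a \<in> carrier A \<Longrightarrow> h \<in> carrier H \<Longrightarrow> m \<in> carrier M \<Longrightarrow> n \<in> carrier N \<Longrightarrow>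
      f (pure_tensor (tensor K A H) a h) (pure_tensor (tensor K M N) m n) =
      g (pure_tensor (tensor K A H) a h) (pure_tensor (tensor K M N) m n)"
    and "s \<in> carrier (tensor K A H)" "t \<in> carrier (tensor K M N)"
  shows "f s t = g s t"
proof (rule tensor_ext[OF assms(1,2) bilin_left[OF assms(5)] bilin_left[OF assms(6)] _ assms(8)])
  fix a h assume ah: "a \<in> carrier A" "h \<in> carrier H"
  note p = tensor_pure_closed[OF assms(1,2) ah]
  show "f (pure_tensor (tensor K A H) a h) t = g (pure_tensor (tensor K A H) a h) t"
    by (rule tensor_ext[OF assms(3,4) bilin_right[OF assms(5) p] bilin_right[OF assms(6) p] _ assms(9)])
      (rule assms(7)[OF ah])
qed (use assms in auto)

section \<open>Actions of \<open>A \<otimes> H\<close> on \<open>M \<otimes> N\<close> that come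
  from actions on the factors\<close>

context
  fixes K :: "('k, 'x) ring_scheme"
    and A :: "('k, 'a, 'xa) module_scheme" and H :: "('k, 'h, 'xh) module_scheme"
    and M :: "('k, 'm, 'xm) module_scheme" and N :: "('k, 'n, 'xn) module_scheme"
  assumes m: "module K A" "module K H" "module K M" "module K N"
begin

private abbreviation (input) "AH \<equiv> tensor K A H"
private abbreviation (input) "MN \<equiv> tensor K M N"

text \<open>With products \<open>mA\<close>, \<open>mH\<close> and actions \<open>f\<close>,
  \<open>g\<close> this is the associativity of the action of \<open>A \<otimes> H\<close> on
  \<open>M \<otimes> N\<close>. Both sides are linear in each of \<open>s\<close>, \<open>t\<close>,
  \<open>u\<close>, so the laws in the factors decide.\<close>

lemma bimap_assoc:
  assumes mA: "bilin K A A A mA" and mH: "bilin K H H H mH"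
    and f: "bilin K A M M f" and g: "bilin K H N N g"
    and fa: "\<And>a b x. a \<in> carrier A \<Longrightarrow> b \<in> carrier A \<Longrightarrow> x \<in> carrier M \<Longrightarrow> f (mA a b) x = f a (f b x)"
    and ga: "\<And>a b x. a \<in> carrier H \<Longrightarrow> b \<in> carrier H \<Longrightarrow> x \<in> carrier N \<Longrightarrow> g (mH a b) x = g a (g b x)"
    and s: "s \<in> carrier AH" and t: "t \<in> carrier AH" and u: "u \<in> carrier MN"
  shows "tensor_bimap MN f g (tensor_bimap AH mA mH s t) u = tensor_bimap MN f g s (tensor_bimap MN f g t u)"
proof -
  note bm = bilin_bimap[OF m(1,2,1,2,1,2) mA mH] and b = bilin_bimap[OF m m(3,4) f g]
  have "tensor_bimap MN f g (tensor_bimap AH mA mH s t) (pure_tensor MN x y) =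
      tensor_bimap MN f g s (tensor_bimap MN f g t (pure_tensor MN x y))"
    if xy: "x \<in> carrier M" "y \<in> carrier N" for x y
  proof (rule tensor_ext2[OF m(1,2,1,2) bilin_lin_comp[OF bilin_left[OF b] bm]
        bilin_comp[OF b lin_map_ident bilin_left[OF b]] _ s t])
    show "pure_tensor MN x y \<in> carrier MN" by (rule tensor_pure_closed[OF m(3,4) xy])
    then show "pure_tensor MN x y \<in> carrier MN" .
  qed (simp add: bimap_pure[OF m(1,2,1,2,1,2) mA mH] bimap_pure[OF m m(3,4) f g] xy
      bilin_closed[OF mA] bilin_closed[OF mH] bilin_closed[OF f] bilin_closed[OF g] fa ga)
  then show ?thesis
    by (intro tensor_ext[OF m(3,4) bilin_right[OF b bilin_closed[OF bm s t]]
      lin_map_bilin2[OF b bilin_right[OF b t] s] _ u])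
qed

text \<open>Meant for a right action against a left one: commuting in each factor gives the bimodule
  law on \<open>M \<otimes> N\<close>.\<close>

lemma bimap_commute:
  assumes f: "bilin K A M M f" and g: "bilin K H N N g" and f': "bilin K A M M f'" and g': "bilin K H N N g'"
    and fc: "\<And>a b x. a \<in> carrier A \<Longrightarrow> b \<in> carrier A \<Longrightarrow> x \<in> carrier M \<Longrightarrow> f a (f' b x) = f' b (f a x)"
    and gc: "\<And>a b x. a \<in> carrier H \<Longrightarrow> b \<in> carrier H \<Longrightarrow> x \<in> carrier N \<Longrightarrow> g a (g' b x) = g' b (g a x)"
    and s: "s \<in> carrier AH" and t: "t \<in> carrier AH" and u: "u \<in> carrier MN"
  shows "tensor_bimap MN f g s (tensor_bimap MN f' g' t u) = tensor_bimap MN f' g' t (tensor_bimap MN f g s u)"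
proof -
  note b = bilin_bimap[OF m m(3,4) f g] and b' = bilin_bimap[OF m m(3,4) f' g']
  have "tensor_bimap MN f g s (tensor_bimap MN f' g' t (pure_tensor MN x y)) =
      tensor_bimap MN f' g' t (tensor_bimap MN f g s (pure_tensor MN x y))"
    if xy: "x \<in> carrier M" "y \<in> carrier N" for x y
  proof (rule tensor_ext2[OF m(1,2,1,2) bilin_comp[OF b lin_map_ident bilin_left[OF b']]
        bilin_flip[OF bilin_comp[OF b' lin_map_ident bilin_left[OF b]]] _ s t])
    show "pure_tensor MN x y \<in> carrier MN" by (rule tensor_pure_closed[OF m(3,4) xy])
    then show "pure_tensor MN x y \<in> carrier MN" .
  qed (simp add: bimap_pure[OF m m(3,4) f g] bimap_pure[OF m m(3,4) f' g'] xy
      bilin_closed[OF f] bilin_closed[OF g] bilin_closed[OF f'] bilin_closed[OF g'] fc gc)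
  then show ?thesis
    by (intro tensor_ext[OF m(3,4) lin_map_bilin2[OF b bilin_right[OF b' t] s]
      lin_map_bilin2[OF b' bilin_right[OF b s] t] _ u])
qed

end

lemma bimap_cong:
  assumes m: "module K A" "module K H" "module K M" "module K N" "module K P" "module K Q"
    and f: "bilin K A M P f" and g: "bilin K H N Q g"
    and f': "\<And>a x. a \<in> carrier A \<Longrightarrow> x \<in> carrier M \<Longrightarrow> f' a x = f a x"
    and g': "\<And>h y. h \<in> carrier H \<Longrightarrow> y \<in> carrier N \<Longrightarrow> g' h y = g h y"
    and s: "s \<in> carrier (tensor K A H)" and t: "t \<in> carrier (tensor K M N)"
  shows "tensor_bimap (tensor K P Q) f' g' s t = tensor_bimap (tensor K P Q) f g s t"
proof -
  have bf: "bilin K A M P f'" and bg: "bilin K H N Q g'"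
    by (rule bilin_cong[OF f f' m(1,3)] bilin_cong[OF g g' m(2,4)]; assumption)+
  show ?thesis
    by (rule tensor_ext2[OF m(1-4) bilin_bimap[OF m bf bg] bilin_bimap[OF m f g] _ s t])
      (simp add: bimap_pure[OF m bf bg] bimap_pure[OF m f g] f' g')
qed

lemma bimap_unit:
  assumes m: "module K A" "module K H" "module K M" "module K N"
    and f: "bilin K A M M f" and g: "bilin K H N N g"
    and a: "a \<in> carrier A" "h \<in> carrier H"
    and u: "\<And>x. x \<in> carrier M \<Longrightarrow> f a x = x" "\<And>y. y \<in> carrier N \<Longrightarrow> g h y = y"
    and t: "t \<in> carrier (tensor K M N)"
  shows "tensor_bimap (tensor K M N) f g (pure_tensor (tensor K A H) a h) t = t"
  by (rule tensor_ext[OF m(3,4) bilin_right[OF bilin_bimap[OF m m(3,4) f g]] lin_map_ident _ t])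
    (simp_all add: bimap_pure[OF m m(3,4) f g] a u tensor_pure_closed[OF m(1,2)])

section \<open>Functoriality of the tensor product\<close>

definition tensor_map ::
  "(('p \<times> 'q \<Rightarrow>\<^sub>0 int) set, 'z) ring_scheme \<Rightarrow> ('m \<Rightarrow> 'p) \<Rightarrow> ('n \<Rightarrow> 'q)
    \<Rightarrow> ('m \<times> 'n \<Rightarrow>\<^sub>0 int) set \<Rightarrow> ('p \<times> 'q \<Rightarrow>\<^sub>0 int) set"
  where "tensor_map P f g t = tensor_lift P t (\<lambda>m n. pure_tensor P (f m) (g n))"

context
  fixes K :: "('k, 'x) ring_scheme"
    and M :: "('k, 'm, 'xm) module_scheme" and N :: "('k, 'n, 'xn) module_scheme"
    and P :: "('k, 'p, 'xp) module_scheme" and Q :: "('k, 'q, 'xq) module_scheme"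
    and f g
  assumes mod: "module K M" "module K N" "module K P" "module K Q"
    and f: "lin_map K M P f" and g: "lin_map K N Q g"
begin

lemma bilin_tensor_map_inner: "bilin K M N (tensor K P Q) (\<lambda>m n. pure_tensor (tensor K P Q) (f m) (g n))"
  by (rule bilin_comp[OF bilin_pure[OF mod(3,4)] f g])

lemma lin_map_tensor_map: "lin_map K (tensor K M N) (tensor K P Q) (tensor_map (tensor K P Q) f g)"
  unfolding tensor_map_def
  by (rule lin_map_lift[OF mod(1,2) module_tensor[OF mod(3,4)] bilin_tensor_map_inner])

lemma tensor_map_pure:
  "m \<in> carrier M \<Longrightarrow> n \<in> carrier N \<Longrightarrow>
    tensor_map (tensor K P Q) f g (pure_tensor (tensor K M N) m n) = pure_tensor (tensor K P Q) (f m) (g n)"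
  unfolding tensor_map_def
  by (rule lift_pure[OF mod(1,2) module_tensor[OF mod(3,4)] bilin_tensor_map_inner])

lemma lift_tensor_map:
  assumes R: "module K R" and \<phi>: "bilin K P Q R \<phi>" and t: "t \<in> carrier (tensor K M N)"
  shows "tensor_lift R (tensor_map (tensor K P Q) f g t) \<phi> = tensor_lift R t (\<lambda>m n. \<phi> (f m) (g n))"
  by (rule tensor_ext[OF mod(1,2) lin_map_lift_comp[OF mod(3,4) R \<phi> lin_map_tensor_map]
      lin_map_lift[OF mod(1,2) R bilin_comp[OF \<phi> f g]] _ t])
    (simp add: tensor_map_pure lift_pure[OF mod(3,4) R \<phi>] lift_pure[OF mod(1,2) R bilin_comp[OF \<phi> f g]]
      lin_map_closed[OF f] lin_map_closed[OF g])

end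

lemma bimap_tensor_map:
  assumes m: "module K A" "module K H" "module K M" "module K N" "module K P" "module K Q"
      "module K X" "module K Y"
    and f: "bilin K A M P f" and g: "bilin K H N Q g"
    and \<phi>: "lin_map K X M \<phi>" and \<psi>: "lin_map K Y N \<psi>"
    and s: "s \<in> carrier (tensor K A H)" and t: "t \<in> carrier (tensor K X Y)"
  shows "tensor_bimap (tensor K P Q) f g s (tensor_map (tensor K M N) \<phi> \<psi> t) =
    tensor_bimap (tensor K P Q) (\<lambda>a x. f a (\<phi> x)) (\<lambda>h y. g h (\<psi> y)) s t"
proof (rule tensor_ext2[OF m(1,2,7,8) _ _ _ s t])
  note f' = bilin_comp[OF f lin_map_ident \<phi>] and g' = bilin_comp[OF g lin_map_ident \<psi>]
  show "bilin K (tensor K A H) (tensor K X Y) (tensor K P Q)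
      (\<lambda>s t. tensor_bimap (tensor K P Q) f g s (tensor_map (tensor K M N) \<phi> \<psi> t))"
    by (rule bilin_comp[OF bilin_bimap[OF m(1-6) f g] lin_map_ident lin_map_tensor_map[OF m(7,8,3,4) \<phi> \<psi>]])
  show "bilin K (tensor K A H) (tensor K X Y) (tensor K P Q)
      (tensor_bimap (tensor K P Q) (\<lambda>a x. f a (\<phi> x)) (\<lambda>h y. g h (\<psi> y)))"
    by (rule bilin_bimap[OF m(1,2,7,8,5,6) f' g'])
  fix a h x y assume "a \<in> carrier A" "h \<in> carrier H" "x \<in> carrier X" "y \<in> carrier Y"
  then show "tensor_bimap (tensor K P Q) f g (pure_tensor (tensor K A H) a h)
        (tensor_map (tensor K M N) \<phi> \<psi> (pure_tensor (tensor K X Y) x y)) =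
      tensor_bimap (tensor K P Q) (\<lambda>a x. f a (\<phi> x)) (\<lambda>h y. g h (\<psi> y)) (pure_tensor (tensor K A H) a h)
        (pure_tensor (tensor K X Y) x y)"
    by (simp add: tensor_map_pure[OF m(7,8,3,4) \<phi> \<psi>] bimap_pure[OF m(1-6) f g]
      bimap_pure[OF m(1,2,7,8,5,6) f' g'] lin_map_closed[OF \<phi>] lin_map_closed[OF \<psi>])
qed

lemma tensor_map_bimap:
  assumes m: "module K A" "module K H" "module K M" "module K N" "module K P" "module K Q"
      "module K X" "module K Y"
    and f: "bilin K A M P f" and g: "bilin K H N Q g"
    and \<phi>: "lin_map K P X \<phi>" and \<psi>: "lin_map K Q Y \<psi>"
    and s: "s \<in> carrier (tensor K A H)" and t: "t \<in> carrier (tensor K M N)"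
  shows "tensor_map (tensor K X Y) \<phi> \<psi> (tensor_bimap (tensor K P Q) f g s t) =
    tensor_bimap (tensor K X Y) (\<lambda>a x. \<phi> (f a x)) (\<lambda>h y. \<psi> (g h y)) s t"
proof (rule tensor_ext2[OF m(1-4) _ _ _ s t])
  note f' = bilin_lin_comp[OF \<phi> f] and g' = bilin_lin_comp[OF \<psi> g]
  show "bilin K (tensor K A H) (tensor K M N) (tensor K X Y)
      (\<lambda>s t. tensor_map (tensor K X Y) \<phi> \<psi> (tensor_bimap (tensor K P Q) f g s t))"
    by (rule bilin_lin_comp[OF lin_map_tensor_map[OF m(5-8) \<phi> \<psi>] bilin_bimap[OF m(1-6) f g]])
  show "bilin K (tensor K A H) (tensor K M N) (tensor K X Y)
      (tensor_bimap (tensor K X Y) (\<lambda>a x. \<phi> (f a x)) (\<lambda>h y. \<psi> (g h y)))"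
    by (rule bilin_bimap[OF m(1-4,7,8) f' g'])
  fix a h x y assume "a \<in> carrier A" "h \<in> carrier H" "x \<in> carrier M" "y \<in> carrier N"
  then show "tensor_map (tensor K X Y) \<phi> \<psi> (tensor_bimap (tensor K P Q) f g
        (pure_tensor (tensor K A H) a h) (pure_tensor (tensor K M N) x y)) =
      tensor_bimap (tensor K X Y) (\<lambda>a x. \<phi> (f a x)) (\<lambda>h y. \<psi> (g h y)) (pure_tensor (tensor K A H) a h)
        (pure_tensor (tensor K M N) x y)"
    by (simp add: tensor_map_pure[OF m(5-8) \<phi> \<psi>] bimap_pure[OF m(1-6) f g]
      bimap_pure[OF m(1-4,7,8) f' g'] bilin_closed[OF f] bilin_closed[OF g])
qed

section \<open>First order calculi\<close>

lemma module_cong: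
  assumes "module K M" "carrier M' = carrier M" "add M' = add M" "\<zero>\<^bsub>M'\<^esub> = \<zero>\<^bsub>M\<^esub>" "smult M' = smult M"
  shows "module K M'"
proof -
  interpret module K M by fact
  have "abelian_group M'"
    by (rule abelian_groupI) (use assms in \<open>auto simp: M.a_ac intro: bexI[of _ "\<ominus>\<^bsub>M\<^esub> x" for x] M.l_neg\<close>)
  then show ?thesis
    by (rule moduleI[OF R.is_cring])
      (simp_all add: assms smult_l_distr smult_r_distr smult_assoc1)
qed

text \<open>Equalizers here, and preimages and images in the next two lemmas, are the submodules
  into which a span is later shown to fall by testing its generators.\<close>

lemma submodule_eq:
  assumes "module K M" "module K N" "lin_map K M N f" "lin_map K M N g"
  shows "submodule {x \<in> carrier M. f x = g x} K M"
proof -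
  interpret M: module K M by fact
  interpret N: module K N by fact
  note ab = module_abelian_group[OF assms(1)] module_abelian_group[OF assms(2)]
  show ?thesis
  proof (rule M.submoduleI)
    show "\<ominus>\<^bsub>M\<^esub> a \<in> {x \<in> carrier M. f x = g x}" if "a \<in> {x \<in> carrier M. f x = g x}" for a
      using that lin_map_minus[OF assms(3) ab, of "\<zero>\<^bsub>M\<^esub>" a] lin_map_minus[OF assms(4) ab, of "\<zero>\<^bsub>M\<^esub>" a]
      by (simp add: a_minus_def lin_map_zero[OF assms(3) ab] lin_map_zero[OF assms(4) ab])
  qed (auto simp: lin_map_zero[OF assms(3) ab] lin_map_zero[OF assms(4) ab]
      lin_map_add[OF assms(3)] lin_map_add[OF assms(4)] lin_map_smult[OF assms(3)] lin_map_smult[OF assms(4)])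
qed

lemma submodule_vimage:
  assumes "module K M" "module K N" "lin_map K M N f" "submodule U K N"
  shows "submodule {x \<in> carrier M. f x \<in> U} K M"
proof -
  interpret M: module K M by fact
  interpret N: module K N by fact
  note ab = module_abelian_group[OF assms(1)] module_abelian_group[OF assms(2)]
  note U = N.submoduleE[OF assms(4)]
  have z: "\<zero>\<^bsub>N\<^esub> \<in> U"
    using subgroup.one_closed[OF submodule.axioms(1)[OF assms(4)]] by simp
  show ?thesis
  proof (rule M.submoduleI)
    show "\<ominus>\<^bsub>M\<^esub> a \<in> {x \<in> carrier M. f x \<in> U}" if "a \<in> {x \<in> carrier M. f x \<in> U}" for a
      using that lin_map_minus[OF assms(3) ab, of "\<zero>\<^bsub>M\<^esub>" a] U(3)[of "f a"] lin_map_closed[OF assms(3), of a]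
      by (simp add: a_minus_def lin_map_zero[OF assms(3) ab])
  qed (auto simp: lin_map_zero[OF assms(3) ab] z
      lin_map_add[OF assms(3)] lin_map_smult[OF assms(3)] U)
qed

lemma submodule_range:
  assumes "module K M" "module K N" "lin_map K M N f"
  shows "submodule (f ` carrier M) K N"
proof -
  interpret M: module K M by fact
  interpret N: module K N by fact
  note ab = module_abelian_group[OF assms(1)] module_abelian_group[OF assms(2)]
  show ?thesis
  proof (rule N.submoduleI)
    show "\<zero>\<^bsub>N\<^esub> \<in> f ` carrier M" using lin_map_zero[OF assms(3) ab] M.zero_closed by (metis imageI)
    show "\<ominus>\<^bsub>N\<^esub> y \<in> f ` carrier M" if y: "y \<in> f ` carrier M" for y
    proof -
      obtain x where x: "x \<in> carrier M" "y = f x" using y by auto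
      have "f (\<zero>\<^bsub>M\<^esub> \<ominus>\<^bsub>M\<^esub> x) = \<zero>\<^bsub>N\<^esub> \<ominus>\<^bsub>N\<^esub> y"
        using lin_map_minus[OF assms(3) ab M.zero_closed x(1)] x lin_map_zero[OF assms(3) ab] by simp
      moreover have "\<zero>\<^bsub>N\<^esub> \<ominus>\<^bsub>N\<^esub> y = \<ominus>\<^bsub>N\<^esub> y"
        using lin_map_closed[OF assms(3)] x by (simp add: a_minus_def)
      ultimately show ?thesis using x by (metis M.minus_closed M.zero_closed imageI)
    qed
  qed (auto simp: lin_map_closed[OF assms(3)] lin_map_add[OF assms(3), symmetric]
      lin_map_smult[OF assms(3), symmetric])
qed

lemma lspan_subset: "submodule N K M \<Longrightarrow> X \<subseteq> N \<Longrightarrow> lspan K M X \<subseteq> N"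
  unfolding lspan_def by auto

text \<open>\<open>X \<subseteq> carrier M\<close> makes the whole module one of the intersected
  submodules, which keeps the intersection inside it.\<close>

lemma submodule_lspan:
  assumes "module K M" "X \<subseteq> carrier M"
  shows "submodule (lspan K M X) K M"
proof -
  interpret module K M by fact
  have sub: "lspan K M X \<subseteq> carrier M"
    using carrier_is_submodule assms(2) by (rule lspan_subset)
  have z: "\<zero>\<^bsub>M\<^esub> \<in> N" if "submodule N K M" for N
    using subgroup.one_closed[OF submodule.axioms(1)[OF that]] by simp
  have mem: "x \<in> lspan K M X \<longleftrightarrow> (\<forall>N. submodule N K M \<and> X \<subseteq> N \<longrightarrow> x \<in> N)" for x
    by (auto simp: lspan_def)
  show ?thesis
  proof (rule submoduleI[OF sub])
    show "\<zero>\<^bsub>M\<^esub> \<in> lspan K M X" by (simp add: mem z)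
    show "\<ominus>\<^bsub>M\<^esub> x \<in> lspan K M X" if "x \<in> lspan K M X" for x
      using that submoduleE(3) by (simp add: mem)
    show "x \<oplus>\<^bsub>M\<^esub> y \<in> lspan K M X" if "x \<in> lspan K M X" "y \<in> lspan K M X" for x y
      using that submoduleE(5) by (simp add: mem)
    show "c \<odot>\<^bsub>M\<^esub> x \<in> lspan K M X" if "c \<in> carrier K" "x \<in> lspan K M X" for c x
      using that submoduleE(4) by (simp add: mem)
  qed
qed

section \<open>Calculi, and linear maps determined by their values on the forms
  \<open>a d b\<close>\<close>

lemma bimodule_bilin_lact: "bimodule K A \<Gamma> \<Longrightarrow> bilin K A \<Gamma> \<Gamma> (lact \<Gamma>)"
  and bimodule_bilin_ract: "bimodule K A \<Gamma> \<Longrightarrow> bilin K \<Gamma> A \<Gamma> (ract \<Gamma>)"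
  and bimodule_module: "bimodule K A \<Gamma> \<Longrightarrow> module K \<Gamma>"
  unfolding bimodule_def bilin_def by auto

lemma fodc_bimodule: "is_fodc K A \<Gamma> \<Longrightarrow> bimodule K A \<Gamma>"
  and fodc_lin_dif: "is_fodc K A \<Gamma> \<Longrightarrow> lin_map K A \<Gamma> (dif \<Gamma>)"
  unfolding is_fodc_def by auto

lemmas fodc_module = bimodule_module[OF fodc_bimodule]
lemmas fodc_lact = bimodule_bilin_lact[OF fodc_bimodule]
lemmas fodc_ract = bimodule_bilin_ract[OF fodc_bimodule]

lemma algebra_module: "unital_algebra K A \<Longrightarrow> module K A"
  and algebra_ring: "unital_algebra K A \<Longrightarrow> ring A"
  unfolding unital_algebra_def by auto

lemma algebra_bilin_mult:
  assumes "unital_algebra K A"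
  shows "bilin K A A A (monoid.mult A)"
proof -
  interpret A: ring A by (rule algebra_ring[OF assms])
  show ?thesis using assms unfolding unital_algebra_def bilin_def lin_map_def
    by (auto simp: A.l_distr A.r_distr)
qed

lemma fodc_span:
  assumes "is_fodc K A \<Gamma>" "submodule N K \<Gamma>"
    and "\<And>a b. a \<in> carrier A \<Longrightarrow> b \<in> carrier A \<Longrightarrow> lact \<Gamma> a (dif \<Gamma> b) \<in> N"
    and "x \<in> carrier \<Gamma>"
  shows "x \<in> N"
proof -
  have "carrier \<Gamma> = lspan K \<Gamma> {lact \<Gamma> a (dif \<Gamma> a') | a a'. a \<in> carrier A \<and> a' \<in> carrier A}"
    using assms(1) by (simp add: is_fodc_def)
  also have "\<dots> \<subseteq> N" by (rule lspan_subset[OF assms(2)]) (use assms(3) in auto)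
  finally show ?thesis using assms(4) by auto
qed

lemma fodc_ext:
  assumes "is_fodc K A \<Gamma>" "module K T" "lin_map K \<Gamma> T f" "lin_map K \<Gamma> T g"
    and "\<And>a b. a \<in> carrier A \<Longrightarrow> b \<in> carrier A \<Longrightarrow> f (lact \<Gamma> a (dif \<Gamma> b)) = g (lact \<Gamma> a (dif \<Gamma> b))"
    and "x \<in> carrier \<Gamma>"
  shows "f x = g x"
proof -
  have "x \<in> {x \<in> carrier \<Gamma>. f x = g x}"
  proof (rule fodc_span[OF assms(1) submodule_eq[OF fodc_module[OF assms(1)] assms(2-4)] _ assms(6)])
    fix a b assume ab: "a \<in> carrier A" "b \<in> carrier A"
    show "lact \<Gamma> a (dif \<Gamma> b) \<in> {x \<in> carrier \<Gamma>. f x = g x}"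
      using assms(5)[OF ab] bilin_closed[OF fodc_lact[OF assms(1)] ab(1) lin_map_closed[OF fodc_lin_dif[OF assms(1)] ab(2)]]
      by blast
  qed
  then show ?thesis by simp
qed

text \<open>Left multiplication takes spanning forms to spanning forms,
  \<open>a (b dc) = (ab) dc\<close>, so the action law for \<open>L\<close> turns the formula on
  generators into left linearity.\<close>

lemma fodc_map_left:
  assumes A: "unital_algebra K A" and \<Gamma>: "is_fodc K A \<Gamma>" and T: "module K T" and \<Phi>: "lin_map K \<Gamma> T \<Phi>"
    and L: "\<And>a. a \<in> carrier A \<Longrightarrow> lin_map K T T (L a)"
    and LL: "\<And>a b x. a \<in> carrier A \<Longrightarrow> b \<in> carrier A \<Longrightarrow> x \<in> carrier T \<Longrightarrow> L (a \<otimes>\<^bsub>A\<^esub> b) x = L a (L b x)"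
    and D: "\<And>a. a \<in> carrier A \<Longrightarrow> D a \<in> carrier T"
    and eq: "\<And>a b. a \<in> carrier A \<Longrightarrow> b \<in> carrier A \<Longrightarrow> \<Phi> (lact \<Gamma> a (dif \<Gamma> b)) = L a (D b)"
    and a: "a \<in> carrier A" and x: "x \<in> carrier \<Gamma>"
  shows "\<Phi> (lact \<Gamma> a x) = L a (\<Phi> x)"
proof (rule fodc_ext[OF \<Gamma> T lin_map_comp[OF \<Phi> bilin_right[OF fodc_lact[OF \<Gamma>] a]] lin_map_comp[OF L[OF a] \<Phi>] _ x])
  interpret A: ring A by (rule algebra_ring[OF A])
  fix b c assume bc: "b \<in> carrier A" "c \<in> carrier A"
  have "lact \<Gamma> (a \<otimes>\<^bsub>A\<^esub> b) (dif \<Gamma> c) = lact \<Gamma> a (lact \<Gamma> b (dif \<Gamma> c))"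
    using fodc_bimodule[OF \<Gamma>] a bc lin_map_closed[OF fodc_lin_dif[OF \<Gamma>]] unfolding bimodule_def by blast
  then show "\<Phi> (lact \<Gamma> a (lact \<Gamma> b (dif \<Gamma> c))) = L a (\<Phi> (lact \<Gamma> b (dif \<Gamma> c)))"
    using eq[of "a \<otimes>\<^bsub>A\<^esub> b" c] eq[of b c] LL[of a b "D c"] D a bc by simp
qed

text \<open>Right multiplication does not preserve the spanning forms, but the Leibniz rule gives
  \<open>(b dc) a = b d(ca) - (bc) da\<close>. The same rule for \<open>D\<close> in the target
  makes the two expansions match.\<close>

lemma fodc_map_right:
  assumes A: "unital_algebra K A" and \<Gamma>: "is_fodc K A \<Gamma>" and T: "module K T" and \<Phi>: "lin_map K \<Gamma> T \<Phi>"
    and L: "\<And>a. a \<in> carrier A \<Longrightarrow> lin_map K T T (L a)"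
    and R: "\<And>a. a \<in> carrier A \<Longrightarrow> lin_map K T T (\<lambda>x. R x a)"
    and LL: "\<And>a b x. a \<in> carrier A \<Longrightarrow> b \<in> carrier A \<Longrightarrow> x \<in> carrier T \<Longrightarrow> L (a \<otimes>\<^bsub>A\<^esub> b) x = L a (L b x)"
    and LR: "\<And>a b x. a \<in> carrier A \<Longrightarrow> b \<in> carrier A \<Longrightarrow> x \<in> carrier T \<Longrightarrow> R (L a x) b = L a (R x b)"
    and D: "\<And>a. a \<in> carrier A \<Longrightarrow> D a \<in> carrier T"
    and leibniz: "\<And>a b. a \<in> carrier A \<Longrightarrow> b \<in> carrier A \<Longrightarrow> D (a \<otimes>\<^bsub>A\<^esub> b) = R (D a) b \<oplus>\<^bsub>T\<^esub> L a (D b)"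
    and eq: "\<And>a b. a \<in> carrier A \<Longrightarrow> b \<in> carrier A \<Longrightarrow> \<Phi> (lact \<Gamma> a (dif \<Gamma> b)) = L a (D b)"
    and a: "a \<in> carrier A" and x: "x \<in> carrier \<Gamma>"
  shows "\<Phi> (ract \<Gamma> x a) = R (\<Phi> x) a"
proof (rule fodc_ext[OF \<Gamma> T lin_map_comp[OF \<Phi> bilin_left[OF fodc_ract[OF \<Gamma>] a]] lin_map_comp[OF R[OF a] \<Phi>] _ x])
  interpret A: ring A by (rule algebra_ring[OF A])
  interpret T: module K T by (rule T)
  interpret G: module K \<Gamma> by (rule fodc_module[OF \<Gamma>])
  fix b c assume bc: "b \<in> carrier A" "c \<in> carrier A"
  note bim = fodc_bimodule[OF \<Gamma>, unfolded bimodule_def]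
  note dc = lin_map_closed[OF fodc_lin_dif[OF \<Gamma>]]
  note lc = bilin_closed[OF fodc_lact[OF \<Gamma>]] and rc = bilin_closed[OF fodc_ract[OF \<Gamma>]]
  have Lc: "L u v \<in> carrier T" if "u \<in> carrier A" "v \<in> carrier T" for u v
    using lin_map_closed[OF L] that .
  have Rc: "R v u \<in> carrier T" if "u \<in> carrier A" "v \<in> carrier T" for u v
    using lin_map_closed[OF R] that .
  note c = a bc dc lc rc
  have "dif \<Gamma> (c \<otimes>\<^bsub>A\<^esub> a) = ract \<Gamma> (dif \<Gamma> c) a \<oplus>\<^bsub>\<Gamma>\<^esub> lact \<Gamma> c (dif \<Gamma> a)"
    using \<Gamma> a bc unfolding is_fodc_def by blast
  then have "lact \<Gamma> b (dif \<Gamma> (c \<otimes>\<^bsub>A\<^esub> a)) =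
      ract \<Gamma> (lact \<Gamma> b (dif \<Gamma> c)) a \<oplus>\<^bsub>\<Gamma>\<^esub> lact \<Gamma> (b \<otimes>\<^bsub>A\<^esub> c) (dif \<Gamma> a)"
    using bim c by (simp add: lin_map_add[OF bilin_right[OF fodc_lact[OF \<Gamma>]]])
  then have "\<Phi> (lact \<Gamma> b (dif \<Gamma> (c \<otimes>\<^bsub>A\<^esub> a))) =
      \<Phi> (ract \<Gamma> (lact \<Gamma> b (dif \<Gamma> c)) a) \<oplus>\<^bsub>T\<^esub> \<Phi> (lact \<Gamma> (b \<otimes>\<^bsub>A\<^esub> c) (dif \<Gamma> a))"
    using c by (simp add: lin_map_add[OF \<Phi>])
  \<comment> \<open>Both sides contain the image of \<open>(bc) da\<close>; cancelling it leaves the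
    value on \<open>(b dc) a\<close>.\<close>
  then have "L b (R (D c) a) \<oplus>\<^bsub>T\<^esub> L b (L c (D a)) =
      \<Phi> (ract \<Gamma> (lact \<Gamma> b (dif \<Gamma> c)) a) \<oplus>\<^bsub>T\<^esub> L b (L c (D a))"
    using c D Lc Rc by (simp add: eq leibniz LL lin_map_add[OF L])
  then have "\<Phi> (ract \<Gamma> (lact \<Gamma> b (dif \<Gamma> c)) a) = L b (R (D c) a)"
    using c D Lc Rc lin_map_closed[OF \<Phi>] by (simp add: T.add.right_cancel)
  then show "\<Phi> (ract \<Gamma> (lact \<Gamma> b (dif \<Gamma> c)) a) = R (\<Phi> (lact \<Gamma> b (dif \<Gamma> c))) a"
    using c D by (simp add: eq LR)
qed

text \<open>Nothing is known about \<open>\<Gamma>'\<close> beyond its operations, so all laws,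
  those of an abelian group included, are pulled back along the bijection to
  \<open>\<Gamma>\<close>.\<close>

lemma fodc_iso:
  fixes \<Gamma> :: "('k, 'a, 'g) fodc" and \<Gamma>' :: "('k, 'a, 'w) fodc"
  assumes A: "unital_algebra K A" and \<Gamma>: "is_fodc K A \<Gamma>"
    and bij: "bij_betw \<iota> (carrier \<Gamma>) (carrier \<Gamma>')"
    and add: "\<And>x y. x \<in> carrier \<Gamma> \<Longrightarrow> y \<in> carrier \<Gamma> \<Longrightarrow> \<iota> (x \<oplus>\<^bsub>\<Gamma>\<^esub> y) = \<iota> x \<oplus>\<^bsub>\<Gamma>'\<^esub> \<iota> y"
    and zero: "\<iota> \<zero>\<^bsub>\<Gamma>\<^esub> = \<zero>\<^bsub>\<Gamma>'\<^esub>"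
    and smult: "\<And>c x. c \<in> carrier K \<Longrightarrow> x \<in> carrier \<Gamma> \<Longrightarrow> \<iota> (c \<odot>\<^bsub>\<Gamma>\<^esub> x) = c \<odot>\<^bsub>\<Gamma>'\<^esub> \<iota> x"
    and lact: "\<And>a x. a \<in> carrier A \<Longrightarrow> x \<in> carrier \<Gamma> \<Longrightarrow> \<iota> (lact \<Gamma> a x) = lact \<Gamma>' a (\<iota> x)"
    and ract: "\<And>a x. a \<in> carrier A \<Longrightarrow> x \<in> carrier \<Gamma> \<Longrightarrow> \<iota> (ract \<Gamma> x a) = ract \<Gamma>' (\<iota> x) a"
    and dif: "\<And>a. a \<in> carrier A \<Longrightarrow> \<iota> (dif \<Gamma> a) = dif \<Gamma>' a"
  shows "is_fodc K A \<Gamma>'" "lin_map K \<Gamma> \<Gamma>' \<iota>"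
    "lin_map K \<Gamma>' \<Gamma> (inv_into (carrier \<Gamma>) \<iota>)"
proof -
  note mG = fodc_module[OF \<Gamma>]
  interpret G: module K \<Gamma> by (rule mG)
  interpret A: ring A by (rule algebra_ring[OF A])
  have im: "\<iota> ` carrier \<Gamma> = carrier \<Gamma>'" and inj: "inj_on \<iota> (carrier \<Gamma>)"
    using bij by (auto simp: bij_betw_def)
  have c: "\<iota> x \<in> carrier \<Gamma>'" if "x \<in> carrier \<Gamma>" for x using im that by auto
  have pre: "\<exists>x\<in>carrier \<Gamma>. x' = \<iota> x" if "x' \<in> carrier \<Gamma>'" for x' using im that by auto
  show l\<iota>: "lin_map K \<Gamma> \<Gamma>' \<iota>" by (rule lin_mapI) (simp_all add: c add smult)
  \<comment> \<open>With the carrier rewritten as an image, every element of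
    \<open>\<Gamma>'\<close> becomes some \<open>\<iota> x\<close> and its operations become those
    of \<open>\<Gamma>\<close>.\<close>
  note push = im[symmetric] add[symmetric] zero[symmetric] smult[symmetric]
  have neg: "\<exists>y\<in>carrier \<Gamma>. \<iota> (y \<oplus>\<^bsub>\<Gamma>\<^esub> x) = \<iota> \<zero>\<^bsub>\<Gamma>\<^esub>" if "x \<in> carrier \<Gamma>" for x
    using that by (intro bexI[of _ "\<ominus>\<^bsub>\<Gamma>\<^esub> x"]) (simp_all add: G.l_neg)
  have ab: "abelian_group \<Gamma>'"
    by (rule abelian_groupI) (use neg in \<open>auto simp: push G.a_ac\<close>)
  have mG': "module K \<Gamma>'"
    by (rule moduleI[OF G.R.is_cring ab])
      (auto simp: push G.smult_l_distr G.smult_r_distr G.smult_assoc1)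
  define j where "j = inv_into (carrier \<Gamma>) \<iota>"
  have j\<iota>: "j (\<iota> x) = x" if "x \<in> carrier \<Gamma>" for x
    using that inj by (simp add: j_def)
  have lj: "lin_map K \<Gamma>' \<Gamma> j"
    by (rule lin_mapI) (auto simp: push j\<iota>)
  then show "lin_map K \<Gamma>' \<Gamma> (inv_into (carrier \<Gamma>) \<iota>)" by (simp add: j_def)
  note jc = lin_map_closed[OF lj]
  have \<iota>j: "\<iota> (j x') = x'" if "x' \<in> carrier \<Gamma>'" for x'
    using that im by (simp add: j_def f_inv_into_f)
  have lact': "lact \<Gamma>' a x' = \<iota> (lact \<Gamma> a (j x'))" if "a \<in> carrier A" "x' \<in> carrier \<Gamma>'" for a x'
    using that by (simp add: lact jc \<iota>j)
  have ract': "ract \<Gamma>' x' a = \<iota> (ract \<Gamma> (j x') a)" if "a \<in> carrier A" "x' \<in> carrier \<Gamma>'" for a x'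
    using that by (simp add: ract jc \<iota>j)
  note lc = bilin_closed[OF fodc_lact[OF \<Gamma>]] and rc = bilin_closed[OF fodc_ract[OF \<Gamma>]]
  note dc = lin_map_closed[OF fodc_lin_dif[OF \<Gamma>]]
  have bimG: "lact \<Gamma> \<one>\<^bsub>A\<^esub> x = x" "ract \<Gamma> x \<one>\<^bsub>A\<^esub> = x" "lact \<Gamma> (a \<otimes>\<^bsub>A\<^esub> b) x = lact \<Gamma> a (lact \<Gamma> b x)"
      "ract \<Gamma> x (a \<otimes>\<^bsub>A\<^esub> b) = ract \<Gamma> (ract \<Gamma> x a) b" "ract \<Gamma> (lact \<Gamma> a x) b = lact \<Gamma> a (ract \<Gamma> x b)"
    if "a \<in> carrier A" "b \<in> carrier A" "x \<in> carrier \<Gamma>" for a b x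
    using fodc_bimodule[OF \<Gamma>] that unfolding bimodule_def by blast+
  have bl: "bilin K A \<Gamma>' \<Gamma>' (lact \<Gamma>')"
    by (rule bilin_cong[OF bilin_lin_comp[OF l\<iota> bilin_comp[OF fodc_lact[OF \<Gamma>] lin_map_ident lj]] lact' algebra_module[OF A] mG'])
  have br: "bilin K \<Gamma>' A \<Gamma>' (ract \<Gamma>')"
    by (rule bilin_cong[OF bilin_lin_comp[OF l\<iota> bilin_comp[OF fodc_ract[OF \<Gamma>] lj lin_map_ident]] ract' mG' algebra_module[OF A]])
  have bim: "bimodule K A \<Gamma>'"
    unfolding bimodule_def
    using bl br mG' bimG
    by (auto simp: bilin_def lact' ract' j\<iota> c jc lc rc \<iota>j bimG(1,2)[OF A.one_closed A.one_closed] simp del: bimG)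
  have ld: "lin_map K A \<Gamma>' (dif \<Gamma>')"
    by (rule lin_map_cong[OF lin_map_comp[OF l\<iota> fodc_lin_dif[OF \<Gamma>]] _ algebra_module[OF A]]) (simp add: dif)
  have leib: "dif \<Gamma>' (a \<otimes>\<^bsub>A\<^esub> b) = ract \<Gamma>' (dif \<Gamma>' a) b \<oplus>\<^bsub>\<Gamma>'\<^esub> lact \<Gamma>' a (dif \<Gamma>' b)"
    if "a \<in> carrier A" "b \<in> carrier A" for a b
  proof -
    have "dif \<Gamma> (a \<otimes>\<^bsub>A\<^esub> b) = ract \<Gamma> (dif \<Gamma> a) b \<oplus>\<^bsub>\<Gamma>\<^esub> lact \<Gamma> a (dif \<Gamma> b)"
      using \<Gamma> that by (simp add: is_fodc_def)
    then show ?thesis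
      using that by (simp add: dif[symmetric] ract[symmetric] lact[symmetric] add[symmetric] dc lc rc)
  qed
  let ?Y = "{lact \<Gamma>' a (dif \<Gamma>' a') | a a'. a \<in> carrier A \<and> a' \<in> carrier A}"
  interpret G': module K \<Gamma>' by (rule mG')
  have "carrier \<Gamma>' = lspan K \<Gamma>' ?Y"
  proof
    show "carrier \<Gamma>' \<subseteq> lspan K \<Gamma>' ?Y"
    proof
      fix x' assume "x' \<in> carrier \<Gamma>'"
      then obtain x where x: "x \<in> carrier \<Gamma>" "x' = \<iota> x" using pre by meson
      have "x' \<in> N" if N: "submodule N K \<Gamma>'" "?Y \<subseteq> N" for N
      proof -
        have "x \<in> {x \<in> carrier \<Gamma>. \<iota> x \<in> N}"
        proof (rule fodc_span[OF \<Gamma> submodule_vimage[OF mG mG' l\<iota> N(1)] _ x(1)])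
          fix a b assume ab: "a \<in> carrier A" "b \<in> carrier A"
          then have "\<iota> (lact \<Gamma> a (dif \<Gamma> b)) \<in> ?Y" by (auto simp: lact dif dc)
          then show "lact \<Gamma> a (dif \<Gamma> b) \<in> {x \<in> carrier \<Gamma>. \<iota> x \<in> N}" using N(2) ab by (auto simp: lc dc)
        qed
        then show ?thesis using x by simp
      qed
      then show "x' \<in> lspan K \<Gamma>' ?Y" by (simp add: lspan_def)
    qed
    have "lact \<Gamma>' a (dif \<Gamma>' b) \<in> carrier \<Gamma>'" if "a \<in> carrier A" "b \<in> carrier A" for a b
      using bilin_closed[OF bl] lin_map_closed[OF ld] that by blast
    then show "lspan K \<Gamma>' ?Y \<subseteq> carrier \<Gamma>'"
      by (intro lspan_subset[OF G'.carrier_is_submodule]) auto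
  qed
  then show "is_fodc K A \<Gamma>'"
    unfolding is_fodc_def using bim ld leib by simp
qed

lemma algebra_map_mult_tensor:
  assumes "algebra_map K A (tensor K M N) f" "x \<in> carrier A" "y \<in> carrier A"
  shows "f (x \<otimes>\<^bsub>A\<^esub> y) = tensor_bimap (tensor K M N) (monoid.mult M) (monoid.mult N) (f x) (f y)"
  using assms unfolding algebra_map_def ring_hom_def by (simp add: mult_tensor tensor_bimap_def)

section \<open>Hopf algebras and comodule algebras in Sweedler notation\<close>

locale hopf_alg =
  fixes K :: "('k, 'x) ring_scheme" and H :: "('k, 'h) hopf"
  assumes hopf: "hopf_algebra K H"
begin

lemma alg_H: "unital_algebra K H"
  using hopf by (simp add: hopf_algebra_def Let_def)

lemmas mod_H = algebra_module[OF alg_H]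

sublocale H: ring H by (rule algebra_ring[OF alg_H])
sublocale HM: module K H by (rule mod_H)

lemmas bilin_H = algebra_bilin_mult[OF alg_H]

lemma counit_closed: "h \<in> carrier H \<Longrightarrow> counit H h \<in> carrier K"
  and counit_add: "h \<in> carrier H \<Longrightarrow> g \<in> carrier H \<Longrightarrow> counit H (h \<oplus>\<^bsub>H\<^esub> g) = counit H h \<oplus>\<^bsub>K\<^esub> counit H g"
  and counit_mult: "h \<in> carrier H \<Longrightarrow> g \<in> carrier H \<Longrightarrow> counit H (h \<otimes>\<^bsub>H\<^esub> g) = counit H h \<otimes>\<^bsub>K\<^esub> counit H g"
  and counit_one: "counit H \<one>\<^bsub>H\<^esub> = \<one>\<^bsub>K\<^esub>"
  and counit_smult: "c \<in> carrier K \<Longrightarrow> h \<in> carrier H \<Longrightarrow> counit H (c \<odot>\<^bsub>H\<^esub> h) = c \<otimes>\<^bsub>K\<^esub> counit H h"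
  using hopf by (auto simp: hopf_algebra_def Let_def ring_hom_def)

lemma lin_antipode: "lin_map K H H (antipode H)"
  using hopf by (simp add: hopf_algebra_def Let_def)

lemma antipode_left: "h \<in> carrier H \<Longrightarrow>
    tensor_lift H (comult H h) (\<lambda>x y. antipode H x \<otimes>\<^bsub>H\<^esub> y) = counit H h \<odot>\<^bsub>H\<^esub> \<one>\<^bsub>H\<^esub>"
  and antipode_right: "h \<in> carrier H \<Longrightarrow>
    tensor_lift H (comult H h) (\<lambda>x y. x \<otimes>\<^bsub>H\<^esub> antipode H y) = counit H h \<odot>\<^bsub>H\<^esub> \<one>\<^bsub>H\<^esub>"
  and counit_left: "h \<in> carrier H \<Longrightarrow> tensor_lift H (comult H h) (\<lambda>x y. counit H x \<odot>\<^bsub>H\<^esub> y) = h"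
  using hopf by (simp_all add: hopf_algebra_def Let_def)

lemma comodule_algebra_self: "comodule_algebra K H H (comult H)"
  using hopf by (simp add: hopf_algebra_def comodule_algebra_def Let_def)

lemma bilin_counit:
  assumes "module K P" "lin_map K X P g"
  shows "bilin K X H P (\<lambda>x h. counit H h \<odot>\<^bsub>P\<^esub> g x)"
proof (rule bilinI)
  interpret P: module K P by fact
  show "lin_map K X P (\<lambda>x. counit H h \<odot>\<^bsub>P\<^esub> g x)" if "h \<in> carrier H" for h
    by (rule lin_map_comp[OF module_carrier_lin_smult[OF assms(1) counit_closed[OF that]] assms(2)])
  show "lin_map K H P (\<lambda>h. counit H h \<odot>\<^bsub>P\<^esub> g x)" if "x \<in> carrier X" for x
    by (rule lin_mapI)
      (use lin_map_closed[OF assms(2) that] in \<open>simp_all add: counit_closed counit_add counit_smult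
        P.smult_l_distr P.smult_assoc1\<close>)
qed

end

locale comodule_alg = hopf_alg K H
  for K :: "('k, 'x) ring_scheme" and H :: "('k, 'h) hopf" +
  fixes A :: "('k, 'a, 'y) module_scheme" and \<delta> :: "'a \<Rightarrow> ('a \<times> 'h \<Rightarrow>\<^sub>0 int) set"
  assumes comod: "comodule_algebra K H A \<delta>"
begin

lemma alg_A: "unital_algebra K A"
  using comod by (simp add: comodule_algebra_def Let_def)

lemmas mod_A = algebra_module[OF alg_A]

sublocale A: ring A by (rule algebra_ring[OF alg_A])
sublocale AM: module K A by (rule mod_A)

lemmas bilin_A = algebra_bilin_mult[OF alg_A]

lemma algebra_map_coact: "algebra_map K A (tensor K A H) \<delta>"
  using comod by (simp add: comodule_algebra_def Let_def)

lemma lin_coact: "lin_map K A (tensor K A H) \<delta>"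
  using algebra_map_coact by (simp add: algebra_map_def)

lemmas coact_closed = lin_map_closed[OF lin_coact]

lemma coact_one: "\<delta> \<one>\<^bsub>A\<^esub> = pure_tensor (tensor K A H) \<one>\<^bsub>A\<^esub> \<one>\<^bsub>H\<^esub>"
  using algebra_map_coact by (simp add: algebra_map_def ring_hom_def one_tensor)

lemmas coact_mult = algebra_map_mult_tensor[OF algebra_map_coact]

text \<open>After the first leg is split once more, the inner sum must be bilinear in the two outer
  legs before it can be summed again. \<open>bilin_coact_right\<close> is the counterpart for
  splitting the second leg.\<close>

lemma bilin_coact_left:
  assumes P: "module K P"
    and G: "\<And>h. h \<in> carrier H \<Longrightarrow> bilin K A H P (\<lambda>y g. G y g h)"
      "\<And>y. y \<in> carrier A \<Longrightarrow> bilin K H H P (G y)"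
  shows "bilin K A H P (\<lambda>x h. tensor_lift P (\<delta> x) (\<lambda>y g. G y g h))"
proof (rule bilinI)
  show "lin_map K A P (\<lambda>x. tensor_lift P (\<delta> x) (\<lambda>y g. G y g h))" if "h \<in> carrier H" for h
    by (rule lin_map_lift_comp[OF mod_A mod_H P G(1)[OF that] lin_coact])
  show "lin_map K H P (\<lambda>h. tensor_lift P (\<delta> x) (\<lambda>y g. G y g h))" if "x \<in> carrier A" for x
    by (rule lin_map_lift_param[OF mod_A mod_H P mod_H coact_closed[OF that] G(1) bilin_right[OF G(2)]])
qed

lemma bilin_coact_right:
  assumes P: "module K P"
    and G: "\<And>h. h \<in> carrier H \<Longrightarrow> bilin K A H P (\<lambda>y g. G y g h)"
      "\<And>y. y \<in> carrier A \<Longrightarrow> bilin K H H P (G y)"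
    and t: "lin_map K H (tensor K H H) \<Delta>"
  shows "bilin K A H P (\<lambda>x h. tensor_lift P (\<Delta> h) (G x))"
proof (rule bilinI)
  show "lin_map K H P (\<lambda>h. tensor_lift P (\<Delta> h) (G x))" if "x \<in> carrier A" for x
    by (rule lin_map_lift_comp[OF mod_H mod_H P G(2)[OF that] t])
  have "lin_map K A P (\<lambda>x. G x g h)" if "g \<in> carrier H" "h \<in> carrier H" for g h
    by (rule bilin_left[OF G(1)[OF that(2)] that(1)])
  then show "lin_map K A P (\<lambda>x. tensor_lift P (\<Delta> h) (G x))" if "h \<in> carrier H" for h
    using that by (intro lin_map_lift_param[OF mod_H mod_H P mod_A lin_map_closed[OF t that] G(2)])
qed

text \<open>The axiom equates two tensors in \<open>A \<otimes> (H \<otimes> H)\<close>. The linear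
  map \<open>?\<Psi>\<close> in the proof integrates \<open>G\<close> over such a tensor, and
  applying it to both of them gives coassociativity under an arbitrary multilinear expression.
  Linearity of \<open>comult\<close> is a premise because it is obtained afterwards, from
  \<open>H\<close> as a comodule over itself.\<close>

lemma coassoc_lift:
  assumes \<Delta>: "lin_map K H (tensor K H H) (comult H)"
    and P: "module K P"
    and G: "\<And>h. h \<in> carrier H \<Longrightarrow> bilin K A H P (\<lambda>y g. G y g h)"
      "\<And>y. y \<in> carrier A \<Longrightarrow> bilin K H H P (G y)"
    and a: "a \<in> carrier A"
  shows "tensor_lift P (\<delta> a) (\<lambda>x h. tensor_lift P (\<delta> x) (\<lambda>y g. G y g h)) =
    tensor_lift P (\<delta> a) (\<lambda>x h. tensor_lift P (comult H h) (G x))"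
proof -
  let ?HH = "tensor K H H" and ?AHH = "tensor K A (tensor K H H)"
  let ?p = "\<lambda>y g h. pure_tensor ?AHH y (pure_tensor ?HH g h)"
  let ?\<Psi> = "\<lambda>t. tensor_lift P t (\<lambda>y w. tensor_lift P w (G y))"
  note mHH = module_tensor[OF mod_H mod_H]
  note mAHH = module_tensor[OF mod_A mHH]
  have b: "bilin K A ?HH P (\<lambda>y w. tensor_lift P w (G y))"
  proof (rule bilinI)
    have "lin_map K A P (\<lambda>x. G x g h)" if "g \<in> carrier H" "h \<in> carrier H" for g h
      by (rule bilin_left[OF G(1)[OF that(2)] that(1)])
    then show "lin_map K A P (\<lambda>y. tensor_lift P w (G y))" if "w \<in> carrier ?HH" for w
      using that by (intro lin_map_lift_param[OF mod_H mod_H P mod_A that G(2)])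
    show "lin_map K ?HH P (\<lambda>w. tensor_lift P w (G y))" if "y \<in> carrier A" for y
      by (rule lin_map_lift[OF mod_H mod_H P G(2)[OF that]])
  qed
  have p1: "bilin K A H ?AHH (\<lambda>y g. ?p y g h)" if "h \<in> carrier H" for h
    by (rule bilin_comp[OF bilin_pure[OF mod_A mHH] lin_map_ident bilin_left[OF bilin_pure[OF mod_H mod_H] that]])
  have p2: "bilin K H H ?AHH (?p y)" if "y \<in> carrier A" for y
    by (rule bilin_lin_comp[OF bilin_right[OF bilin_pure[OF mod_A mHH] that] bilin_pure[OF mod_H mod_H]])
  have \<Psi>: "lin_map K ?AHH P ?\<Psi>"
    by (rule lin_map_lift[OF mod_A mHH P b])
  have \<Psi>p: "?\<Psi> (pure_tensor ?AHH y w) = tensor_lift P w (G y)" if "y \<in> carrier A" "w \<in> carrier ?HH" for y w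
    by (rule lift_pure[OF mod_A mHH P b that])
  have \<Psi>pp: "?\<Psi> (?p y g h) = G y g h" if "y \<in> carrier A" "g \<in> carrier H" "h \<in> carrier H" for y g h
    using that by (simp add: \<Psi>p tensor_pure_closed[OF mod_H mod_H] lift_pure[OF mod_H mod_H P G(2)])
  have "?\<Psi> (tensor_lift ?AHH (\<delta> a) (\<lambda>x h. tensor_lift ?AHH (\<delta> x) (\<lambda>y g. ?p y g h))) =
      tensor_lift P (\<delta> a) (\<lambda>x h. ?\<Psi> (tensor_lift ?AHH (\<delta> x) (\<lambda>y g. ?p y g h)))"
    by (rule lin_map_lift_commute[OF mod_A mod_H mAHH P \<Psi> bilin_coact_left[OF mAHH p1 p2] coact_closed[OF a]])
  also have "\<dots> = tensor_lift P (\<delta> a) (\<lambda>x h. tensor_lift P (\<delta> x) (\<lambda>y g. G y g h))"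
  proof (rule lift_cong[OF mod_A mod_H P bilin_coact_left[OF P G] coact_closed[OF a]])
    fix x h assume x: "x \<in> carrier A" and h: "h \<in> carrier H"
    have "?\<Psi> (tensor_lift ?AHH (\<delta> x) (\<lambda>y g. ?p y g h)) = tensor_lift P (\<delta> x) (\<lambda>y g. ?\<Psi> (?p y g h))"
      by (rule lin_map_lift_commute[OF mod_A mod_H mAHH P \<Psi> p1[OF h] coact_closed[OF x]])
    also have "\<dots> = tensor_lift P (\<delta> x) (\<lambda>y g. G y g h)"
      by (rule lift_cong[OF mod_A mod_H P G(1)[OF h] coact_closed[OF x] \<Psi>pp]) (use h in auto)
    finally show "?\<Psi> (tensor_lift ?AHH (\<delta> x) (\<lambda>y g. ?p y g h)) = tensor_lift P (\<delta> x) (\<lambda>y g. G y g h)" .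
  qed
  finally have 1: "?\<Psi> (tensor_lift ?AHH (\<delta> a) (\<lambda>x h. tensor_lift ?AHH (\<delta> x) (\<lambda>y g. ?p y g h))) =
    tensor_lift P (\<delta> a) (\<lambda>x h. tensor_lift P (\<delta> x) (\<lambda>y g. G y g h))" .
  have "?\<Psi> (tensor_lift ?AHH (\<delta> a) (\<lambda>x h. pure_tensor ?AHH x (comult H h))) =
      tensor_lift P (\<delta> a) (\<lambda>x h. ?\<Psi> (pure_tensor ?AHH x (comult H h)))"
    by (rule lin_map_lift_commute[OF mod_A mod_H mAHH P \<Psi>
      bilin_comp[OF bilin_pure[OF mod_A mHH] lin_map_ident \<Delta>] coact_closed[OF a]])
  also have "\<dots> = tensor_lift P (\<delta> a) (\<lambda>x h. tensor_lift P (comult H h) (G x))"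
    by (rule lift_cong[OF mod_A mod_H P bilin_coact_right[OF P G \<Delta>] coact_closed[OF a] \<Psi>p])
      (use lin_map_closed[OF \<Delta>] in auto)
  finally have 2: "?\<Psi> (tensor_lift ?AHH (\<delta> a) (\<lambda>x h. pure_tensor ?AHH x (comult H h))) =
    tensor_lift P (\<delta> a) (\<lambda>x h. tensor_lift P (comult H h) (G x))" .
  have "tensor_lift ?AHH (\<delta> a) (\<lambda>x h. tensor_lift ?AHH (\<delta> x) (\<lambda>y g. ?p y g h)) =
      tensor_lift ?AHH (\<delta> a) (\<lambda>x h. pure_tensor ?AHH x (comult H h))"
    using comod a by (simp add: comodule_algebra_def Let_def)
  with 1 2 show ?thesis by simp
qed

lemma counit_lift:
  assumes P: "module K P" and g: "lin_map K A P g" and a: "a \<in> carrier A"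
  shows "tensor_lift P (\<delta> a) (\<lambda>x h. counit H h \<odot>\<^bsub>P\<^esub> g x) = g a"
proof -
  have "g (tensor_lift A (\<delta> a) (\<lambda>x h. counit H h \<odot>\<^bsub>A\<^esub> x)) =
      tensor_lift P (\<delta> a) (\<lambda>x h. g (counit H h \<odot>\<^bsub>A\<^esub> x))"
    by (rule lin_map_lift_commute[OF mod_A mod_H mod_A P g bilin_counit[OF mod_A lin_map_ident] coact_closed[OF a]])
  also have "\<dots> = tensor_lift P (\<delta> a) (\<lambda>x h. counit H h \<odot>\<^bsub>P\<^esub> g x)"
    by (rule lift_cong[OF mod_A mod_H P bilin_counit[OF P g] coact_closed[OF a]])
      (simp add: lin_map_smult[OF g] counit_closed)
  finally show ?thesis
    using comod a by (simp add: comodule_algebra_def Let_def)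
qed

end

text \<open>The coproduct is a coaction of \<open>H\<close> on itself, so each Sweedler rule for
  coactions becomes a rule for \<open>comult\<close>.\<close>

sublocale hopf_alg \<subseteq> self: comodule_alg K H H "comult H"
  by unfold_locales (rule comodule_algebra_self)

context hopf_alg
begin

lemmas lin_comult = self.lin_coact
lemmas comult_closed = self.coact_closed

text \<open>\<open>self.counit_lift\<close> applies the counit to the second leg; the first leg
  needs the other counit axiom.\<close>

lemma counit_lift_left:
  assumes P: "module K P" and g: "lin_map K H P g" and h: "h \<in> carrier H"
  shows "tensor_lift P (comult H h) (\<lambda>x y. counit H x \<odot>\<^bsub>P\<^esub> g y) = g h"
proof -
  have "g (tensor_lift H (comult H h) (\<lambda>x y. counit H x \<odot>\<^bsub>H\<^esub> y)) =
      tensor_lift P (comult H h) (\<lambda>x y. g (counit H x \<odot>\<^bsub>H\<^esub> y))"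
    by (rule lin_map_lift_commute[OF mod_H mod_H mod_H P g bilin_flip[OF bilin_counit[OF mod_H lin_map_ident]] comult_closed[OF h]])
  also have "\<dots> = tensor_lift P (comult H h) (\<lambda>x y. counit H x \<odot>\<^bsub>P\<^esub> g y)"
    by (rule lift_cong[OF mod_H mod_H P bilin_flip[OF bilin_counit[OF P g]] comult_closed[OF h]])
      (simp add: lin_map_smult[OF g] counit_closed)
  finally show ?thesis using counit_left[OF h] by simp
qed

text \<open>\<open>\<alpha>\<close> is convolution inverse to \<open>\<beta>\<close>, so that \<open>F\<close> can be recovered from \<open>h \<mapsto> \<beta> h\<^sub>1 \<cdot> F h\<^sub>2\<close>.\<close>

lemma convolution_cancel:
  assumes V: "module K V" and act: "bilin K H V V act"
    and act_mult: "\<And>x y v. x \<in> carrier H \<Longrightarrow> y \<in> carrier H \<Longrightarrow> v \<in> carrier V \<Longrightarrow>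
      act (x \<otimes>\<^bsub>H\<^esub> y) v = act x (act y v)"
    and act_one: "\<And>v. v \<in> carrier V \<Longrightarrow> act \<one>\<^bsub>H\<^esub> v = v"
    and \<alpha>: "lin_map K H H \<alpha>" and \<beta>: "lin_map K H H \<beta>"
    and inv: "\<And>h. h \<in> carrier H \<Longrightarrow>
      tensor_lift H (comult H h) (\<lambda>x y. \<alpha> x \<otimes>\<^bsub>H\<^esub> \<beta> y) = counit H h \<odot>\<^bsub>H\<^esub> \<one>\<^bsub>H\<^esub>"
    and F: "lin_map K H V F" and h: "h \<in> carrier H"
  shows "tensor_lift V (comult H h) (\<lambda>x y. act (\<alpha> x)
    (tensor_lift V (comult H y) (\<lambda>u v. act (\<beta> u) (F v)))) = F h"
proof -
  note Ac = lin_map_closed[OF \<alpha>] and Bc = lin_map_closed[OF \<beta>] and Fc = lin_map_closed[OF F]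
  let ?G = "\<lambda>u v y. act (\<alpha> u) (act (\<beta> v) (F y))"
  note bF = bilin_comp[OF act \<beta> F]
  have G1: "bilin K H H V (\<lambda>u v. ?G u v y)" if "y \<in> carrier H" for y
    by (rule bilin_comp[OF act \<alpha> bilin_left[OF bF that]])
  have G2: "bilin K H H V (?G u)" if "u \<in> carrier H" for u
    by (rule bilin_lin_comp[OF bilin_right[OF act Ac[OF that]] bF])
  have "tensor_lift V (comult H h) (\<lambda>x y. act (\<alpha> x) (tensor_lift V (comult H y) (\<lambda>u v. act (\<beta> u) (F v)))) =
      tensor_lift V (comult H h) (\<lambda>x y. tensor_lift V (comult H y) (?G x))"
    by (rule lift_cong[OF mod_H mod_H V self.bilin_coact_right[OF V G1 G2 lin_comult] comult_closed[OF h]])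
      (auto intro: lin_map_lift_commute[OF mod_H mod_H V V bilin_right[OF act Ac] bF comult_closed])
  \<comment> \<open>Regrouping by coassociativity puts \<open>\<alpha>\<close> and
    \<open>\<beta>\<close> on the two legs of one coproduct, where \<open>inv\<close> turns them
    into a counit.\<close>
  also have "\<dots> = tensor_lift V (comult H h) (\<lambda>x y. tensor_lift V (comult H x) (\<lambda>u v. ?G u v y))"
    by (rule self.coassoc_lift[OF lin_comult V G1 G2 h, symmetric])
  also have "\<dots> = tensor_lift V (comult H h) (\<lambda>x y. counit H x \<odot>\<^bsub>V\<^esub> F y)"
  proof (rule lift_cong[OF mod_H mod_H V bilin_flip[OF bilin_counit[OF V F]] comult_closed[OF h]])
    fix x y assume x: "x \<in> carrier H" and y: "y \<in> carrier H"
    have "tensor_lift V (comult H x) (\<lambda>u v. ?G u v y) =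
        tensor_lift V (comult H x) (\<lambda>u v. act (\<alpha> u \<otimes>\<^bsub>H\<^esub> \<beta> v) (F y))"
      by (rule lift_cong[OF mod_H mod_H V
          bilin_lin_comp[OF bilin_left[OF act Fc[OF y]] bilin_comp[OF bilin_H \<alpha> \<beta>]] comult_closed[OF x]])
        (simp add: act_mult Ac Bc Fc y)
    also have "\<dots> = act (tensor_lift H (comult H x) (\<lambda>u v. \<alpha> u \<otimes>\<^bsub>H\<^esub> \<beta> v)) (F y)"
      by (rule lin_map_lift_commute[OF mod_H mod_H mod_H V bilin_left[OF act Fc[OF y]]
          bilin_comp[OF bilin_H \<alpha> \<beta>] comult_closed[OF x], symmetric])
    also have "\<dots> = counit H x \<odot>\<^bsub>V\<^esub> F y"
      using lin_map_smult[OF bilin_left[OF act Fc[OF y]] counit_closed[OF x] H.one_closed]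
      by (simp add: inv[OF x] act_one Fc y)
    finally show "tensor_lift V (comult H x) (\<lambda>u v. ?G u v y) = counit H x \<odot>\<^bsub>V\<^esub> F y" .
  qed
  also have "\<dots> = F h" by (rule counit_lift_left[OF V F h])
  finally show ?thesis .
qed

end

section \<open>Left coinvariant forms\<close>

locale bicovariant_fodc = hopf_alg K H
  for K :: "('k, 'x) ring_scheme" and H :: "('k, 'h) hopf" +
  fixes \<Gamma> :: "('k, 'h, 'g) fodc"
  assumes fodc: "is_fodc K H \<Gamma>" and bicov: "bicovariant K H \<Gamma>"
begin

abbreviation "lam \<equiv> left_coaction K H \<Gamma>"
abbreviation "\<Lambda> \<equiv> coinv_forms K H \<Gamma>"
abbreviation "HG \<equiv> tensor K H \<Gamma>"

text \<open>The Maurer-Cartan form of the calculus.\<close>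

definition varpi :: "'h \<Rightarrow> 'g"
  where "varpi h = tensor_lift \<Gamma> (comult H h) (\<lambda>h\<^sub>1 h\<^sub>2. lact \<Gamma> (antipode H h\<^sub>1) (dif \<Gamma> h\<^sub>2))"

definition coinv_proj :: "'g \<Rightarrow> 'g"
  where "coinv_proj \<omega> = tensor_lift \<Gamma> (lam \<omega>) (\<lambda>h x. lact \<Gamma> (antipode H h) x)"

text \<open>The left \<open>H\<close>-action on \<open>H \<otimes> \<Gamma>\<close> through the
  coproduct, for which \<open>lam\<close> is left linear.\<close>

definition diag_act :: "'h \<Rightarrow> ('h \<times> 'g \<Rightarrow>\<^sub>0 int) set \<Rightarrow> ('h \<times> 'g \<Rightarrow>\<^sub>0 int) set"
  where "diag_act h = tensor_bimap HG (monoid.mult H) (lact \<Gamma>) (comult H h)"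

lemmas mod_G = fodc_module[OF fodc]
lemmas lin_dif = fodc_lin_dif[OF fodc]
lemmas dif_closed = lin_map_closed[OF lin_dif]
lemmas bilin_lact = fodc_lact[OF fodc]
lemmas lact_closed = bilin_closed[OF bilin_lact]
lemmas antipode_closed = lin_map_closed[OF lin_antipode]

sublocale GM: module K \<Gamma> by (rule mod_G)

lemma lact_mult: "a \<in> carrier H \<Longrightarrow> b \<in> carrier H \<Longrightarrow> x \<in> carrier \<Gamma> \<Longrightarrow>
    lact \<Gamma> (a \<otimes>\<^bsub>H\<^esub> b) x = lact \<Gamma> a (lact \<Gamma> b x)"
  and lact_one: "x \<in> carrier \<Gamma> \<Longrightarrow> lact \<Gamma> \<one>\<^bsub>H\<^esub> x = x"
  using fodc_bimodule[OF fodc] unfolding bimodule_def by blast+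

lemma is_left_coaction_lam: "is_left_coaction K H \<Gamma> lam"
proof -
  have "\<exists>\<rho>. is_left_coaction K H \<Gamma> \<rho>" using bicov by (simp add: bicovariant_def)
  then show ?thesis unfolding left_coaction_def by (rule someI_ex)
qed

lemma lin_lam: "lin_map K \<Gamma> HG lam"
  using is_left_coaction_lam by (simp add: is_left_coaction_def Let_def)

lemmas mod_HG = module_tensor[OF mod_H mod_G]

text \<open>Separating the action of \<open>h\<close> from the value on \<open>d g\<close> gives the
  shape that \<open>fodc_map_left\<close> turns into left linearity of \<open>lam\<close>.\<close>

lemma lam_generator:
  assumes h: "h \<in> carrier H" and g: "g \<in> carrier H"
  shows "lam (lact \<Gamma> h (dif \<Gamma> g)) = diag_act h (tensor_map HG (\<lambda>x. x) (dif \<Gamma>) (comult H g))"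
proof -
  have "lam (lact \<Gamma> h (dif \<Gamma> g)) = tensor_bimap HG (\<lambda>a x. a \<otimes>\<^bsub>H\<^esub> x) (\<lambda>h y. lact \<Gamma> h (dif \<Gamma> y)) (comult H h) (comult H g)"
    using is_left_coaction_lam h g by (simp add: is_left_coaction_def Let_def tensor_bimap_def)
  then show ?thesis
    unfolding diag_act_def
    using bimap_tensor_map[OF mod_H mod_H mod_H mod_G mod_H mod_G mod_H mod_H bilin_H bilin_lact
      lin_map_ident lin_dif comult_closed[OF h] comult_closed[OF g]] by simp
qed

lemma bilin_diag_act: "bilin K H HG HG diag_act"
  using bilin_comp[OF bilin_bimap[OF mod_H mod_H mod_H mod_G mod_H mod_G bilin_H bilin_lact] lin_comult lin_map_ident]
  unfolding diag_act_def[abs_def] .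

lemma diag_act_mult:
  assumes "x \<in> carrier H" "y \<in> carrier H" "v \<in> carrier HG"
  shows "diag_act (x \<otimes>\<^bsub>H\<^esub> y) v = diag_act x (diag_act y v)"
  unfolding diag_act_def self.coact_mult[OF assms(1,2)]
  by (rule bimap_assoc[OF mod_H mod_H mod_H mod_G bilin_H bilin_H bilin_H bilin_lact _ _ comult_closed[OF assms(1)] comult_closed[OF assms(2)] assms(3)])
    (simp_all add: H.m_assoc lact_mult)

lemma diag_act_one: "v \<in> carrier HG \<Longrightarrow> diag_act \<one>\<^bsub>H\<^esub> v = v"
  unfolding diag_act_def self.coact_one
  by (rule bimap_unit[OF mod_H mod_H mod_H mod_G bilin_H bilin_lact]) (simp_all add: lact_one)

lemma lam_lact:
  assumes "h \<in> carrier H" "x \<in> carrier \<Gamma>"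
  shows "lam (lact \<Gamma> h x) = diag_act h (lam x)"
  by (rule fodc_map_left[OF alg_H fodc mod_HG lin_lam bilin_right[OF bilin_diag_act] diag_act_mult _ lam_generator assms])
    (auto intro!: lin_map_closed[OF lin_map_tensor_map[OF mod_H mod_H mod_H mod_G lin_map_ident lin_dif]] comult_closed)

lemma lam_dif:
  assumes h: "h \<in> carrier H"
  shows "lam (dif \<Gamma> h) = tensor_map HG (\<lambda>x. x) (dif \<Gamma>) (comult H h)"
  using lam_generator[OF H.one_closed h]
  by (simp add: lact_one dif_closed h diag_act_one comult_closed
      lin_map_closed[OF lin_map_tensor_map[OF mod_H mod_H mod_H mod_G lin_map_ident lin_dif]])

lemma bilin_antipode_dif: "bilin K H H \<Gamma> (\<lambda>x y. lact \<Gamma> (antipode H x) (dif \<Gamma> y))"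
  by (rule bilin_comp[OF bilin_lact lin_antipode lin_dif])

lemma lin_varpi: "lin_map K H \<Gamma> varpi"
  unfolding varpi_def[abs_def]
  by (rule lin_map_lift_comp[OF mod_H mod_H mod_G bilin_antipode_dif lin_comult])

lemmas varpi_closed = lin_map_closed[OF lin_varpi]

text \<open>Here the antipode is the inner factor of the convolution and the identity the outer one:
  \<open>h_1 S(h_2) d h_3\<close> collapses to \<open>d h\<close>.\<close>

lemma dif_eq_varpi:
  assumes "h \<in> carrier H"
  shows "tensor_lift \<Gamma> (comult H h) (\<lambda>x y. lact \<Gamma> x (varpi y)) = dif \<Gamma> h"
  unfolding varpi_def
  by (rule convolution_cancel[OF mod_G bilin_lact lact_mult lact_one lin_map_ident lin_antipode
        antipode_right lin_dif assms])

lemma lin_pure_one: "lin_map K \<Gamma> HG (pure_tensor HG \<one>\<^bsub>H\<^esub>)"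
  by (rule bilin_right[OF bilin_pure[OF mod_H mod_G] H.one_closed])

lemma diag_act_pure_one:
  assumes h: "h \<in> carrier H" and x: "x \<in> carrier \<Gamma>"
  shows "diag_act h (pure_tensor HG \<one>\<^bsub>H\<^esub> x) = tensor_map HG (\<lambda>u. u) (\<lambda>v. lact \<Gamma> v x) (comult H h)"
proof -
  have p: "pure_tensor HG \<one>\<^bsub>H\<^esub> x \<in> carrier HG"
    by (rule tensor_pure_closed[OF mod_H mod_G H.one_closed x])
  show ?thesis unfolding diag_act_def
    by (rule tensor_ext[OF mod_H mod_H
      bilin_left[OF bilin_bimap[OF mod_H mod_H mod_H mod_G mod_H mod_G bilin_H bilin_lact] p]
      lin_map_tensor_map[OF mod_H mod_H mod_H mod_G lin_map_ident bilin_left[OF bilin_lact x]] _ comult_closed[OF h]])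
     (simp add: bimap_pure[OF mod_H mod_H mod_H mod_G mod_H mod_G bilin_H bilin_lact] x
      tensor_map_pure[OF mod_H mod_H mod_H mod_G lin_map_ident bilin_left[OF bilin_lact x]])
qed

text \<open>\<open>h \<mapsto> lam (varpi h)\<close> and \<open>h \<mapsto> 1 \<otimes> varpi h\<close> have the same convolution product
  \<open>h\<^sub>1 \<otimes> d h\<^sub>2\<close> with the diagonal action, which is invertible.\<close>

lemma lam_varpi:
  assumes h: "h \<in> carrier H"
  shows "lam (varpi h) = pure_tensor HG \<one>\<^bsub>H\<^esub> (varpi h)"
proof -
  let ?F = "\<lambda>h. lam (varpi h)" and ?E = "\<lambda>h. pure_tensor HG \<one>\<^bsub>H\<^esub> (varpi h)"
  have F: "lin_map K H HG ?F" by (rule lin_map_comp[OF lin_lam lin_varpi])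
  have E: "lin_map K H HG ?E" by (rule lin_map_comp[OF lin_pure_one lin_varpi])
  have bw: "bilin K H H \<Gamma> (\<lambda>x y. lact \<Gamma> x (varpi y))"
    by (rule bilin_comp[OF bilin_lact lin_map_ident lin_varpi])
  have bp: "bilin K H H HG (\<lambda>x y. pure_tensor HG x (dif \<Gamma> y))"
    by (rule bilin_comp[OF bilin_pure[OF mod_H mod_G] lin_map_ident lin_dif])
  \<comment> \<open>By left linearity the action moves inside \<open>lam\<close>, where
    \<open>y_1 varpi(y_2)\<close> recombines to \<open>d y\<close>.\<close>
  have 1: "tensor_lift HG (comult H y) (\<lambda>u v. diag_act u (?F v)) = tensor_map HG (\<lambda>x. x) (dif \<Gamma>) (comult H y)"
    if y: "y \<in> carrier H" for y
  proof -
    have "tensor_lift HG (comult H y) (\<lambda>u v. diag_act u (?F v)) =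
        tensor_lift HG (comult H y) (\<lambda>u v. lam (lact \<Gamma> u (varpi v)))"
      by (rule lift_cong[OF mod_H mod_H mod_HG bilin_lin_comp[OF lin_lam bw] comult_closed[OF y]])
        (simp add: lam_lact varpi_closed)
    also have "\<dots> = lam (tensor_lift \<Gamma> (comult H y) (\<lambda>u v. lact \<Gamma> u (varpi v)))"
      by (rule lin_map_lift_commute[OF mod_H mod_H mod_G mod_HG lin_lam bw comult_closed[OF y], symmetric])
    finally show ?thesis by (simp add: dif_eq_varpi lam_dif y)
  qed
  let ?G = "\<lambda>u v y. pure_tensor HG u (lact \<Gamma> v (varpi y))"
  have G1: "bilin K H H HG (\<lambda>u v. ?G u v y)" if "y \<in> carrier H" for y
    by (rule bilin_comp[OF bilin_pure[OF mod_H mod_G] lin_map_ident bilin_left[OF bilin_lact varpi_closed[OF that]]])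
  have G2: "bilin K H H HG (?G u)" if "u \<in> carrier H" for u
    by (rule bilin_lin_comp[OF bilin_right[OF bilin_pure[OF mod_H mod_G] that] bw])
  \<comment> \<open>The coproduct of \<open>u\<close> takes \<open>1 \<otimes> varpi v\<close> to
    \<open>u_1 \<otimes> u_2 varpi v\<close>; regrouping the legs lets \<open>u_2 varpi v\<close>
    recombine to a differential in the second factor.\<close>
  have 2: "tensor_lift HG (comult H y) (\<lambda>u v. diag_act u (?E v)) = tensor_map HG (\<lambda>x. x) (dif \<Gamma>) (comult H y)"
    if y: "y \<in> carrier H" for y
  proof -
    have "tensor_lift HG (comult H y) (\<lambda>u v. diag_act u (?E v)) =
        tensor_lift HG (comult H y) (\<lambda>x z. tensor_lift HG (comult H x) (\<lambda>u v. ?G u v z))"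
      by (rule lift_cong[OF mod_H mod_H mod_HG self.bilin_coact_left[OF mod_HG G1 G2] comult_closed[OF y]])
        (simp_all add: diag_act_pure_one varpi_closed tensor_map_def)
    also have "\<dots> = tensor_lift HG (comult H y) (\<lambda>x z. tensor_lift HG (comult H z) (?G x))"
      by (rule self.coassoc_lift[OF lin_comult mod_HG G1 G2 y])
    also have "\<dots> = tensor_lift HG (comult H y) (\<lambda>x z. pure_tensor HG x (dif \<Gamma> z))"
    proof (rule lift_cong[OF mod_H mod_H mod_HG bp comult_closed[OF y]])
      fix x z assume x: "x \<in> carrier H" and z: "z \<in> carrier H"
      have "tensor_lift HG (comult H z) (?G x) = pure_tensor HG x (tensor_lift \<Gamma> (comult H z) (\<lambda>u v. lact \<Gamma> u (varpi v)))"
        by (rule lin_map_lift_commute[OF mod_H mod_H mod_G mod_HG bilin_right[OF bilin_pure[OF mod_H mod_G] x]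
          bw comult_closed[OF z], symmetric])
      then show "tensor_lift HG (comult H z) (?G x) = pure_tensor HG x (dif \<Gamma> z)"
        by (simp add: dif_eq_varpi z)
    qed
    finally show ?thesis by (simp add: tensor_map_def)
  qed
  have c: "tensor_lift HG (comult H h) (\<lambda>x y. diag_act (antipode H x) (tensor_lift HG (comult H y) (\<lambda>u v. diag_act u (F v)))) = F h"
    if "lin_map K H HG F" for F
    by (rule convolution_cancel[OF mod_HG bilin_diag_act diag_act_mult diag_act_one lin_antipode lin_map_ident
        antipode_left that h])
  have b: "bilin K H H HG (\<lambda>x y. diag_act (antipode H x) (tensor_map HG (\<lambda>x. x) (dif \<Gamma>) (comult H y)))"
    by (rule bilin_comp[OF bilin_diag_act lin_antipode
      lin_map_comp[OF lin_map_tensor_map[OF mod_H mod_H mod_H mod_G lin_map_ident lin_dif] lin_comult]])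
  have "?F h = tensor_lift HG (comult H h) (\<lambda>x y. diag_act (antipode H x) (tensor_lift HG (comult H y) (\<lambda>u v. diag_act u (?F v))))"
    by (rule c[OF F, symmetric])
  also have "\<dots> = tensor_lift HG (comult H h) (\<lambda>x y. diag_act (antipode H x) (tensor_map HG (\<lambda>x. x) (dif \<Gamma>) (comult H y)))"
    by (rule lift_cong[OF mod_H mod_H mod_HG b comult_closed[OF h]]) (simp add: 1)
  also have "\<dots> = tensor_lift HG (comult H h) (\<lambda>x y. diag_act (antipode H x) (tensor_lift HG (comult H y) (\<lambda>u v. diag_act u (?E v))))"
    by (rule lift_cong[OF mod_H mod_H mod_HG b comult_closed[OF h], symmetric]) (simp add: 2)
  also have "\<dots> = ?E h" by (rule c[OF E])
  finally show ?thesis .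
qed

lemma carrier_coinv: "carrier \<Lambda> = {x \<in> carrier \<Gamma>. lam x = pure_tensor HG \<one>\<^bsub>H\<^esub> x}"
  by (simp add: coinv_forms_def)

lemma varpi_coinv: "h \<in> carrier H \<Longrightarrow> varpi h \<in> carrier \<Lambda>"
  by (simp add: carrier_coinv varpi_closed lam_varpi)

lemma submodule_coinv: "submodule (carrier \<Lambda>) K \<Gamma>"
  unfolding carrier_coinv by (rule submodule_eq[OF mod_G mod_HG lin_lam lin_pure_one])

lemma mod_coinv: "module K \<Lambda>"
  using submodule.submodule_is_module[OF submodule_coinv mod_G] by (simp add: coinv_forms_def)

lemma ops_coinv: "add \<Lambda> = add \<Gamma>" "smult \<Lambda> = smult \<Gamma>" "\<zero>\<^bsub>\<Lambda>\<^esub> = \<zero>\<^bsub>\<Gamma>\<^esub>"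
  by (simp_all add: coinv_forms_def)

lemma lin_map_into_coinv:
  "lin_map K X \<Gamma> f \<Longrightarrow> (\<And>x. x \<in> carrier X \<Longrightarrow> f x \<in> carrier \<Lambda>) \<Longrightarrow> lin_map K X \<Lambda> f"
  unfolding lin_map_def by (auto simp: ops_coinv)

lemma lin_coinv_incl: "lin_map K \<Lambda> \<Gamma> (\<lambda>x. x)"
  unfolding lin_map_def by (auto simp: ops_coinv carrier_coinv)

lemma lin_varpi_coinv: "lin_map K H \<Lambda> varpi"
  by (rule lin_map_into_coinv[OF lin_varpi varpi_coinv])

lemma bilin_antipode_lact: "bilin K H \<Gamma> \<Gamma> (\<lambda>h x. lact \<Gamma> (antipode H h) x)"
  by (rule bilin_comp[OF bilin_lact lin_antipode lin_map_ident])

lemma lin_coinv_proj: "lin_map K \<Gamma> \<Gamma> coinv_proj"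
  unfolding coinv_proj_def[abs_def]
  by (rule lin_map_lift_comp[OF mod_H mod_G mod_G bilin_antipode_lact lin_lam])

text \<open>For coinvariant \<open>x\<close> the coaction of \<open>h x\<close> is
  \<open>h_1 \<otimes> h_2 x\<close>, so the projection forms \<open>S(h_1) h_2 x\<close>, which the
  antipode law collapses.\<close>

lemma coinv_proj_lact:
  assumes h: "h \<in> carrier H" and x: "x \<in> carrier \<Lambda>"
  shows "coinv_proj (lact \<Gamma> h x) = counit H h \<odot>\<^bsub>\<Gamma>\<^esub> x"
proof -
  have x': "x \<in> carrier \<Gamma>" "lam x = pure_tensor HG \<one>\<^bsub>H\<^esub> x" using x by (simp_all add: carrier_coinv)
  have "coinv_proj (lact \<Gamma> h x) = tensor_lift \<Gamma> (tensor_map HG (\<lambda>u. u) (\<lambda>v. lact \<Gamma> v x) (comult H h))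
      (\<lambda>h x. lact \<Gamma> (antipode H h) x)"
    using h x' by (simp add: coinv_proj_def lam_lact diag_act_pure_one)
  also have "\<dots> = tensor_lift \<Gamma> (comult H h) (\<lambda>u v. lact \<Gamma> (antipode H u) (lact \<Gamma> v x))"
    by (rule lift_tensor_map[OF mod_H mod_H mod_H mod_G lin_map_ident bilin_left[OF bilin_lact x'(1)] mod_G
      bilin_antipode_lact comult_closed[OF h]])
  also have "\<dots> = tensor_lift \<Gamma> (comult H h) (\<lambda>u v. lact \<Gamma> (antipode H u \<otimes>\<^bsub>H\<^esub> v) x)"
    by (rule lift_cong[OF mod_H mod_H mod_G
          bilin_lin_comp[OF bilin_left[OF bilin_lact x'(1)] bilin_comp[OF bilin_H lin_antipode lin_map_ident]]
          comult_closed[OF h]])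
      (simp add: lact_mult antipode_closed x')
  also have "\<dots> = lact \<Gamma> (tensor_lift H (comult H h) (\<lambda>u v. antipode H u \<otimes>\<^bsub>H\<^esub> v)) x"
    by (rule lin_map_lift_commute[OF mod_H mod_H mod_H mod_G bilin_left[OF bilin_lact x'(1)]
      bilin_comp[OF bilin_H lin_antipode lin_map_ident] comult_closed[OF h], symmetric])
  also have "\<dots> = counit H h \<odot>\<^bsub>\<Gamma>\<^esub> x"
    using lin_map_smult[OF bilin_left[OF bilin_lact x'(1)] counit_closed[OF h] H.one_closed]
    by (simp add: antipode_left h lact_one x')
  finally show ?thesis .
qed

lemma coinv_proj_coinv: "x \<in> carrier \<Lambda> \<Longrightarrow> coinv_proj x = x"
  using coinv_proj_lact[OF H.one_closed, of x] by (simp add: carrier_coinv lact_one counit_one)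

text \<open>Expanding \<open>d g\<close> as \<open>g_1 varpi(g_2)\<close> leaves
  \<open>counit(h g_1) varpi(g_2)\<close>; the counit is multiplicative, and its value on
  \<open>g_1\<close> cancels against the coproduct of \<open>g\<close>.\<close>

lemma coinv_proj_generator:
  assumes h: "h \<in> carrier H" and g: "g \<in> carrier H"
  shows "coinv_proj (lact \<Gamma> h (dif \<Gamma> g)) = counit H h \<odot>\<^bsub>\<Gamma>\<^esub> varpi g"
proof -
  have bw: "bilin K H H \<Gamma> (\<lambda>x y. lact \<Gamma> x (varpi y))"
    by (rule bilin_comp[OF bilin_lact lin_map_ident lin_varpi])
  have l: "lin_map K \<Gamma> \<Gamma> (\<lambda>x. coinv_proj (lact \<Gamma> h x))"
    by (rule lin_map_comp[OF lin_coinv_proj bilin_right[OF bilin_lact h]])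
  have lc: "lin_map K H \<Gamma> (\<lambda>y. counit H h \<odot>\<^bsub>\<Gamma>\<^esub> varpi y)"
    by (rule lin_map_comp[OF module_carrier_lin_smult[OF mod_G counit_closed[OF h]] lin_varpi])
  have "coinv_proj (lact \<Gamma> h (dif \<Gamma> g)) =
      coinv_proj (lact \<Gamma> h (tensor_lift \<Gamma> (comult H g) (\<lambda>x y. lact \<Gamma> x (varpi y))))"
    by (simp add: dif_eq_varpi g)
  also have "\<dots> = tensor_lift \<Gamma> (comult H g) (\<lambda>x y. coinv_proj (lact \<Gamma> h (lact \<Gamma> x (varpi y))))"
    by (rule lin_map_lift_commute[OF mod_H mod_H mod_G mod_G l bw comult_closed[OF g]])
  also have "\<dots> = tensor_lift \<Gamma> (comult H g) (\<lambda>x y. counit H x \<odot>\<^bsub>\<Gamma>\<^esub> (counit H h \<odot>\<^bsub>\<Gamma>\<^esub> varpi y))"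
  proof (rule lift_cong[OF mod_H mod_H mod_G bilin_flip[OF bilin_counit[OF mod_G lc]] comult_closed[OF g]])
    fix x y assume x: "x \<in> carrier H" and y: "y \<in> carrier H"
    have "lact \<Gamma> h (lact \<Gamma> x (varpi y)) = lact \<Gamma> (h \<otimes>\<^bsub>H\<^esub> x) (varpi y)"
      using h x y by (simp add: lact_mult varpi_closed)
    then have "coinv_proj (lact \<Gamma> h (lact \<Gamma> x (varpi y))) = counit H (h \<otimes>\<^bsub>H\<^esub> x) \<odot>\<^bsub>\<Gamma>\<^esub> varpi y"
      using h x y by (simp add: coinv_proj_lact varpi_coinv)
    also have "\<dots> = counit H x \<odot>\<^bsub>\<Gamma>\<^esub> (counit H h \<odot>\<^bsub>\<Gamma>\<^esub> varpi y)"
      using h x y by (simp add: counit_mult counit_closed varpi_closed GM.smult_assoc1[symmetric] HM.R.m_comm)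
    finally show "coinv_proj (lact \<Gamma> h (lact \<Gamma> x (varpi y))) = counit H x \<odot>\<^bsub>\<Gamma>\<^esub> (counit H h \<odot>\<^bsub>\<Gamma>\<^esub> varpi y)" .
  qed
  also have "\<dots> = counit H h \<odot>\<^bsub>\<Gamma>\<^esub> varpi g"
    by (rule counit_lift_left[OF mod_G lc g])
  finally show ?thesis .
qed

text \<open>Generators project to \<open>counit(a) varpi(b) = varpi(counit(a) b)\<close>, and the
  range of a linear map is a submodule.\<close>

lemma coinv_proj_range:
  assumes "x \<in> carrier \<Gamma>"
  shows "coinv_proj x \<in> varpi ` carrier H"
proof -
  have "x \<in> {x \<in> carrier \<Gamma>. coinv_proj x \<in> varpi ` carrier H}"
  proof (rule fodc_span[OF fodc submodule_vimage[OF mod_G mod_G lin_coinv_proj submodule_range[OF mod_H mod_G lin_varpi]] _ assms])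
    fix a b assume a: "a \<in> carrier H" and b: "b \<in> carrier H"
    have "coinv_proj (lact \<Gamma> a (dif \<Gamma> b)) = varpi (counit H a \<odot>\<^bsub>H\<^esub> b)"
      using a b by (simp add: coinv_proj_generator lin_map_smult[OF lin_varpi] counit_closed)
    then show "lact \<Gamma> a (dif \<Gamma> b) \<in> {x \<in> carrier \<Gamma>. coinv_proj x \<in> varpi ` carrier H}"
      using a b by (simp add: lact_closed dif_closed counit_closed)
  qed
  then show ?thesis by simp
qed

text \<open>A coinvariant form is its own projection, and projections lie in the range of
  \<open>varpi\<close>.\<close>

lemma coinv_eq_varpi: "carrier \<Lambda> = varpi ` carrier H"
proof
  show "carrier \<Lambda> \<subseteq> varpi ` carrier H"
    using coinv_proj_range coinv_proj_coinv by (force simp: carrier_coinv)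
qed (use varpi_coinv in auto)

lemma lin_coinv_proj_coinv: "lin_map K \<Gamma> \<Lambda> coinv_proj"
  by (rule lin_map_into_coinv[OF lin_coinv_proj]) (use coinv_proj_range in \<open>auto simp: coinv_eq_varpi\<close>)

end

section \<open>Vertical maps and vertical coactions\<close>

locale comodule_fodc = comodule_alg K H A \<delta> + bicovariant_fodc K H \<Gamma>
  for K :: "('k, 'x) ring_scheme" and H :: "('k, 'h) hopf"
    and A :: "('k, 'a, 'y) module_scheme" and \<delta> :: "'a \<Rightarrow> ('a \<times> 'h \<Rightarrow>\<^sub>0 int) set"
    and \<Gamma> :: "('k, 'h, 'g) fodc" +
  fixes \<Gamma>A :: "('k, 'a, 'w) fodc"
  assumes fodcA: "is_fodc K A \<Gamma>A"
begin

abbreviation "AH \<equiv> tensor K A H"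
abbreviation "AG \<equiv> tensor K A \<Gamma>"
abbreviation "AL \<equiv> tensor K A \<Lambda>"

lemmas mod_AH = module_tensor[OF mod_A mod_H]
lemmas mod_AG = module_tensor[OF mod_A mod_G]
lemmas mod_AL = module_tensor[OF mod_A mod_coinv]
lemmas mod_GA = fodc_module[OF fodcA]

text \<open>Only the values on the forms \<open>a d b\<close> are prescribed; compatibility with
  both actions and with the differential is derived in \<open>coactions_fodc_map\<close>.\<close>

definition is_vertical_coaction :: "('w \<Rightarrow> ('a \<times> 'g \<Rightarrow>\<^sub>0 int) set) \<Rightarrow> bool"
  where "is_vertical_coaction \<Psi> \<longleftrightarrow> lin_map K \<Gamma>A AG \<Psi> \<and>
    (\<forall>a\<in>carrier A. \<forall>b\<in>carrier A. \<Psi> (lact \<Gamma>A a (dif \<Gamma>A b)) =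
      tensor_bimap AG (monoid.mult A) (lact \<Gamma>) (\<delta> a) (tensor_map AG (\<lambda>x. x) (dif \<Gamma>) (\<delta> b)))"

definition to_ver :: "('a \<times> 'g \<Rightarrow>\<^sub>0 int) set \<Rightarrow> ('a \<times> 'g \<Rightarrow>\<^sub>0 int) set"
  where "to_ver = tensor_map AL (\<lambda>x. x) coinv_proj"

definition from_ver :: "('a \<times> 'g \<Rightarrow>\<^sub>0 int) set \<Rightarrow> ('a \<times> 'g \<Rightarrow>\<^sub>0 int) set"
  where "from_ver t = tensor_lift AG t (\<lambda>a x. tensor_map AG (\<lambda>b. b) (\<lambda>h. lact \<Gamma> h x) (\<delta> a))"

lemma is_ver_iff: "is_ver K H A \<delta> \<Gamma> \<Gamma>A v \<longleftrightarrow> lin_map K \<Gamma>A AL v \<and>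
    (\<forall>a\<in>carrier A. \<forall>b\<in>carrier A. v (lact \<Gamma>A a (dif \<Gamma>A b)) =
      tensor_map AL (\<lambda>x. a \<otimes>\<^bsub>A\<^esub> x) varpi (\<delta> b))"
  by (simp add: is_ver_def Let_def tensor_map_def varpi_def)

lemma lin_to_ver: "lin_map K AG AL to_ver"
  unfolding to_ver_def by (rule lin_map_tensor_map[OF mod_A mod_G mod_A mod_coinv lin_map_ident lin_coinv_proj_coinv])

lemma bilin_from_ver: "bilin K A \<Lambda> AG (\<lambda>a x. tensor_map AG (\<lambda>b. b) (\<lambda>h. lact \<Gamma> h x) (\<delta> a))"
proof (rule bilinI)
  fix x assume "x \<in> carrier \<Lambda>"
  then have x: "x \<in> carrier \<Gamma>" by (simp add: carrier_coinv)
  show "lin_map K A AG (\<lambda>a. tensor_map AG (\<lambda>b. b) (\<lambda>h. lact \<Gamma> h x) (\<delta> a))"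
    by (rule lin_map_comp[OF lin_map_tensor_map[OF mod_A mod_H mod_A mod_G lin_map_ident bilin_left[OF bilin_lact x]] lin_coact])
next
  fix a assume a: "a \<in> carrier A"
  have b: "bilin K A H AG (\<lambda>m n. pure_tensor AG m (lact \<Gamma> n x))" if "x \<in> carrier \<Gamma>" for x
    by (rule bilin_comp[OF bilin_pure[OF mod_A mod_G] lin_map_ident bilin_left[OF bilin_lact that]])
  have l: "lin_map K \<Gamma> AG (\<lambda>x. pure_tensor AG m (lact \<Gamma> n x))" if "m \<in> carrier A" "n \<in> carrier H" for m n
    by (rule lin_map_comp[OF bilin_right[OF bilin_pure[OF mod_A mod_G] that(1)] bilin_right[OF bilin_lact that(2)]])
  have "lin_map K \<Gamma> AG (\<lambda>x. tensor_map AG (\<lambda>b. b) (\<lambda>h. lact \<Gamma> h x) (\<delta> a))"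
    unfolding tensor_map_def
    by (rule lin_map_lift_param[OF mod_A mod_H mod_AG mod_G coact_closed[OF a] b l])
  then show "lin_map K \<Lambda> AG (\<lambda>x. tensor_map AG (\<lambda>b. b) (\<lambda>h. lact \<Gamma> h x) (\<delta> a))"
    by (rule lin_map_comp[OF _ lin_coinv_incl])
qed

lemma lin_from_ver: "lin_map K AL AG from_ver"
  unfolding from_ver_def[abs_def]
  by (rule lin_map_lift[OF mod_A mod_coinv mod_AG bilin_from_ver])

text \<open>\<open>coinv_proj\<close> reduces the \<open>H\<close>-leg of \<open>a\<close> to its
  counit, which is absorbed into \<open>a\<close>, while the leg of \<open>b\<close> becomes
  \<open>varpi\<close>.\<close>

lemma vertical_coaction_to_ver:
  assumes "is_vertical_coaction \<Psi>"
  shows "is_ver K H A \<delta> \<Gamma> \<Gamma>A (\<lambda>w. to_ver (\<Psi> w))"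
  unfolding is_ver_iff
proof (intro conjI ballI)
  have \<Psi>: "lin_map K \<Gamma>A AG \<Psi>" using assms by (simp add: is_vertical_coaction_def)
  show "lin_map K \<Gamma>A AL (\<lambda>w. to_ver (\<Psi> w))"
    by (rule lin_map_comp[OF lin_to_ver \<Psi>])
  fix a b assume a: "a \<in> carrier A" and b: "b \<in> carrier A"
  note dif' = bilin_comp[OF bilin_lact lin_map_ident lin_dif]
  have lm: "lin_map K A A (\<lambda>x. c \<otimes>\<^bsub>A\<^esub> x)" "lin_map K A A (\<lambda>x. x \<otimes>\<^bsub>A\<^esub> c)" if "c \<in> carrier A" for c
    using bilin_right[OF bilin_A that] bilin_left[OF bilin_A that] by simp_all
  \<comment> \<open>\<open>?F c\<close> is the vertical value prescribed for \<open>c d b\<close>.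
    Its linearity in \<open>c\<close> lets \<open>counit_lift\<close> collapse the sum over
    \<open>\<delta> a\<close> to \<open>?F a\<close>.\<close>
  let ?F = "\<lambda>c. tensor_map AL (\<lambda>x. c \<otimes>\<^bsub>A\<^esub> x) varpi (\<delta> b)"
  have bF: "bilin K A H AL (\<lambda>x y. pure_tensor AL (c \<otimes>\<^bsub>A\<^esub> x) (varpi y))" if "c \<in> carrier A" for c
    by (rule bilin_comp[OF bilin_pure[OF mod_A mod_coinv] lm(1)[OF that] lin_varpi_coinv])
  have F: "lin_map K A AL ?F"
    unfolding tensor_map_def
  proof (rule lin_map_lift_param[OF mod_A mod_H mod_AL mod_A coact_closed[OF b] bF])
    fix x y assume x: "x \<in> carrier A" and y: "y \<in> carrier H"
    show "lin_map K A AL (\<lambda>c. pure_tensor AL (c \<otimes>\<^bsub>A\<^esub> x) (varpi y))"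
      by (rule lin_map_comp[OF bilin_left[OF bilin_pure[OF mod_A mod_coinv] varpi_coinv[OF y]] lm(2)[OF x]])
  qed
  have "to_ver (\<Psi> (lact \<Gamma>A a (dif \<Gamma>A b))) =
      to_ver (tensor_bimap AG (\<lambda>a x. a \<otimes>\<^bsub>A\<^esub> x) (\<lambda>h y. lact \<Gamma> h (dif \<Gamma> y)) (\<delta> a) (\<delta> b))"
    using assms a b bimap_tensor_map[OF mod_A mod_H mod_A mod_G mod_A mod_G mod_A mod_H bilin_A bilin_lact
        lin_map_ident lin_dif coact_closed[OF a] coact_closed[OF b]]
    by (simp add: is_vertical_coaction_def)
  also have "\<dots> = tensor_bimap AL (\<lambda>a x. a \<otimes>\<^bsub>A\<^esub> x) (\<lambda>h y. coinv_proj (lact \<Gamma> h (dif \<Gamma> y))) (\<delta> a) (\<delta> b)"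
    unfolding to_ver_def
    by (rule tensor_map_bimap[OF mod_A mod_H mod_A mod_H mod_A mod_G mod_A mod_coinv bilin_A dif' lin_map_ident
      lin_coinv_proj_coinv coact_closed[OF a] coact_closed[OF b]])
  also have "\<dots> = tensor_lift AL (\<delta> a) (\<lambda>c h. counit H h \<odot>\<^bsub>AL\<^esub> ?F c)"
    unfolding tensor_bimap_def
  proof (rule lift_cong[OF mod_A mod_H mod_AL bilin_counit[OF mod_AL F] coact_closed[OF a]])
    fix c h assume c: "c \<in> carrier A" and h: "h \<in> carrier H"
    note lc = module_carrier_lin_smult[OF mod_AL counit_closed[OF h]]
    have "counit H h \<odot>\<^bsub>AL\<^esub> ?F c =
        tensor_lift AL (\<delta> b) (\<lambda>x y. counit H h \<odot>\<^bsub>AL\<^esub> pure_tensor AL (c \<otimes>\<^bsub>A\<^esub> x) (varpi y))"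
      unfolding tensor_map_def
      by (rule lin_map_lift_commute[OF mod_A mod_H mod_AL mod_AL lc bF[OF c] coact_closed[OF b]])
    also have "\<dots> = tensor_lift AL (\<delta> b) (\<lambda>x y. pure_tensor AL (c \<otimes>\<^bsub>A\<^esub> x) (coinv_proj (lact \<Gamma> h (dif \<Gamma> y))))"
    proof (rule lift_cong[OF mod_A mod_H mod_AL bilin_lin_comp[OF lc bF[OF c]] coact_closed[OF b], symmetric])
      fix x y assume x: "x \<in> carrier A" and y: "y \<in> carrier H"
      have "pure_tensor AL (c \<otimes>\<^bsub>A\<^esub> x) (coinv_proj (lact \<Gamma> h (dif \<Gamma> y))) =
          pure_tensor AL (c \<otimes>\<^bsub>A\<^esub> x) (counit H h \<odot>\<^bsub>\<Lambda>\<^esub> varpi y)"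
        using h y by (simp add: coinv_proj_generator ops_coinv)
      also have "\<dots> = counit H h \<odot>\<^bsub>AL\<^esub> pure_tensor AL (c \<otimes>\<^bsub>A\<^esub> x) (varpi y)"
        by (rule lin_map_smult[OF bilin_right[OF bilin_pure[OF mod_A mod_coinv] A.m_closed[OF c x]]
          counit_closed[OF h] varpi_coinv[OF y]])
      finally show "pure_tensor AL (c \<otimes>\<^bsub>A\<^esub> x) (coinv_proj (lact \<Gamma> h (dif \<Gamma> y))) =
          counit H h \<odot>\<^bsub>AL\<^esub> pure_tensor AL (c \<otimes>\<^bsub>A\<^esub> x) (varpi y)" .
    qed
    finally show "tensor_lift AL (\<delta> b) (\<lambda>x y. pure_tensor AL (c \<otimes>\<^bsub>A\<^esub> x) (coinv_proj (lact \<Gamma> h (dif \<Gamma> y)))) =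
        counit H h \<odot>\<^bsub>AL\<^esub> ?F c" by simp
  qed
  also have "\<dots> = ?F a" by (rule counit_lift[OF mod_AL F a])
  finally show "to_ver (\<Psi> (lact \<Gamma>A a (dif \<Gamma>A b))) = ?F a" .
qed

text \<open>\<open>from_ver\<close> applies the coaction to \<open>a b_0\<close>; it is
  multiplicative, so the factor \<open>\<delta> a\<close> comes out. What remains is
  \<open>b_0 \<otimes> b_1 varpi(b_2)\<close> after coassociativity, that is
  \<open>b_0 \<otimes> d b_1\<close>.\<close>

lemma ver_to_vertical_coaction:
  assumes "is_ver K H A \<delta> \<Gamma> \<Gamma>A v"
  shows "is_vertical_coaction (\<lambda>w. from_ver (v w))"
  unfolding is_vertical_coaction_def
proof (intro conjI ballI)
  have v: "lin_map K \<Gamma>A AL v" using assms by (simp add: is_ver_iff)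
  show "lin_map K \<Gamma>A AG (\<lambda>w. from_ver (v w))"
    by (rule lin_map_comp[OF lin_from_ver v])
  fix a b assume a: "a \<in> carrier A" and b: "b \<in> carrier A"
  let ?L = "\<lambda>s t. tensor_bimap AG (monoid.mult A) (lact \<Gamma>) s t"
  \<comment> \<open>\<open>?E z t\<close> is the product of \<open>t\<close> with
    \<open>1 \<otimes> z\<close>; \<open>E_mult\<close> below is the associativity of this
    product.\<close>
  let ?E = "\<lambda>z. tensor_map AG (\<lambda>b. b) (\<lambda>h. lact \<Gamma> h z)"
  note bL = bilin_bimap[OF mod_A mod_H mod_A mod_G mod_A mod_G bilin_A bilin_lact]
  note lE = lin_map_tensor_map[OF mod_A mod_H mod_A mod_G lin_map_ident bilin_left[OF bilin_lact]]
  note bm = bilin_bimap[OF mod_A mod_H mod_A mod_H mod_A mod_H bilin_A bilin_H]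
  have lm: "lin_map K A A (\<lambda>x. a \<otimes>\<^bsub>A\<^esub> x)"
    using bilin_right[OF bilin_A a] by simp
  have E_mult: "?E z (tensor_bimap AH (monoid.mult A) (monoid.mult H) s t) = ?L s (?E z t)"
    if z: "z \<in> carrier \<Gamma>" and s: "s \<in> carrier AH" and t: "t \<in> carrier AH" for z s t
  proof (rule tensor_ext2[OF mod_A mod_H mod_A mod_H _ _ _ s t])
    show "bilin K AH AH AG (\<lambda>s t. ?E z (tensor_bimap AH (monoid.mult A) (monoid.mult H) s t))"
      by (rule bilin_lin_comp[OF lE[OF z] bm])
    show "bilin K AH AH AG (\<lambda>s t. ?L s (?E z t))"
      by (rule bilin_comp[OF bL lin_map_ident lE[OF z]])
    fix x h y g assume "x \<in> carrier A" "h \<in> carrier H" "y \<in> carrier A" "g \<in> carrier H"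
    then show "?E z (tensor_bimap AH (monoid.mult A) (monoid.mult H) (pure_tensor AH x h) (pure_tensor AH y g)) =
        ?L (pure_tensor AH x h) (?E z (pure_tensor AH y g))"
      using z by (simp add: bimap_pure[OF mod_A mod_H mod_A mod_H mod_A mod_H bilin_A bilin_H]
          bimap_pure[OF mod_A mod_H mod_A mod_G mod_A mod_G bilin_A bilin_lact]
          tensor_map_pure[OF mod_A mod_H mod_A mod_G lin_map_ident bilin_left[OF bilin_lact z]]
          lact_mult lact_closed)
  qed
  let ?G = "\<lambda>y g h. pure_tensor AG y (lact \<Gamma> g (varpi h))"
  have bw: "bilin K H H \<Gamma> (\<lambda>x y. lact \<Gamma> x (varpi y))"
    by (rule bilin_comp[OF bilin_lact lin_map_ident lin_varpi])
  have G1: "bilin K A H AG (\<lambda>y g. ?G y g h)" if "h \<in> carrier H" for h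
    by (rule bilin_comp[OF bilin_pure[OF mod_A mod_G] lin_map_ident bilin_left[OF bilin_lact varpi_closed[OF that]]])
  have G2: "bilin K H H AG (?G y)" if "y \<in> carrier A" for y
    by (rule bilin_lin_comp[OF bilin_right[OF bilin_pure[OF mod_A mod_G] that] bw])
  have bd: "bilin K A H AG (\<lambda>x h. pure_tensor AG x (dif \<Gamma> h))"
    by (rule bilin_comp[OF bilin_pure[OF mod_A mod_G] lin_map_ident lin_dif])
  have bE: "bilin K A H AG (\<lambda>x h. ?E (varpi h) (\<delta> x))"
    using bilin_comp[OF bilin_from_ver lin_map_ident lin_varpi_coinv] by simp
  have "from_ver (v (lact \<Gamma>A a (dif \<Gamma>A b))) =
      from_ver (tensor_map AL (\<lambda>x. a \<otimes>\<^bsub>A\<^esub> x) varpi (\<delta> b))"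
    using assms a b by (simp add: is_ver_iff)
  also have "\<dots> = tensor_lift AG (\<delta> b) (\<lambda>x h. ?E (varpi h) (\<delta> (a \<otimes>\<^bsub>A\<^esub> x)))"
    unfolding from_ver_def
    by (rule lift_tensor_map[OF mod_A mod_H mod_A mod_coinv lm lin_varpi_coinv mod_AG bilin_from_ver coact_closed[OF b]])
  also have "\<dots> = tensor_lift AG (\<delta> b) (\<lambda>x h. ?L (\<delta> a) (?E (varpi h) (\<delta> x)))"
    by (rule lift_cong[OF mod_A mod_H mod_AG bilin_lin_comp[OF bilin_right[OF bL coact_closed[OF a]] bE] coact_closed[OF b]])
      (simp add: coact_mult E_mult a coact_closed varpi_closed)
  also have "\<dots> = ?L (\<delta> a) (tensor_lift AG (\<delta> b) (\<lambda>x h. ?E (varpi h) (\<delta> x)))"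
    by (rule lin_map_lift_commute[OF mod_A mod_H mod_AG mod_AG bilin_right[OF bL coact_closed[OF a]] bE coact_closed[OF b], symmetric])
  also have "tensor_lift AG (\<delta> b) (\<lambda>x h. ?E (varpi h) (\<delta> x)) =
      tensor_lift AG (\<delta> b) (\<lambda>x h. tensor_lift AG (comult H h) (?G x))"
    unfolding tensor_map_def by (rule coassoc_lift[OF lin_comult mod_AG G1 G2 b])
  also have "\<dots> = tensor_map AG (\<lambda>x. x) (dif \<Gamma>) (\<delta> b)"
    unfolding tensor_map_def
  proof (rule lift_cong[OF mod_A mod_H mod_AG bd coact_closed[OF b]])
    fix x h assume x: "x \<in> carrier A" and h: "h \<in> carrier H"
    have "tensor_lift AG (comult H h) (?G x) = pure_tensor AG x (tensor_lift \<Gamma> (comult H h) (\<lambda>u v. lact \<Gamma> u (varpi v)))"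
      by (rule lin_map_lift_commute[OF mod_H mod_H mod_G mod_AG bilin_right[OF bilin_pure[OF mod_A mod_G] x]
        bw comult_closed[OF h], symmetric])
    then show "tensor_lift AG (comult H h) (?G x) = pure_tensor AG x (dif \<Gamma> h)"
      by (simp add: dif_eq_varpi h)
  qed
  finally show "from_ver (v (lact \<Gamma>A a (dif \<Gamma>A b))) =
      ?L (\<delta> a) (tensor_map AG (\<lambda>x. x) (dif \<Gamma>) (\<delta> b))" .
qed

lemma is_ver_unique:
  assumes "is_ver K H A \<delta> \<Gamma> \<Gamma>A v" "is_ver K H A \<delta> \<Gamma> \<Gamma>A v'" "w \<in> carrier \<Gamma>A"
  shows "v w = v' w"
  by (rule fodc_ext[OF fodcA mod_AL _ _ _ assms(3)]) (use assms in \<open>auto simp: is_ver_iff\<close>)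

lemma vertical_coaction_unique:
  assumes "is_vertical_coaction \<Psi>" "is_vertical_coaction \<Psi>'" "w \<in> carrier \<Gamma>A"
  shows "\<Psi> w = \<Psi>' w"
  by (rule fodc_ext[OF fodcA mod_AG _ _ _ assms(3)]) (use assms in \<open>auto simp: is_vertical_coaction_def\<close>)

text \<open>Uniqueness on generators identifies \<open>v\<close> with \<open>to_ver\<close> after
  \<open>\<Psi>\<close> and \<open>\<Psi>\<close> with \<open>from_ver\<close> after
  \<open>v\<close>, and linear maps send zero to zero.\<close>

lemma ver_kernel:
  assumes \<Psi>: "is_vertical_coaction \<Psi>" and v: "is_ver K H A \<delta> \<Gamma> \<Gamma>A v" and w: "w \<in> carrier \<Gamma>A"
  shows "v w = \<zero>\<^bsub>AL\<^esub> \<longleftrightarrow> \<Psi> w = \<zero>\<^bsub>AG\<^esub>"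
proof -
  have 1: "v w = to_ver (\<Psi> w)"
    by (rule is_ver_unique[OF v vertical_coaction_to_ver[OF \<Psi>] w])
  have 2: "\<Psi> w = from_ver (v w)"
    by (rule vertical_coaction_unique[OF \<Psi> ver_to_vertical_coaction[OF v] w])
  show ?thesis
    using 1 2 lin_map_zero[OF lin_to_ver module_abelian_group[OF mod_AG] module_abelian_group[OF mod_AL]]
      lin_map_zero[OF lin_from_ver module_abelian_group[OF mod_AL] module_abelian_group[OF mod_AG]] by metis
qed

lemma ver_surjective:
  assumes galois: "hopf_galois K H A \<delta>" and v: "is_ver K H A \<delta> \<Gamma> \<Gamma>A v"
  shows "v ` carrier \<Gamma>A = carrier AL"
proof -
  define B where "B = coinv K H A \<delta>"
  define ABA where "ABA = balanced_tensor B A (\<lambda>a b. a \<otimes>\<^bsub>A\<^esub> b) A (\<lambda>b a. b \<otimes>\<^bsub>A\<^esub> a)"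
  define can where "can a a' = tensor_map AH (\<lambda>x. a \<otimes>\<^bsub>A\<^esub> x) (\<lambda>h. h) (\<delta> a')" for a a'
  have lv: "lin_map K \<Gamma>A AL v" using v by (simp add: is_ver_iff)
  have lm: "lin_map K A A (\<lambda>x. c \<otimes>\<^bsub>A\<^esub> x)" "lin_map K A A (\<lambda>x. x \<otimes>\<^bsub>A\<^esub> c)" if "c \<in> carrier A" for c
    using bilin_right[OF bilin_A that] bilin_left[OF bilin_A that] by simp_all
  have lc: "lin_map K A AH (can a)" if "a \<in> carrier A" for a
    unfolding can_def[abs_def]
    by (rule lin_map_comp[OF lin_map_tensor_map[OF mod_A mod_H mod_A mod_H lm(1)[OF that] lin_map_ident] lin_coact])
  have lc': "lin_map K A AH (\<lambda>a. can a a')" if "a' \<in> carrier A" for a'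
    unfolding can_def tensor_map_def
  proof (rule lin_map_lift_param[OF mod_A mod_H mod_AH mod_A coact_closed[OF that]])
    show "bilin K A H AH (\<lambda>m n. pure_tensor AH (x \<otimes>\<^bsub>A\<^esub> m) n)" if "x \<in> carrier A" for x
      by (rule bilin_comp[OF bilin_pure[OF mod_A mod_H] lm(1)[OF that] lin_map_ident])
    show "lin_map K A AH (\<lambda>x. pure_tensor AH (x \<otimes>\<^bsub>A\<^esub> m) n)" if "m \<in> carrier A" "n \<in> carrier H" for m n
      by (rule lin_map_comp[OF bilin_left[OF bilin_pure[OF mod_A mod_H] that(2)] lm(2)[OF that(1)]])
  qed
  have B: "b \<in> carrier A" "\<delta> b = pure_tensor AH b \<one>\<^bsub>H\<^esub>" if "b \<in> B" for b
    using that by (simp_all add: B_def coinv_def)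
  interpret BT: balanced_data B A "\<lambda>a b. a \<otimes>\<^bsub>A\<^esub> b" A "\<lambda>b a. b \<otimes>\<^bsub>A\<^esub> a"
    by unfold_locales (auto dest: B)
  \<comment> \<open>A base element coacts as \<open>b \<otimes> 1\<close>, so its coaction
    multiplies the first leg only and \<open>b\<close> can change sides.\<close>
  have can_bal: "can (a \<otimes>\<^bsub>A\<^esub> b) a' = can a (b \<otimes>\<^bsub>A\<^esub> a')" if a: "a \<in> carrier A" and b: "b \<in> B" and a': "a' \<in> carrier A" for a b a'
  proof -
    note b' = B[OF b]
    have *: "tensor_bimap AH (monoid.mult A) (monoid.mult H) (pure_tensor AH b \<one>\<^bsub>H\<^esub>) t = tensor_map AH (\<lambda>x. b \<otimes>\<^bsub>A\<^esub> x) (\<lambda>h. h) t"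
      if t: "t \<in> carrier AH" for t
      by (rule tensor_ext[OF mod_A mod_H bilin_right[OF bilin_bimap[OF mod_A mod_H mod_A mod_H mod_A mod_H bilin_A bilin_H]
              tensor_pure_closed[OF mod_A mod_H b'(1) H.one_closed]]
            lin_map_tensor_map[OF mod_A mod_H mod_A mod_H lm(1)[OF b'(1)] lin_map_ident] _ t])
        (simp add: bimap_pure[OF mod_A mod_H mod_A mod_H mod_A mod_H bilin_A bilin_H] b'
          tensor_map_pure[OF mod_A mod_H mod_A mod_H lm(1)[OF b'(1)] lin_map_ident])
    have "can a (b \<otimes>\<^bsub>A\<^esub> a') = tensor_map AH (\<lambda>x. a \<otimes>\<^bsub>A\<^esub> x) (\<lambda>h. h) (tensor_map AH (\<lambda>x. b \<otimes>\<^bsub>A\<^esub> x) (\<lambda>h. h) (\<delta> a'))"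
      by (simp add: can_def coact_mult b' a' * coact_closed)
    also have "\<dots> = tensor_lift AH (\<delta> a') (\<lambda>x h. pure_tensor AH (a \<otimes>\<^bsub>A\<^esub> (b \<otimes>\<^bsub>A\<^esub> x)) h)"
      unfolding tensor_map_def[of AH "\<lambda>x. a \<otimes>\<^bsub>A\<^esub> x"]
      by (rule lift_tensor_map[OF mod_A mod_H mod_A mod_H lm(1)[OF b'(1)] lin_map_ident mod_AH
        bilin_comp[OF bilin_pure[OF mod_A mod_H] lm(1)[OF a] lin_map_ident] coact_closed[OF a']])
    also have "\<dots> = can (a \<otimes>\<^bsub>A\<^esub> b) a'"
      unfolding can_def tensor_map_def
      by (rule lift_cong[OF mod_A mod_H mod_AH bilin_comp[OF bilin_pure[OF mod_A mod_H] lm(1)[OF A.m_closed[OF a b'(1)]] lin_map_ident] coact_closed[OF a']])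
        (simp add: A.m_assoc a b')
    finally show ?thesis by simp
  qed
  have bal: "balanced_map B A (\<lambda>a b. a \<otimes>\<^bsub>A\<^esub> b) A (\<lambda>b a. b \<otimes>\<^bsub>A\<^esub> a) AH can"
    unfolding balanced_map_def
    using can_bal by (auto simp: lin_map_closed[OF lc] lin_map_add[OF lc] lin_map_add[OF lc'])
  note ab = module_abelian_group[OF mod_AH]
  interpret AL: module K AL by (rule mod_AL)
  have sub: "submodule (v ` carrier \<Gamma>A) K AL" by (rule submodule_range[OF mod_GA mod_AL lv])
  interpret V: submodule "v ` carrier \<Gamma>A" K AL by (rule sub)
  note lw = lin_map_tensor_map[OF mod_A mod_H mod_A mod_coinv lin_map_ident lin_varpi_coinv]
  \<comment> \<open>\<open>id \<otimes> varpi\<close> after the canonical map takes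
    \<open>a \<otimes> a'\<close> to the vertical value of \<open>a d a'\<close>.\<close>
  have gen: "tensor_map AL (\<lambda>x. x) varpi (can a a') \<in> v ` carrier \<Gamma>A" if a: "a \<in> carrier A" and a': "a' \<in> carrier A" for a a'
  proof -
    have "tensor_map AL (\<lambda>x. x) varpi (can a a') = tensor_map AL (\<lambda>x. a \<otimes>\<^bsub>A\<^esub> x) varpi (\<delta> a')"
      unfolding can_def tensor_map_def[of AL]
      by (rule lift_tensor_map[OF mod_A mod_H mod_A mod_H lm(1)[OF a] lin_map_ident mod_AL
        bilin_comp[OF bilin_pure[OF mod_A mod_coinv] lin_map_ident lin_varpi_coinv] coact_closed[OF a']])
    also have "\<dots> = v (lact \<Gamma>A a (dif \<Gamma>A a'))" using v a a' by (simp add: is_ver_iff)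
    finally show ?thesis
      using a a' bilin_closed[OF fodc_lact[OF fodcA]] lin_map_closed[OF fodc_lin_dif[OF fodcA]] by simp
  qed
  \<comment> \<open>The range of \<open>v\<close> is closed under addition, which extends
    \<open>gen\<close> from pure tensors to the whole domain of the canonical map.\<close>
  have lift_gen: "tensor_map AL (\<lambda>x. x) varpi (tensor_lift AH s can) \<in> v ` carrier \<Gamma>A" if "s \<in> carrier BT.T" for s
    using that
  proof (rule BT.tensor_induct)
    show "tensor_map AL (\<lambda>x. x) varpi (tensor_lift AH (pure_tensor BT.T m n) can) \<in> v ` carrier \<Gamma>A"
      if "m \<in> carrier A" "n \<in> carrier A" for m n
      using that by (simp add: BT.lift_pure[OF ab bal] gen)
    show "tensor_map AL (\<lambda>x. x) varpi (tensor_lift AH (s \<oplus>\<^bsub>BT.T\<^esub> t) can) \<in> v ` carrier \<Gamma>A"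
      if st: "s \<in> carrier BT.T" "t \<in> carrier BT.T"
        and i: "tensor_map AL (\<lambda>x. x) varpi (tensor_lift AH s can) \<in> v ` carrier \<Gamma>A"
          "tensor_map AL (\<lambda>x. x) varpi (tensor_lift AH t can) \<in> v ` carrier \<Gamma>A" for s t
      using AL.submoduleE(5)[OF sub i] st
      by (simp add: BT.lift_add[OF ab bal] lin_map_add[OF lw] BT.lift_closed[OF ab bal])
  qed
  have surj: "t \<in> (\<lambda>s. tensor_lift AH s can) ` carrier BT.T" if "t \<in> carrier AH" for t
  proof -
    have "can = (\<lambda>a a'. tensor_lift AH (\<delta> a') (\<lambda>x h. pure_tensor AH (a \<otimes>\<^bsub>A\<^esub> x) h))"
      by (simp add: can_def tensor_map_def fun_eq_iff)
    then show ?thesis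
      using galois that unfolding hopf_galois_def Let_def bij_betw_def B_def by simp
  qed
  have "t \<in> v ` carrier \<Gamma>A" if "t \<in> carrier AL" for t
    using mod_A mod_coinv that
  proof (rule tensor_induct)
    fix a x assume a: "a \<in> carrier A" and x: "x \<in> carrier \<Lambda>"
    obtain h where h: "h \<in> carrier H" "x = varpi h" using x by (auto simp: coinv_eq_varpi)
    obtain s where s: "s \<in> carrier BT.T" "pure_tensor AH a h = tensor_lift AH s can"
      using surj[OF tensor_pure_closed[OF mod_A mod_H a h(1)]] by auto
    have "pure_tensor AL a x = tensor_map AL (\<lambda>x. x) varpi (pure_tensor AH a h)"
      using a h by (simp add: tensor_map_pure[OF mod_A mod_H mod_A mod_coinv lin_map_ident lin_varpi_coinv])
    then show "pure_tensor AL a x \<in> v ` carrier \<Gamma>A" using lift_gen[OF s(1)] s(2) by simp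
  qed (use AL.submoduleE(5)[OF sub] in auto)
  then show ?thesis using lin_map_closed[OF lv] by auto
qed

end

context comodule_alg
begin

text \<open>Both summands of the calculus on \<open>A \<otimes> H\<close> have the shape \<open>M \<otimes> N\<close> for an \<open>A\<close>-bimodule \<open>M\<close> and
  an \<open>H\<close>-bimodule \<open>N\<close>, with differential \<open>\<phi> \<otimes> \<psi>\<close>.\<close>

lemma tensor_component_map:
  fixes \<Gamma>A :: "('k, 'a, 'w) fodc" and M :: "('k, 'm, 'u) module_scheme" and N :: "('k, 'n, 'v) module_scheme"
  assumes \<Gamma>: "is_fodc K A \<Gamma>A" and M: "module K M" and N: "module K N"
    and lM: "bilin K A M M lM" and rM: "bilin K A M M rM"
    and lN: "bilin K H N N lN" and rN: "bilin K H N N rN"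
    and lM_mult: "\<And>a b x. a \<in> carrier A \<Longrightarrow> b \<in> carrier A \<Longrightarrow> x \<in> carrier M \<Longrightarrow> lM (a \<otimes>\<^bsub>A\<^esub> b) x = lM a (lM b x)"
    and lN_mult: "\<And>a b x. a \<in> carrier H \<Longrightarrow> b \<in> carrier H \<Longrightarrow> x \<in> carrier N \<Longrightarrow> lN (a \<otimes>\<^bsub>H\<^esub> b) x = lN a (lN b x)"
    and lM_one: "\<And>x. x \<in> carrier M \<Longrightarrow> lM \<one>\<^bsub>A\<^esub> x = x"
    and lN_one: "\<And>x. x \<in> carrier N \<Longrightarrow> lN \<one>\<^bsub>H\<^esub> x = x"
    and rlM: "\<And>a b x. a \<in> carrier A \<Longrightarrow> b \<in> carrier A \<Longrightarrow> x \<in> carrier M \<Longrightarrow> rM a (lM b x) = lM b (rM a x)"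
    and rlN: "\<And>a b x. a \<in> carrier H \<Longrightarrow> b \<in> carrier H \<Longrightarrow> x \<in> carrier N \<Longrightarrow> rN a (lN b x) = lN b (rN a x)"
    and \<phi>: "lin_map K A M \<phi>" and \<psi>: "lin_map K H N \<psi>"
    and leibniz: "\<And>a h b g. a \<in> carrier A \<Longrightarrow> h \<in> carrier H \<Longrightarrow> b \<in> carrier A \<Longrightarrow> g \<in> carrier H \<Longrightarrow>
      pure_tensor (tensor K M N) (\<phi> (a \<otimes>\<^bsub>A\<^esub> b)) (\<psi> (h \<otimes>\<^bsub>H\<^esub> g)) =
      pure_tensor (tensor K M N) (rM b (\<phi> a)) (rN g (\<psi> h)) \<oplus>\<^bsub>tensor K M N\<^esub>
      pure_tensor (tensor K M N) (lM a (\<phi> b)) (lN h (\<psi> g))"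
    and \<Phi>: "lin_map K \<Gamma>A (tensor K M N) \<Phi>"
    and gen: "\<And>a b. a \<in> carrier A \<Longrightarrow> b \<in> carrier A \<Longrightarrow> \<Phi> (lact \<Gamma>A a (dif \<Gamma>A b)) =
      tensor_bimap (tensor K M N) lM lN (\<delta> a) (tensor_map (tensor K M N) \<phi> \<psi> (\<delta> b))"
    and a: "a \<in> carrier A"
  shows "x \<in> carrier \<Gamma>A \<Longrightarrow> \<Phi> (lact \<Gamma>A a x) = tensor_bimap (tensor K M N) lM lN (\<delta> a) (\<Phi> x)"
    and "x \<in> carrier \<Gamma>A \<Longrightarrow> \<Phi> (ract \<Gamma>A x a) = tensor_bimap (tensor K M N) rM rN (\<delta> a) (\<Phi> x)"
    and "\<Phi> (dif \<Gamma>A a) = tensor_map (tensor K M N) \<phi> \<psi> (\<delta> a)"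
proof -
  let ?AH = "tensor K A H" and ?P = "tensor K M N"
  note mP = module_tensor[OF M N]
  note bl = bilin_bimap[OF mod_A mod_H M N M N lM lN] and br = bilin_bimap[OF mod_A mod_H M N M N rM rN]
  note bm = bilin_bimap[OF mod_A mod_H mod_A mod_H mod_A mod_H bilin_A bilin_H]
  note D = lin_map_tensor_map[OF mod_A mod_H M N \<phi> \<psi>]
  have L: "lin_map K ?P ?P (tensor_bimap ?P lM lN (\<delta> a))" if "a \<in> carrier A" for a
    by (rule bilin_right[OF bl coact_closed[OF that]])
  have R: "lin_map K ?P ?P (\<lambda>x. tensor_bimap ?P rM rN (\<delta> a) x)" if "a \<in> carrier A" for a
    using bilin_right[OF br coact_closed[OF that]] by simp
  have LL: "tensor_bimap ?P lM lN (\<delta> (a \<otimes>\<^bsub>A\<^esub> b)) x = tensor_bimap ?P lM lN (\<delta> a) (tensor_bimap ?P lM lN (\<delta> b) x)"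
    if "a \<in> carrier A" "b \<in> carrier A" "x \<in> carrier ?P" for a b x
    unfolding coact_mult[OF that(1,2)]
    by (rule bimap_assoc[OF mod_A mod_H M N bilin_A bilin_H lM lN lM_mult lN_mult coact_closed[OF that(1)] coact_closed[OF that(2)] that(3)])
  have LR: "tensor_bimap ?P rM rN (\<delta> b) (tensor_bimap ?P lM lN (\<delta> a) x) =
      tensor_bimap ?P lM lN (\<delta> a) (tensor_bimap ?P rM rN (\<delta> b) x)"
    if "a \<in> carrier A" "b \<in> carrier A" "x \<in> carrier ?P" for a b x
    by (rule bimap_commute[where f = rM and g = rN and f' = lM and g' = lN, OF mod_A mod_H M N rM rN lM lN
      rlM rlN coact_closed[OF that(2)] coact_closed[OF that(1)] that(3)])
  have Dc: "tensor_map ?P \<phi> \<psi> (\<delta> a) \<in> carrier ?P" if "a \<in> carrier A" for a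
    by (rule lin_map_closed[OF D coact_closed[OF that]])
  \<comment> \<open>The Leibniz rule is assumed on pure tensors; bilinearity in \<open>s\<close> and
    \<open>t\<close> extends it to all tensors, in particular to the values of
    \<open>\<delta>\<close>.\<close>
  have leibniz': "tensor_map ?P \<phi> \<psi> (tensor_bimap ?AH (monoid.mult A) (monoid.mult H) s t) =
      tensor_bimap ?P rM rN t (tensor_map ?P \<phi> \<psi> s) \<oplus>\<^bsub>?P\<^esub> tensor_bimap ?P lM lN s (tensor_map ?P \<phi> \<psi> t)"
    if s: "s \<in> carrier ?AH" and t: "t \<in> carrier ?AH" for s t
  proof (rule tensor_ext2[OF mod_A mod_H mod_A mod_H _ _ _ s t])
    note mAH = module_tensor[OF mod_A mod_H]
    show "bilin K ?AH ?AH ?P (\<lambda>s t. tensor_map ?P \<phi> \<psi> (tensor_bimap ?AH (monoid.mult A) (monoid.mult H) s t))"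
      by (rule bilin_lin_comp[OF D bm])
    show "bilin K ?AH ?AH ?P (\<lambda>s t. tensor_bimap ?P rM rN t (tensor_map ?P \<phi> \<psi> s) \<oplus>\<^bsub>?P\<^esub>
        tensor_bimap ?P lM lN s (tensor_map ?P \<phi> \<psi> t))"
      by (rule bilin_add_maps[OF mAH mAH mP bilin_flip[OF bilin_comp[OF br lin_map_ident D]]
        bilin_comp[OF bl lin_map_ident D]])
    fix a h b g assume *: "a \<in> carrier A" "h \<in> carrier H" "b \<in> carrier A" "g \<in> carrier H"
    then show "tensor_map ?P \<phi> \<psi> (tensor_bimap ?AH (monoid.mult A) (monoid.mult H) (pure_tensor ?AH a h) (pure_tensor ?AH b g)) =
        tensor_bimap ?P rM rN (pure_tensor ?AH b g) (tensor_map ?P \<phi> \<psi> (pure_tensor ?AH a h)) \<oplus>\<^bsub>?P\<^esub>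
        tensor_bimap ?P lM lN (pure_tensor ?AH a h) (tensor_map ?P \<phi> \<psi> (pure_tensor ?AH b g))"
      by (simp add: bimap_pure[OF mod_A mod_H mod_A mod_H mod_A mod_H bilin_A bilin_H]
          bimap_pure[OF mod_A mod_H M N M N lM lN] bimap_pure[OF mod_A mod_H M N M N rM rN]
          tensor_map_pure[OF mod_A mod_H M N \<phi> \<psi>] lin_map_closed[OF \<phi>] lin_map_closed[OF \<psi>] leibniz)
  qed
  have leibniz'': "tensor_map ?P \<phi> \<psi> (\<delta> (a \<otimes>\<^bsub>A\<^esub> b)) =
      tensor_bimap ?P rM rN (\<delta> b) (tensor_map ?P \<phi> \<psi> (\<delta> a)) \<oplus>\<^bsub>?P\<^esub>
      tensor_bimap ?P lM lN (\<delta> a) (tensor_map ?P \<phi> \<psi> (\<delta> b))" if "a \<in> carrier A" "b \<in> carrier A" for a b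
    using that by (simp add: coact_mult leibniz' coact_closed)
  show "\<Phi> (lact \<Gamma>A a x) = tensor_bimap ?P lM lN (\<delta> a) (\<Phi> x)" if "x \<in> carrier \<Gamma>A"
    by (rule fodc_map_left[OF alg_A \<Gamma> mP \<Phi> L LL Dc gen a that])
  show "\<Phi> (ract \<Gamma>A x a) = tensor_bimap ?P rM rN (\<delta> a) (\<Phi> x)" if "x \<in> carrier \<Gamma>A"
    by (rule fodc_map_right[OF alg_A \<Gamma> mP \<Phi> L R LL LR Dc leibniz'' gen a that])
  \<comment> \<open>The formula on generators is used with 1 in front: \<open>\<delta>\<close> of
    the unit is a tensor of units and acts trivially.\<close>
  have "lact \<Gamma>A \<one>\<^bsub>A\<^esub> (dif \<Gamma>A a) = dif \<Gamma>A a"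
    using fodc_bimodule[OF \<Gamma>] lin_map_closed[OF fodc_lin_dif[OF \<Gamma>] a] unfolding bimodule_def by blast
  then show "\<Phi> (dif \<Gamma>A a) = tensor_map ?P \<phi> \<psi> (\<delta> a)"
    using gen[OF A.one_closed a] bimap_unit[OF mod_A mod_H M N lM lN A.one_closed H.one_closed lM_one lN_one Dc[OF a]]
    by (simp add: coact_one)
qed

end

section \<open>First order coactions as pairs of a right coaction and a vertical coaction, and the
  bundle condition\<close>

context comodule_fodc
begin

abbreviation "GH \<equiv> tensor K \<Gamma>A H"
abbreviation "\<Theta> \<equiv> tensor_fodc K A H \<Gamma>A \<Gamma>"

lemma lact_\<Theta>: "lact \<Theta> t pq = (tensor_bimap GH (lact \<Gamma>A) (monoid.mult H) t (fst pq),
    tensor_bimap AG (monoid.mult A) (lact \<Gamma>) t (snd pq))"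
  and ract_\<Theta>: "ract \<Theta> pq t = (tensor_bimap GH (\<lambda>a x. ract \<Gamma>A x a) (\<lambda>h g. g \<otimes>\<^bsub>H\<^esub> h) t (fst pq),
    tensor_bimap AG (\<lambda>a b. b \<otimes>\<^bsub>A\<^esub> a) (\<lambda>h y. ract \<Gamma> y h) t (snd pq))"
  and dif_\<Theta>: "dif \<Theta> t = (tensor_map GH (dif \<Gamma>A) (\<lambda>h. h) t, tensor_map AG (\<lambda>a. a) (dif \<Gamma>) t)"
  by (simp_all add: tensor_fodc_def Let_def tensor_bimap_def tensor_map_def case_prod_beta)

lemma lin_map_\<Theta>: "lin_map K X \<Theta> \<Phi> \<longleftrightarrow>
    lin_map K X GH (\<lambda>w. fst (\<Phi> w)) \<and> lin_map K X AG (\<lambda>w. snd (\<Phi> w))"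
  unfolding lin_map_def
  by (auto simp: tensor_fodc_def Let_def case_prod_beta prod_eq_iff Pi_iff mem_Times_iff)

lemma fodc_map_generator:
  assumes "fodc_map K A \<delta> \<Gamma>A \<Theta> \<Phi>" "a \<in> carrier A" "b \<in> carrier A"
  shows "\<Phi> (lact \<Gamma>A a (dif \<Gamma>A b)) = lact \<Theta> (\<delta> a) (dif \<Theta> (\<delta> b))"
  using assms lin_map_closed[OF fodc_lin_dif[OF fodcA]] unfolding fodc_map_def by simp

text \<open>Written as \<open>\<delta> a\<close> acting on the differential of
  \<open>\<delta> b\<close>, the condition has the form that \<open>tensor_component_map\<close>
  requires.\<close>

lemma is_right_coaction_iff: "is_right_coaction K H A \<delta> \<Gamma>A \<rho> \<longleftrightarrow> lin_map K \<Gamma>A GH \<rho> \<and>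
    (\<forall>a\<in>carrier A. \<forall>b\<in>carrier A. \<rho> (lact \<Gamma>A a (dif \<Gamma>A b)) =
      tensor_bimap GH (lact \<Gamma>A) (monoid.mult H) (\<delta> a) (tensor_map GH (dif \<Gamma>A) (\<lambda>h. h) (\<delta> b)))"
proof -
  have "tensor_bimap GH (lact \<Gamma>A) (monoid.mult H) (\<delta> a) (tensor_map GH (dif \<Gamma>A) (\<lambda>h. h) (\<delta> b)) =
      tensor_bimap GH (\<lambda>a x. lact \<Gamma>A a (dif \<Gamma>A x)) (monoid.mult H) (\<delta> a) (\<delta> b)"
    if "a \<in> carrier A" "b \<in> carrier A" for a b
    by (rule bimap_tensor_map[OF mod_A mod_H mod_GA mod_H mod_GA mod_H mod_A mod_H fodc_lact[OF fodcA] bilin_H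
      fodc_lin_dif[OF fodcA] lin_map_ident coact_closed[OF that(1)] coact_closed[OF that(2)]])
  then show ?thesis
    by (simp add: is_right_coaction_def Let_def tensor_bimap_def)
qed

lemma fodc_map_coactions:
  assumes "fodc_map K A \<delta> \<Gamma>A \<Theta> \<Phi>"
  shows "is_right_coaction K H A \<delta> \<Gamma>A (\<lambda>w. fst (\<Phi> w))"
    and "is_vertical_coaction (\<lambda>w. snd (\<Phi> w))"
  using assms fodc_map_generator[OF assms]
  unfolding is_right_coaction_iff is_vertical_coaction_def fodc_map_def
  by (simp_all add: lin_map_\<Theta> lact_\<Theta> dif_\<Theta>)

text \<open>On each summand only one factor is differentiated, so the Leibniz condition of
  \<open>tensor_component_map\<close> reduces to the Leibniz rule in that factor and additivity of
  the tensor product.\<close>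

lemma coactions_fodc_map:
  assumes \<rho>: "is_right_coaction K H A \<delta> \<Gamma>A \<rho>" and \<Psi>: "is_vertical_coaction \<Psi>"
  shows "fodc_map K A \<delta> \<Gamma>A \<Theta> (\<lambda>w. (\<rho> w, \<Psi> w))"
proof -
  have bimA: "lact \<Gamma>A (a \<otimes>\<^bsub>A\<^esub> b) x = lact \<Gamma>A a (lact \<Gamma>A b x)" "lact \<Gamma>A \<one>\<^bsub>A\<^esub> x = x"
      "ract \<Gamma>A (lact \<Gamma>A b x) a = lact \<Gamma>A b (ract \<Gamma>A x a)"
    if "a \<in> carrier A" "b \<in> carrier A" "x \<in> carrier \<Gamma>A" for a b x
    using fodc_bimodule[OF fodcA] that unfolding bimodule_def by blast+
  have bimH: "ract \<Gamma> (lact \<Gamma> b x) a = lact \<Gamma> b (ract \<Gamma> x a)"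
    if "a \<in> carrier H" "b \<in> carrier H" "x \<in> carrier \<Gamma>" for a b x
    using fodc_bimodule[OF fodc] that unfolding bimodule_def by blast
  have leibA: "dif \<Gamma>A (a \<otimes>\<^bsub>A\<^esub> b) = ract \<Gamma>A (dif \<Gamma>A a) b \<oplus>\<^bsub>\<Gamma>A\<^esub> lact \<Gamma>A a (dif \<Gamma>A b)"
    if "a \<in> carrier A" "b \<in> carrier A" for a b
    using fodcA that unfolding is_fodc_def by blast
  have leibH: "dif \<Gamma> (a \<otimes>\<^bsub>H\<^esub> b) = ract \<Gamma> (dif \<Gamma> a) b \<oplus>\<^bsub>\<Gamma>\<^esub> lact \<Gamma> a (dif \<Gamma> b)"
    if "a \<in> carrier H" "b \<in> carrier H" for a b
    using fodc that unfolding is_fodc_def by blast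
  note dA = lin_map_closed[OF fodc_lin_dif[OF fodcA]]
  note lA = bilin_closed[OF fodc_lact[OF fodcA]] and rA = bilin_closed[OF fodc_ract[OF fodcA]]
    and rH = bilin_closed[OF fodc_ract[OF fodc]]
  have leibP: "pure_tensor GH (dif \<Gamma>A (a \<otimes>\<^bsub>A\<^esub> b)) (h \<otimes>\<^bsub>H\<^esub> g) =
      pure_tensor GH (ract \<Gamma>A (dif \<Gamma>A a) b) (h \<otimes>\<^bsub>H\<^esub> g) \<oplus>\<^bsub>GH\<^esub> pure_tensor GH (lact \<Gamma>A a (dif \<Gamma>A b)) (h \<otimes>\<^bsub>H\<^esub> g)"
    if "a \<in> carrier A" "h \<in> carrier H" "b \<in> carrier A" "g \<in> carrier H" for a h b g
    using that by (simp add: leibA tensor_pure_add_left[OF mod_GA mod_H] lA rA dA)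
  have leibQ: "pure_tensor AG (a \<otimes>\<^bsub>A\<^esub> b) (dif \<Gamma> (h \<otimes>\<^bsub>H\<^esub> g)) =
      pure_tensor AG (a \<otimes>\<^bsub>A\<^esub> b) (ract \<Gamma> (dif \<Gamma> h) g) \<oplus>\<^bsub>AG\<^esub> pure_tensor AG (a \<otimes>\<^bsub>A\<^esub> b) (lact \<Gamma> h (dif \<Gamma> g))"
    if "a \<in> carrier A" "h \<in> carrier H" "b \<in> carrier A" "g \<in> carrier H" for a h b g
    using that by (simp add: leibH tensor_pure_add_right[OF mod_A mod_G] lact_closed rH dif_closed)
  have l\<rho>: "lin_map K \<Gamma>A GH \<rho>" and g\<rho>: "\<And>a b. a \<in> carrier A \<Longrightarrow> b \<in> carrier A \<Longrightarrow> \<rho> (lact \<Gamma>A a (dif \<Gamma>A b)) =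
      tensor_bimap GH (lact \<Gamma>A) (monoid.mult H) (\<delta> a) (tensor_map GH (dif \<Gamma>A) (\<lambda>h. h) (\<delta> b))"
    using \<rho> by (simp_all add: is_right_coaction_iff)
  have l\<Psi>: "lin_map K \<Gamma>A AG \<Psi>" and g\<Psi>: "\<And>a b. a \<in> carrier A \<Longrightarrow> b \<in> carrier A \<Longrightarrow> \<Psi> (lact \<Gamma>A a (dif \<Gamma>A b)) =
      tensor_bimap AG (monoid.mult A) (lact \<Gamma>) (\<delta> a) (tensor_map AG (\<lambda>a. a) (dif \<Gamma>) (\<delta> b))"
    using \<Psi> by (simp_all add: is_vertical_coaction_def)
  have commA: "(b \<otimes>\<^bsub>A\<^esub> x) \<otimes>\<^bsub>A\<^esub> a = b \<otimes>\<^bsub>A\<^esub> (x \<otimes>\<^bsub>A\<^esub> a)"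
    if "a \<in> carrier A" "b \<in> carrier A" "x \<in> carrier A" for a b x
    using that by (simp add: A.m_assoc)
  have commH: "(b \<otimes>\<^bsub>H\<^esub> x) \<otimes>\<^bsub>H\<^esub> a = b \<otimes>\<^bsub>H\<^esub> (x \<otimes>\<^bsub>H\<^esub> a)"
    if "a \<in> carrier H" "b \<in> carrier H" "x \<in> carrier H" for a b x
    using that by (simp add: H.m_assoc)
  \<comment> \<open>Right actions enter with the scalar as first argument, hence the flips;
    \<open>commH\<close> here and \<open>commA\<close> in \<open>Q\<close> say that left and right
    multiplications commute.\<close>
  note P = tensor_component_map[OF fodcA mod_GA mod_H fodc_lact[OF fodcA] bilin_flip[OF fodc_ract[OF fodcA]]
      bilin_H bilin_flip[OF bilin_H] bimA(1) H.m_assoc bimA(2)[OF A.one_closed A.one_closed] H.l_one bimA(3) commH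
      fodc_lin_dif[OF fodcA] lin_map_ident leibP l\<rho> g\<rho>]
  note Q = tensor_component_map[OF fodcA mod_A mod_G bilin_A bilin_flip[OF bilin_A]
      bilin_lact bilin_flip[OF fodc_ract[OF fodc]] A.m_assoc lact_mult A.l_one lact_one commA bimH
      lin_map_ident lin_dif leibQ l\<Psi> g\<Psi>]
  show ?thesis
    unfolding fodc_map_def lin_map_\<Theta> lact_\<Theta> ract_\<Theta> dif_\<Theta> fst_conv snd_conv
    by (intro conjI ballI l\<rho> l\<Psi> prod_eqI; simp add: P Q)
qed

lemma submodule_base_forms: "submodule (base_forms K H A \<delta> \<Gamma>A) K \<Gamma>A"
  unfolding base_forms_def
  by (rule submodule_lspan[OF mod_GA])
    (auto simp: coinv_def intro!: bilin_closed[OF fodc_lact[OF fodcA]] bilin_closed[OF fodc_ract[OF fodcA]]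
      lin_map_closed[OF fodc_lin_dif[OF fodcA]])

text \<open>\<open>\<Phi>\<close> supplies covariance and a vertical map, the Galois condition its
  surjectivity, and an inclusion is injective; of the exact sequence only the equality of the base
  forms with the kernel is left.\<close>

lemma bm_bundle_iff:
  assumes galois: "hopf_galois K H A \<delta>" and \<Phi>: "fodc_map K A \<delta> \<Gamma>A \<Theta> \<Phi>"
  shows "bm_bundle K H A \<delta> \<Gamma> \<Gamma>A \<longleftrightarrow>
    base_forms K H A \<delta> \<Gamma>A = {w \<in> carrier \<Gamma>A. \<Phi> w \<in> carrier GH \<times> {\<zero>\<^bsub>AG\<^esub>}}"
proof -
  note \<Psi> = fodc_map_coactions(2)[OF \<Phi>]
  have lin: "lin_map K \<Gamma>A GH (\<lambda>w. fst (\<Phi> w))"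
    using \<Phi> by (simp add: fodc_map_def lin_map_\<Theta>)
  \<comment> \<open>The first component of \<open>\<Phi> w\<close> always lies in \<open>GH\<close>,
    so the condition on the right says that the vertical component vanishes.\<close>
  have ker: "{m \<in> carrier \<Gamma>A. v m = \<zero>\<^bsub>AL\<^esub>} = {w \<in> carrier \<Gamma>A. \<Phi> w \<in> carrier GH \<times> {\<zero>\<^bsub>AG\<^esub>}}"
    if "is_ver K H A \<delta> \<Gamma> \<Gamma>A v" for v
    using ver_kernel[OF \<Psi> that] lin_map_closed[OF lin] by (auto simp: mem_Times_iff)
  interpret GA: module K \<Gamma>A by (rule mod_GA)
  have sub: "base_forms K H A \<delta> \<Gamma>A \<subseteq> carrier \<Gamma>A"
    by (rule GA.submoduleE(1)[OF submodule_base_forms])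
  have exact: "short_exact K (\<Gamma>A\<lparr>carrier := base_forms K H A \<delta> \<Gamma>A\<rparr>) (\<lambda>x. x) \<Gamma>A v AL \<longleftrightarrow>
      base_forms K H A \<delta> \<Gamma>A = {w \<in> carrier \<Gamma>A. \<Phi> w \<in> carrier GH \<times> {\<zero>\<^bsub>AG\<^esub>}}"
    if v: "is_ver K H A \<delta> \<Gamma> \<Gamma>A v" for v
  proof -
    have lv: "lin_map K \<Gamma>A AL v" using v by (simp add: is_ver_iff)
    have "lin_map K (\<Gamma>A\<lparr>carrier := base_forms K H A \<delta> \<Gamma>A\<rparr>) \<Gamma>A (\<lambda>x. x)"
      using sub by (auto simp: lin_map_def)
    then show ?thesis
      unfolding short_exact_def using ver_surjective[OF galois v] lv by (simp add: ker[OF v])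
  qed
  have "right_covariant K H A \<delta> \<Gamma>A"
    using fodc_map_coactions(1)[OF \<Phi>] unfolding right_covariant_def by blast
  then have "bm_bundle K H A \<delta> \<Gamma> \<Gamma>A \<longleftrightarrow> (\<exists>v. is_ver K H A \<delta> \<Gamma> \<Gamma>A v \<and>
      short_exact K (\<Gamma>A\<lparr>carrier := base_forms K H A \<delta> \<Gamma>A\<rparr>) (\<lambda>x. x) \<Gamma>A v AL)"
    by (simp add: bm_bundle_def fodc bicov fodcA)
  also have "\<dots> \<longleftrightarrow> base_forms K H A \<delta> \<Gamma>A = {w \<in> carrier \<Gamma>A. \<Phi> w \<in> carrier GH \<times> {\<zero>\<^bsub>AG\<^esub>}}"
  proof
    assume "\<exists>v. is_ver K H A \<delta> \<Gamma> \<Gamma>A v \<and>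
      short_exact K (\<Gamma>A\<lparr>carrier := base_forms K H A \<delta> \<Gamma>A\<rparr>) (\<lambda>x. x) \<Gamma>A v AL"
    then obtain v where v: "is_ver K H A \<delta> \<Gamma> \<Gamma>A v"
      "short_exact K (\<Gamma>A\<lparr>carrier := base_forms K H A \<delta> \<Gamma>A\<rparr>) (\<lambda>x. x) \<Gamma>A v AL" by (elim exE conjE)
    from exact[OF v(1)] v(2) show "base_forms K H A \<delta> \<Gamma>A = {w \<in> carrier \<Gamma>A. \<Phi> w \<in> carrier GH \<times> {\<zero>\<^bsub>AG\<^esub>}}"
      by (rule iffD1)
  next
    note v = vertical_coaction_to_ver[OF \<Psi>]
    assume "base_forms K H A \<delta> \<Gamma>A = {w \<in> carrier \<Gamma>A. \<Phi> w \<in> carrier GH \<times> {\<zero>\<^bsub>AG\<^esub>}}"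
    with exact[OF v] have "short_exact K (\<Gamma>A\<lparr>carrier := base_forms K H A \<delta> \<Gamma>A\<rparr>) (\<lambda>x. x) \<Gamma>A
        (\<lambda>w. to_ver (snd (\<Phi> w))) AL"
      by (rule iffD2)
    with v show "\<exists>v. is_ver K H A \<delta> \<Gamma> \<Gamma>A v \<and>
      short_exact K (\<Gamma>A\<lparr>carrier := base_forms K H A \<delta> \<Gamma>A\<rparr>) (\<lambda>x. x) \<Gamma>A v AL"
      by (intro exI conjI)
  qed
  finally show ?thesis .
qed

end

section \<open>Truncations\<close>

lemma lin_map_truncation:
  "lin_map K X \<Omega> f \<Longrightarrow> (\<And>x. x \<in> carrier X \<Longrightarrow> f x \<in> degr \<Omega> 1) \<Longrightarrow> lin_map K X (truncation \<Omega>) f"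
  unfolding lin_map_def truncation_def by auto

lemma fodc_truncation:
  assumes A: "unital_algebra K A" and \<Omega>: "diff_calculus K A \<Omega>"
  shows "is_fodc K A (truncation \<Omega>)"
proof -
  let ?G = "truncation \<Omega>"
  have alg: "unital_algebra K \<Omega>"
    and sub: "\<And>n. submodule (degr \<Omega> n) K \<Omega>"
    and mult: "\<And>m n v w. v \<in> degr \<Omega> m \<Longrightarrow> w \<in> degr \<Omega> n \<Longrightarrow> v \<otimes>\<^bsub>\<Omega>\<^esub> w \<in> degr \<Omega> (m + n)"
    and emb: "algebra_map K A \<Omega> (emb \<Omega>)" "bij_betw (emb \<Omega>) (carrier A) (degr \<Omega> 0)"
    and dd: "\<And>n. lin_map K (\<Omega>\<lparr>carrier := degr \<Omega> n\<rparr>) (\<Omega>\<lparr>carrier := degr \<Omega> (Suc n)\<rparr>) (dd \<Omega> n)"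
    and leib: "\<And>m n v w. v \<in> degr \<Omega> m \<Longrightarrow> w \<in> degr \<Omega> n \<Longrightarrow> dd \<Omega> (m + n) (v \<otimes>\<^bsub>\<Omega>\<^esub> w) =
      dd \<Omega> m v \<otimes>\<^bsub>\<Omega>\<^esub> w \<oplus>\<^bsub>\<Omega>\<^esub> add_pow \<Omega> ((- 1 :: int) ^ m) (v \<otimes>\<^bsub>\<Omega>\<^esub> dd \<Omega> n w)"
    and span: "\<And>n. degr \<Omega> n = lspan K \<Omega>
      {emb \<Omega> a \<otimes>\<^bsub>\<Omega>\<^esub> wedge_list \<Omega> (map (\<lambda>a'. dd \<Omega> 0 (emb \<Omega> a')) as) | a as.
        a \<in> carrier A \<and> as \<in> lists (carrier A) \<and> length as = n}"
    using \<Omega> unfolding diff_calculus_def by blast+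
  note mod\<Omega> = algebra_module[OF alg]
  interpret O: ring \<Omega> by (rule algebra_ring[OF alg])
  interpret OM: module K \<Omega> by (rule mod\<Omega>)
  interpret A: ring A by (rule algebra_ring[OF A])
  have deg: "degr \<Omega> n \<subseteq> carrier \<Omega>" for n by (rule OM.submoduleE(1)[OF sub])
  have e0: "emb \<Omega> a \<in> degr \<Omega> 0" if "a \<in> carrier A" for a
    using emb(2) that by (auto simp: bij_betw_def)
  note ec = subsetD[OF deg e0]
  have lemb: "lin_map K A \<Omega> (emb \<Omega>)" and emb_mult: "\<And>a b. a \<in> carrier A \<Longrightarrow> b \<in> carrier A \<Longrightarrow> emb \<Omega> (a \<otimes>\<^bsub>A\<^esub> b) = emb \<Omega> a \<otimes>\<^bsub>\<Omega>\<^esub> emb \<Omega> b"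
    and emb_one: "emb \<Omega> \<one>\<^bsub>A\<^esub> = \<one>\<^bsub>\<Omega>\<^esub>"
    using emb(1) unfolding algebra_map_def ring_hom_def by auto
  have sel: "carrier ?G = degr \<Omega> 1" "add ?G = add \<Omega>" "smult ?G = smult \<Omega>" "\<zero>\<^bsub>?G\<^esub> = \<zero>\<^bsub>\<Omega>\<^esub>"
    "lact ?G = (\<lambda>a w. emb \<Omega> a \<otimes>\<^bsub>\<Omega>\<^esub> w)" "ract ?G = (\<lambda>w a. w \<otimes>\<^bsub>\<Omega>\<^esub> emb \<Omega> a)" "dif ?G = (\<lambda>a. dd \<Omega> 0 (emb \<Omega> a))"
    by (simp_all add: truncation_def)
  have modG: "module K ?G"
    by (rule module_cong[OF submodule.submodule_is_module[OF sub[of 1] mod\<Omega>]]) (simp_all add: sel)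
  note lG = lin_map_truncation
  have Gl: "lin_map K ?G \<Omega> f" if "lin_map K \<Omega> \<Omega> f" for f
    using subsetD[OF deg[of 1]]
    by (intro lin_mapI) (simp_all add: sel lin_map_closed[OF that] lin_map_add[OF that] lin_map_smult[OF that])
  note bm = algebra_bilin_mult[OF alg]
  have m01: "v \<otimes>\<^bsub>\<Omega>\<^esub> w \<in> degr \<Omega> 1" if "v \<in> degr \<Omega> 0" "w \<in> degr \<Omega> 1" for v w
    using mult[OF that] by simp
  have m10: "v \<otimes>\<^bsub>\<Omega>\<^esub> w \<in> degr \<Omega> 1" if "v \<in> degr \<Omega> 1" "w \<in> degr \<Omega> 0" for v w
    using mult[OF that] by simp
  have d0: "dd \<Omega> 0 v \<in> degr \<Omega> 1" if "v \<in> degr \<Omega> 0" for v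
    using lin_map_closed[OF dd[of 0]] that by simp
  have bim: "bimodule K A ?G"
    unfolding bimodule_def sel
  proof (intro conjI ballI)
    show "module K ?G" by (rule modG)
    show "lin_map K ?G ?G (\<lambda>x. emb \<Omega> a \<otimes>\<^bsub>\<Omega>\<^esub> x)" if a: "a \<in> carrier A" for a
      by (rule lG[OF Gl]) (use bilin_right[OF bm ec[OF a]] e0[OF a] m01 in \<open>auto simp: sel\<close>)
    show "lin_map K ?G ?G (\<lambda>x. x \<otimes>\<^bsub>\<Omega>\<^esub> emb \<Omega> a)" if a: "a \<in> carrier A" for a
      by (rule lG[OF Gl]) (use bilin_left[OF bm ec[OF a]] e0[OF a] m10 in \<open>auto simp: sel\<close>)
    show "lin_map K A ?G (\<lambda>a. emb \<Omega> a \<otimes>\<^bsub>\<Omega>\<^esub> x)" if x: "x \<in> degr \<Omega> 1" for x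
      by (rule lG) (use lin_map_bilin1[OF bm lemb subsetD[OF deg x]] e0 m01[OF _ x] in auto)
    show "lin_map K A ?G (\<lambda>a. x \<otimes>\<^bsub>\<Omega>\<^esub> emb \<Omega> a)" if x: "x \<in> degr \<Omega> 1" for x
      by (rule lG) (use lin_map_bilin2[OF bm lemb subsetD[OF deg x]] e0 m10[OF x] in auto)
  qed (use subsetD[OF deg[of 1]] ec in \<open>simp_all add: emb_one emb_mult O.m_assoc\<close>)
  have ldif: "lin_map K A ?G (\<lambda>a. dd \<Omega> 0 (emb \<Omega> a))"
    using lemb e0 dd[of 0] unfolding lin_map_def by (auto simp: sel)
  \<comment> \<open>In degree 0 the sign is \<open>(- 1) ^ 0 = 1\<close>, an additive power that
    leaves the second summand unchanged.\<close>
  have leibniz: "dd \<Omega> 0 (emb \<Omega> (a \<otimes>\<^bsub>A\<^esub> b)) =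
      dd \<Omega> 0 (emb \<Omega> a) \<otimes>\<^bsub>\<Omega>\<^esub> emb \<Omega> b \<oplus>\<^bsub>\<Omega>\<^esub> emb \<Omega> a \<otimes>\<^bsub>\<Omega>\<^esub> dd \<Omega> 0 (emb \<Omega> b)"
    if ab: "a \<in> carrier A" "b \<in> carrier A" for a b
    using leib[OF e0[OF ab(1)] e0[OF ab(2)]] ab subsetD[OF deg d0[OF e0]] ec
    by (simp add: emb_mult O.add.int_pow_1)
  \<comment> \<open>A list of length one wedges to a differential times the unit, so the degree-one
    generators of \<open>\<Omega>\<close> are the forms \<open>a d b\<close>.\<close>
  have gens: "{emb \<Omega> a \<otimes>\<^bsub>\<Omega>\<^esub> wedge_list \<Omega> (map (\<lambda>a'. dd \<Omega> 0 (emb \<Omega> a')) as) | a as.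
        a \<in> carrier A \<and> as \<in> lists (carrier A) \<and> length as = 1} =
      {lact ?G a (dif ?G a') | a a'. a \<in> carrier A \<and> a' \<in> carrier A}" (is "?X = ?Y")
  proof -
    have w: "wedge_list \<Omega> (map (\<lambda>a'. dd \<Omega> 0 (emb \<Omega> a')) [b]) = dd \<Omega> 0 (emb \<Omega> b)" if "b \<in> carrier A" for b
      using subsetD[OF deg d0[OF e0[OF that]]] by (simp add: wedge_list_def)
    show ?thesis
    proof (intro equalityI subsetI)
      fix x assume "x \<in> ?X"
      then obtain a as where *: "x = emb \<Omega> a \<otimes>\<^bsub>\<Omega>\<^esub> wedge_list \<Omega> (map (\<lambda>a'. dd \<Omega> 0 (emb \<Omega> a')) as)"
        "a \<in> carrier A" "as \<in> lists (carrier A)" "length as = 1" by blast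
      then obtain b where "as = [b]" "b \<in> carrier A" by (cases as) auto
      then show "x \<in> ?Y" using * w by (auto simp: sel)
    next
      fix x assume "x \<in> ?Y"
      then obtain a b where *: "x = emb \<Omega> a \<otimes>\<^bsub>\<Omega>\<^esub> dd \<Omega> 0 (emb \<Omega> b)" "a \<in> carrier A" "b \<in> carrier A"
        by (auto simp: sel)
      then have "x = emb \<Omega> a \<otimes>\<^bsub>\<Omega>\<^esub> wedge_list \<Omega> (map (\<lambda>a'. dd \<Omega> 0 (emb \<Omega> a')) [b])" using w by simp
      then show "x \<in> ?X" using *(2,3) by (intro CollectI exI[of _ a] exI[of _ "[b]"]) simp
    qed
  qed
  interpret G: module K ?G by (rule modG)
  have Y: "?Y \<subseteq> carrier ?G"
    using e0 d0 m01 by (auto simp: sel)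
  have "carrier ?G = lspan K ?G ?Y"
  proof
    show "carrier ?G \<subseteq> lspan K ?G ?Y"
    proof -
      \<comment> \<open>\<open>lspan\<close> intersects the submodules of a given module. Each
        submodule of the truncation is one of \<open>\<Omega>\<close>, so the span in
        \<open>\<Omega>\<close> lies in the span in the truncation.\<close>
      have "submodule N K \<Omega>" if N: "submodule N K ?G" for N
      proof (rule OM.submoduleI)
        note NE = G.submoduleE[OF N]
        have z: "\<zero>\<^bsub>?G\<^esub> \<in> N" using subgroup.one_closed[OF submodule.axioms(1)[OF N]] by simp
        show "N \<subseteq> carrier \<Omega>" using NE(1) deg[of 1] by (auto simp: sel)
        show "\<zero>\<^bsub>\<Omega>\<^esub> \<in> N" using z by (simp add: sel)
        show "x \<oplus>\<^bsub>\<Omega>\<^esub> y \<in> N" if "x \<in> N" "y \<in> N" for x y using NE(5)[OF that] by (simp add: sel)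
        show "c \<odot>\<^bsub>\<Omega>\<^esub> x \<in> N" if "c \<in> carrier K" "x \<in> N" for c x using NE(4)[OF that] by (simp add: sel)
        \<comment> \<open>Negatives are described relative to the carrier, so those of the
          truncation and of \<open>\<Omega>\<close> have to be identified.\<close>
        show "\<ominus>\<^bsub>\<Omega>\<^esub> x \<in> N" if x: "x \<in> N" for x
        proof -
          have c: "x \<in> carrier ?G" "\<ominus>\<^bsub>?G\<^esub> x \<in> carrier ?G" using NE(1) x NE(3)[OF x] by auto
          have "\<ominus>\<^bsub>?G\<^esub> x \<oplus>\<^bsub>\<Omega>\<^esub> x = \<zero>\<^bsub>\<Omega>\<^esub>" using G.l_neg[OF c(1)] by (simp add: sel)
          then have "\<ominus>\<^bsub>\<Omega>\<^esub> x = \<ominus>\<^bsub>?G\<^esub> x"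
            using c deg[of 1] by (intro O.minus_equality) (auto simp: sel)
          then show ?thesis using NE(3)[OF x] by simp
        qed
      qed
      then have "lspan K \<Omega> ?Y \<subseteq> lspan K ?G ?Y" unfolding lspan_def by blast
      then show ?thesis using span[of 1] unfolding gens sel(1) by blast
    qed
    show "lspan K ?G ?Y \<subseteq> carrier ?G" by (rule lspan_subset[OF G.carrier_is_submodule Y])
  qed
  then show ?thesis
    unfolding is_fodc_def using bim ldif leibniz by (simp add: sel)
qed

section \<open>The maximal prolongation in degree one\<close>

text \<open>The product of \<open>word_ring\<close> freed from its carrier, so that its laws hold
  unconditionally.\<close>

definition word_mult :: "('b list \<Rightarrow>\<^sub>0 int) \<Rightarrow> ('b list \<Rightarrow>\<^sub>0 int) \<Rightarrow> ('b list \<Rightarrow>\<^sub>0 int)"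
  where "word_mult x y = frag_extend (\<lambda>u. frag_extend (\<lambda>v. frag_of (u @ v)) y) x"

lemma frag_extend_diff_fun: "frag_extend (\<lambda>u. f u - g u) x = frag_extend f x - frag_extend g x"
  by (induction x rule: frag_induction[OF subset_UNIV]) (simp_all add: frag_extend_diff)

lemma word_mult_diff_left: "word_mult (x - y) z = word_mult x z - word_mult y z"
  and word_mult_diff_right: "word_mult x (y - z) = word_mult x y - word_mult x z"
  and word_mult_zero: "word_mult 0 z = 0" "word_mult z 0 = 0"
  and word_mult_of: "word_mult (frag_of u) (frag_of v) = frag_of (u @ v)"
  by (simp_all add: word_mult_def frag_extend_diff frag_extend_diff_fun frag_extend_eq_0)

text \<open>Induction on combinations runs over differences, so subtraction comes first; a sum is
  the difference with \<open>0 - y\<close>.\<close>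

lemma word_mult_add_left: "word_mult (x + y) z = word_mult x z + word_mult y z"
  using word_mult_diff_left[of x "0 - y" z] word_mult_diff_left[of 0 y z] by (simp add: word_mult_zero)

lemma word_mult_add_right: "word_mult x (y + z) = word_mult x y + word_mult x z"
  using word_mult_diff_right[of x y "0 - z"] word_mult_diff_right[of x 0 z] by (simp add: word_mult_zero)

lemma word_mult_assoc: "word_mult (word_mult x y) z = word_mult x (word_mult y z)"
proof (induction x rule: frag_induction[OF subset_UNIV])
  case (2 u)
  show ?case
  proof (induction y rule: frag_induction[OF subset_UNIV])
    case (2 v)
    show ?case
      by (induction z rule: frag_induction[OF subset_UNIV])
        (simp_all add: word_mult_zero word_mult_of word_mult_diff_right)
  qed (simp_all add: word_mult_zero word_mult_diff_left word_mult_diff_right)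
qed (simp_all add: word_mult_zero word_mult_diff_left)

lemma word_mult_one: "word_mult (frag_of []) x = x" "word_mult x (frag_of []) = x"
  by (induction x rule: frag_induction[OF subset_UNIV])
    (simp_all add: word_mult_zero word_mult_of word_mult_diff_right word_mult_diff_left)

lemma keys_word_mult:
  assumes "Poly_Mapping.keys x \<subseteq> lists S" "Poly_Mapping.keys y \<subseteq> lists S"
  shows "Poly_Mapping.keys (word_mult x y) \<subseteq> lists S"
proof -
  have "Poly_Mapping.keys (frag_extend (\<lambda>v. frag_of (u @ v)) y) \<subseteq> lists S" if "u \<in> lists S" for u
    using keys_frag_extend[of "\<lambda>v. frag_of (u @ v)" y] assms(2) that by fastforce
  then show ?thesis
    using keys_frag_extend[of "\<lambda>u. frag_extend (\<lambda>v. frag_of (u @ v)) y" x] assms(1)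
    unfolding word_mult_def by blast
qed

lemma word_ring_sel: "carrier (word_ring X Y) = {c. Poly_Mapping.keys c \<subseteq> lists (X <+> Y)}"
    "monoid.mult (word_ring X Y) = word_mult" "one (word_ring X Y) = frag_of []"
    "\<zero>\<^bsub>word_ring X Y\<^esub> = 0" "add (word_ring X Y) = (+)"
  by (simp_all add: word_ring_def word_mult_def fun_eq_iff)

lemma ring_word_ring: "ring (word_ring X Y)"
proof (rule ringI)
  show "abelian_group (word_ring X Y)"
  proof (rule abelian_groupI)
    fix x assume "x \<in> carrier (word_ring X Y)"
    then show "\<exists>y\<in>carrier (word_ring X Y). y \<oplus>\<^bsub>word_ring X Y\<^esub> x = \<zero>\<^bsub>word_ring X Y\<^esub>"
      by (intro bexI[of _ "- x"]) (simp_all add: word_ring_sel)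
  qed (use keys_add in \<open>fastforce simp: word_ring_sel add.assoc add.commute\<close>)+
  show "monoid (word_ring X Y)"
    by (rule monoidI) (simp_all add: word_ring_sel keys_word_mult word_mult_assoc word_mult_one)
qed (simp_all add: word_ring_sel word_mult_add_left word_mult_add_right)

text \<open>Links the subtraction of combinations, used in \<open>word_rel\<close>, to that of the
  ring, used for ideals and cosets.\<close>

lemma minus_word_ring:
  assumes "x \<in> carrier (word_ring X Y)" "y \<in> carrier (word_ring X Y)"
  shows "x \<ominus>\<^bsub>word_ring X Y\<^esub> y = x - y"
proof -
  interpret ring "word_ring X Y" by (rule ring_word_ring)
  have "\<ominus>\<^bsub>word_ring X Y\<^esub> y = - y"
    by (rule minus_equality) (use assms in \<open>simp_all add: word_ring_sel\<close>)
  then show ?thesis by (simp add: a_minus_def word_ring_sel)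
qed

text \<open>\<open>A\<close> and \<open>\<Gamma>\<close> embed as the two components, while any
  product of two forms vanishes. Degrees 0 and 1 thus stay visible, and the quadratic relations of
  the prolongation hold here.\<close>

definition square_zero :: "('k, 'a, 'y) module_scheme \<Rightarrow> ('k, 'a, 'g) fodc \<Rightarrow> ('a \<times> 'g) ring"
  where "square_zero A \<Gamma> =
    \<lparr>carrier = carrier A \<times> carrier \<Gamma>,
     monoid.mult = (\<lambda>p q. (fst p \<otimes>\<^bsub>A\<^esub> fst q, ract \<Gamma> (snd p) (fst q) \<oplus>\<^bsub>\<Gamma>\<^esub> lact \<Gamma> (fst p) (snd q))),
     one = (\<one>\<^bsub>A\<^esub>, \<zero>\<^bsub>\<Gamma>\<^esub>), ring.zero = (\<zero>\<^bsub>A\<^esub>, \<zero>\<^bsub>\<Gamma>\<^esub>),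
     add = (\<lambda>p q. (fst p \<oplus>\<^bsub>A\<^esub> fst q, snd p \<oplus>\<^bsub>\<Gamma>\<^esub> snd q))\<rparr>"

locale fodc_data =
  fixes K :: "('k, 'x) ring_scheme" and A :: "('k, 'a, 'y) module_scheme" and \<Gamma> :: "('k, 'a, 'g) fodc"
  assumes alg_A: "unital_algebra K A" and fodc: "is_fodc K A \<Gamma>"
begin

sublocale A: ring A by (rule algebra_ring[OF alg_A])
sublocale AM: module K A by (rule algebra_module[OF alg_A])
sublocale G: module K \<Gamma> by (rule fodc_module[OF fodc])

lemmas lact_closed = bilin_closed[OF fodc_lact[OF fodc]]
lemmas ract_closed = bilin_closed[OF fodc_ract[OF fodc]]
lemmas dif_closed = lin_map_closed[OF fodc_lin_dif[OF fodc]]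

lemma bimodule_laws:
  assumes "a \<in> carrier A" "b \<in> carrier A" "x \<in> carrier \<Gamma>"
  shows "lact \<Gamma> (a \<otimes>\<^bsub>A\<^esub> b) x = lact \<Gamma> a (lact \<Gamma> b x)"
    "ract \<Gamma> x (a \<otimes>\<^bsub>A\<^esub> b) = ract \<Gamma> (ract \<Gamma> x a) b"
    "ract \<Gamma> (lact \<Gamma> a x) b = lact \<Gamma> a (ract \<Gamma> x b)"
  using fodc_bimodule[OF fodc] assms unfolding bimodule_def by blast+

lemma bimodule_one: "x \<in> carrier \<Gamma> \<Longrightarrow> lact \<Gamma> \<one>\<^bsub>A\<^esub> x = x" "x \<in> carrier \<Gamma> \<Longrightarrow> ract \<Gamma> x \<one>\<^bsub>A\<^esub> = x"
  using fodc_bimodule[OF fodc] unfolding bimodule_def by blast+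

lemma act_zero:
  shows "x \<in> carrier \<Gamma> \<Longrightarrow> lact \<Gamma> \<zero>\<^bsub>A\<^esub> x = \<zero>\<^bsub>\<Gamma>\<^esub>" "a \<in> carrier A \<Longrightarrow> lact \<Gamma> a \<zero>\<^bsub>\<Gamma>\<^esub> = \<zero>\<^bsub>\<Gamma>\<^esub>"
    "x \<in> carrier \<Gamma> \<Longrightarrow> ract \<Gamma> x \<zero>\<^bsub>A\<^esub> = \<zero>\<^bsub>\<Gamma>\<^esub>" "a \<in> carrier A \<Longrightarrow> ract \<Gamma> \<zero>\<^bsub>\<Gamma>\<^esub> a = \<zero>\<^bsub>\<Gamma>\<^esub>"
  using lin_map_zero[OF bilin_left[OF fodc_lact[OF fodc]] A.abelian_group_axioms module_abelian_group[OF fodc_module[OF fodc]]]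
    lin_map_zero[OF bilin_right[OF fodc_lact[OF fodc]] module_abelian_group[OF fodc_module[OF fodc]] module_abelian_group[OF fodc_module[OF fodc]]]
    lin_map_zero[OF bilin_right[OF fodc_ract[OF fodc]] A.abelian_group_axioms module_abelian_group[OF fodc_module[OF fodc]]]
    lin_map_zero[OF bilin_left[OF fodc_ract[OF fodc]] module_abelian_group[OF fodc_module[OF fodc]] module_abelian_group[OF fodc_module[OF fodc]]]
  by auto

lemma act_add:
  "a \<in> carrier A \<Longrightarrow> b \<in> carrier A \<Longrightarrow> x \<in> carrier \<Gamma> \<Longrightarrow> lact \<Gamma> (a \<oplus>\<^bsub>A\<^esub> b) x = lact \<Gamma> a x \<oplus>\<^bsub>\<Gamma>\<^esub> lact \<Gamma> b x"
  "a \<in> carrier A \<Longrightarrow> x \<in> carrier \<Gamma> \<Longrightarrow> y \<in> carrier \<Gamma> \<Longrightarrow> lact \<Gamma> a (x \<oplus>\<^bsub>\<Gamma>\<^esub> y) = lact \<Gamma> a x \<oplus>\<^bsub>\<Gamma>\<^esub> lact \<Gamma> a y"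
  "a \<in> carrier A \<Longrightarrow> b \<in> carrier A \<Longrightarrow> x \<in> carrier \<Gamma> \<Longrightarrow> ract \<Gamma> x (a \<oplus>\<^bsub>A\<^esub> b) = ract \<Gamma> x a \<oplus>\<^bsub>\<Gamma>\<^esub> ract \<Gamma> x b"
  "a \<in> carrier A \<Longrightarrow> x \<in> carrier \<Gamma> \<Longrightarrow> y \<in> carrier \<Gamma> \<Longrightarrow> ract \<Gamma> (x \<oplus>\<^bsub>\<Gamma>\<^esub> y) a = ract \<Gamma> x a \<oplus>\<^bsub>\<Gamma>\<^esub> ract \<Gamma> y a"
  by (simp_all add: lin_map_add[OF bilin_left[OF fodc_lact[OF fodc]]] lin_map_add[OF bilin_right[OF fodc_lact[OF fodc]]]
      lin_map_add[OF bilin_left[OF fodc_ract[OF fodc]]] lin_map_add[OF bilin_right[OF fodc_ract[OF fodc]]])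

lemma ring_square_zero: "ring (square_zero A \<Gamma>)"
proof (rule ringI)
  show "abelian_group (square_zero A \<Gamma>)"
  proof (rule abelian_groupI)
    fix x assume "x \<in> carrier (square_zero A \<Gamma>)"
    then show "\<exists>y\<in>carrier (square_zero A \<Gamma>). y \<oplus>\<^bsub>square_zero A \<Gamma>\<^esub> x = \<zero>\<^bsub>square_zero A \<Gamma>\<^esub>"
      by (intro bexI[of _ "(\<ominus>\<^bsub>A\<^esub> fst x, \<ominus>\<^bsub>\<Gamma>\<^esub> snd x)"]) (auto simp: square_zero_def A.l_neg G.l_neg)
  qed (auto simp: square_zero_def A.a_ac G.a_ac)
  show "monoid (square_zero A \<Gamma>)"
    by (rule monoidI)
      (auto simp: square_zero_def lact_closed ract_closed act_zero bimodule_one A.m_assoc act_add bimodule_laws G.a_ac)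
qed (auto simp: square_zero_def lact_closed ract_closed act_add A.l_distr A.r_distr G.a_ac)

end

lemma Inl_Inr_Plus_iff [simp]: "Inl a \<in> X <+> Y \<longleftrightarrow> a \<in> X" "Inr b \<in> X <+> Y \<longleftrightarrow> b \<in> Y"
  by auto

section \<open>Evaluation of words in the square-zero extension, and the two quotients it factors
  through\<close>

context fodc_data
begin

abbreviation "W \<equiv> word_ring (carrier A) (carrier \<Gamma>)"
abbreviation "words \<equiv> lists (carrier A <+> carrier \<Gamma>)"
abbreviation "E \<equiv> square_zero A \<Gamma>"
abbreviation "I1 \<equiv> Idl\<^bsub>W\<^esub> (word_rel A \<Gamma>)"
abbreviation "T \<equiv> tensor_algebra A \<Gamma>"
abbreviation "tcls \<equiv> tensor_algebra_class A \<Gamma>"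
abbreviation "I2 \<equiv> prolongation_ideal A \<Gamma>"
abbreviation "Q \<equiv> T Quot I2"

definition cls :: "(('a + 'g) list \<Rightarrow>\<^sub>0 int) \<Rightarrow> (('a + 'g) list \<Rightarrow>\<^sub>0 int) set set"
  where "cls x = I2 +>\<^bsub>T\<^esub> tcls x"

definition word_value :: "('a + 'g) list \<Rightarrow> 'a \<times> 'g"
  where "word_value u = foldr (\<lambda>s p. (case s of Inl a \<Rightarrow> (a, \<zero>\<^bsub>\<Gamma>\<^esub>) | Inr x \<Rightarrow> (\<zero>\<^bsub>A\<^esub>, x)) \<otimes>\<^bsub>E\<^esub> p) u \<one>\<^bsub>E\<^esub>"

sublocale WR: ring W by (rule ring_word_ring)
sublocale ER: ring E by (rule ring_square_zero)

lemma word_value_simps: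
  "word_value [] = \<one>\<^bsub>E\<^esub>"
  "word_value (Inl a # u) = (a, \<zero>\<^bsub>\<Gamma>\<^esub>) \<otimes>\<^bsub>E\<^esub> word_value u"
  "word_value (Inr x # u) = (\<zero>\<^bsub>A\<^esub>, x) \<otimes>\<^bsub>E\<^esub> word_value u"
  by (simp_all add: word_value_def)

lemma square_zero_closed: "a \<in> carrier A \<Longrightarrow> x \<in> carrier \<Gamma> \<Longrightarrow> (a, x) \<in> carrier E"
  by (simp add: square_zero_def)

lemma word_value_closed: "u \<in> words \<Longrightarrow> word_value u \<in> carrier E"
proof (induction u)
  case (Cons s u)
  then show ?case by (cases s) (auto simp: word_value_simps square_zero_closed)
qed (simp add: word_value_simps)

lemma word_value_append:
  assumes "u \<in> words" "v \<in> words"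
  shows "word_value (u @ v) = word_value u \<otimes>\<^bsub>E\<^esub> word_value v"
  using assms(1)
proof (induction u)
  case (Cons s u)
  note c = word_value_closed[OF Cons.hyps(2)] word_value_closed[OF assms(2)]
  show ?case
    using Cons c by (cases s) (simp_all add: word_value_simps square_zero_closed ER.m_assoc)
qed (simp add: word_value_simps word_value_closed assms(2))

abbreviation "ev \<equiv> frag_eval E word_value"

lemma word_value_funcset: "word_value \<in> words \<rightarrow> carrier E"
  by (simp add: word_value_closed)

lemma ev_closed: "x \<in> carrier W \<Longrightarrow> ev x \<in> carrier E"
  by (rule ER.frag_eval_closed[OF _ word_value_funcset]) (simp add: word_ring_sel)

lemma ev_diff: "x \<in> carrier W \<Longrightarrow> y \<in> carrier W \<Longrightarrow> ev (x - y) = ev x \<ominus>\<^bsub>E\<^esub> ev y"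
  by (rule ER.frag_eval_diff[OF _ _ word_value_funcset]) (simp_all add: word_ring_sel)

lemma ev_of: "u \<in> words \<Longrightarrow> ev (frag_of u) = word_value u"
  by (rule ER.frag_eval_of) (rule word_value_closed)

lemma W_induct [consumes 1, case_names zero diff of]:
  assumes "x \<in> carrier W" "P 0"
    "\<And>x y. x \<in> carrier W \<Longrightarrow> y \<in> carrier W \<Longrightarrow> P x \<Longrightarrow> P y \<Longrightarrow> P (x - y)"
    "\<And>u. u \<in> words \<Longrightarrow> P (frag_of u)"
  shows "P x"
  by (rule free_Abelian_group_induct[of x "words"])
    (use assms in \<open>simp_all add: word_ring_sel\<close>)

lemma W_of: "u \<in> words \<Longrightarrow> frag_of u \<in> carrier W"
  by (simp add: word_ring_sel)

lemma ev_mult: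
  assumes x: "x \<in> carrier W" and y: "y \<in> carrier W"
  shows "ev (word_mult x y) = ev x \<otimes>\<^bsub>E\<^esub> ev y"
  using x
proof (induction x rule: W_induct)
  case zero
  then show ?case using y by (simp add: word_mult_zero ER.frag_eval_zero ev_closed)
next
  case (diff x x')
  have c: "word_mult x y \<in> carrier W" "word_mult x' y \<in> carrier W"
    using diff(1,2) y by (simp_all add: word_ring_sel keys_word_mult)
  show ?case
    using diff c y by (simp add: word_mult_diff_left ev_diff ev_closed a_minus_def ER.l_distr ER.l_minus)
next
  case (of u)
  show ?case
    using y
  proof (induction y rule: W_induct)
    case zero
    then show ?case using of by (simp add: word_mult_zero ER.frag_eval_zero ev_closed W_of)
  next
    case (diff y y')
    have c: "word_mult (frag_of u) y \<in> carrier W" "word_mult (frag_of u) y' \<in> carrier W"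
      using diff(1,2) of by (simp_all add: word_ring_sel keys_word_mult)
    show ?case
      using diff c W_of[OF of] by (simp add: word_mult_diff_right ev_diff ev_closed a_minus_def ER.r_distr ER.r_minus)
  next
    case (of v)
    then show ?case using \<open>u \<in> _\<close> by (simp add: word_mult_of ev_of word_value_append)
  qed
qed

lemma ev_hom: "ev \<in> ring_hom W E"
proof (rule ring_hom_memI)
  show "ev (x \<oplus>\<^bsub>W\<^esub> y) = ev x \<oplus>\<^bsub>E\<^esub> ev y" if "x \<in> carrier W" "y \<in> carrier W" for x y
    using ER.frag_eval_add[OF _ _ word_value_funcset] that by (simp add: word_ring_sel)
  show "ev (x \<otimes>\<^bsub>W\<^esub> y) = ev x \<otimes>\<^bsub>E\<^esub> ev y" if "x \<in> carrier W" "y \<in> carrier W" for x y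
    using ev_mult[OF that] by (simp add: word_ring_sel)
qed (simp_all add: ev_closed word_ring_sel ev_of word_value_simps)

sublocale EV: ring_hom_ring W E ev
  by (rule ring_hom_ringI2[OF ring_word_ring ring_square_zero ev_hom])

abbreviation "ker_ev \<equiv> a_kernel W E ev"

lemma ker_ev: "x \<in> ker_ev \<longleftrightarrow> x \<in> carrier W \<and> ev x = \<zero>\<^bsub>E\<^esub>"
  unfolding a_kernel_def' by (rule mem_Collect_eq)

lemma ideal_ker: "ideal ker_ev W" by (rule EV.kernel_is_ideal)

lemma word_rel_W: "word_rel A \<Gamma> \<subseteq> carrier W"
proof
  have k: "frag_of u - frag_of v \<in> carrier W" "frag_of u - frag_of v - frag_of v' \<in> carrier W"
    if "u \<in> words" "v \<in> words"
      "v' \<in> words" for u v v' :: "('a + 'g) list"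
    using WR.minus_closed[OF W_of[OF that(1)] W_of[OF that(2)]]
      WR.minus_closed[OF WR.minus_closed[OF W_of[OF that(1)] W_of[OF that(2)]] W_of[OF that(3)]] that
    by (simp_all add: minus_word_ring W_of)
  fix r assume "r \<in> word_rel A \<Gamma>"
  then show "r \<in> carrier W"
    unfolding word_rel_def
  proof (elim UnE CollectE exE conjE)
    assume "r \<in> {frag_of [Inl \<one>\<^bsub>A\<^esub>] - frag_of []}"
    then show ?thesis using k(1)[of "[Inl \<one>\<^bsub>A\<^esub>]" "[]" "[]"] by auto
  qed (simp_all add: k(1)[OF _ _ lists.Nil] k(2) lact_closed ract_closed)
qed

text \<open>On the pairs \<open>(a, 0)\<close> and \<open>(0, x)\<close> the product of
  \<open>E\<close> is the product of \<open>A\<close> and the two actions on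
  \<open>\<Gamma>\<close>, which is what the relations demand.\<close>

lemma word_rel_ker: "word_rel A \<Gamma> \<subseteq> ker_ev"
proof
  fix r assume r: "r \<in> word_rel A \<Gamma>"
  have two: "ev (frag_of u - frag_of v) = word_value u \<ominus>\<^bsub>E\<^esub> word_value v"
    if "u \<in> words" "v \<in> words" for u v :: "('a + 'g) list"
    using that by (simp add: ev_diff ev_of W_of)
  have three: "ev (frag_of u - frag_of v - frag_of v') = word_value u \<ominus>\<^bsub>E\<^esub> word_value v \<ominus>\<^bsub>E\<^esub> word_value v'"
    if "u \<in> words" "v \<in> words"
      "v' \<in> words" for u v v' :: "('a + 'g) list"
    using that WR.minus_closed[OF W_of[OF that(1)] W_of[OF that(2)]]
    by (simp add: ev_diff ev_of W_of minus_word_ring)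
  have z2: "p \<ominus>\<^bsub>E\<^esub> q = \<zero>\<^bsub>E\<^esub>" if "p = q" "q \<in> carrier E" for p q
    using that by (simp add: a_minus_def ER.r_neg)
  have z3: "p \<ominus>\<^bsub>E\<^esub> q \<ominus>\<^bsub>E\<^esub> q' = \<zero>\<^bsub>E\<^esub>" if "p = q \<oplus>\<^bsub>E\<^esub> q'" "q \<in> carrier E" "q' \<in> carrier E" for p q q'
  proof -
    have "p \<ominus>\<^bsub>E\<^esub> q \<ominus>\<^bsub>E\<^esub> q' = (q \<oplus>\<^bsub>E\<^esub> q') \<oplus>\<^bsub>E\<^esub> \<ominus>\<^bsub>E\<^esub> (q \<oplus>\<^bsub>E\<^esub> q')"
      using that by (simp add: a_minus_def ER.minus_add ER.a_assoc)
    then show ?thesis using that by (simp add: ER.r_neg)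
  qed
  have s: "word_value [Inl a] = (a, \<zero>\<^bsub>\<Gamma>\<^esub>)" if "a \<in> carrier A" for a
    using that by (simp add: word_value_simps square_zero_def act_zero)
  have s': "word_value [Inr x] = (\<zero>\<^bsub>A\<^esub>, x)" if "x \<in> carrier \<Gamma>" for x
    using that by (simp add: word_value_simps square_zero_def act_zero bimodule_one)
  have d: "word_value [Inl a, Inl b] = (a \<otimes>\<^bsub>A\<^esub> b, \<zero>\<^bsub>\<Gamma>\<^esub>)" if "a \<in> carrier A" "b \<in> carrier A" for a b
    using that s[OF that(2)] by (simp add: word_value_simps(2)[of a] square_zero_def act_zero)
  have d': "word_value [Inl a, Inr x] = (\<zero>\<^bsub>A\<^esub>, lact \<Gamma> a x)" if "a \<in> carrier A" "x \<in> carrier \<Gamma>" for a x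
    using that s'[OF that(2)] by (simp add: word_value_simps(2)[of a] square_zero_def act_zero lact_closed)
  have d'': "word_value [Inr x, Inl a] = (\<zero>\<^bsub>A\<^esub>, ract \<Gamma> x a)" if "a \<in> carrier A" "x \<in> carrier \<Gamma>" for a x
    using that s[OF that(1)] by (simp add: word_value_simps(3)[of x] square_zero_def act_zero ract_closed)
  have "ev r = \<zero>\<^bsub>E\<^esub>"
    using r unfolding word_rel_def
  proof (elim UnE CollectE exE conjE)
    fix a b assume "r = frag_of [Inl (a \<oplus>\<^bsub>A\<^esub> b)] - frag_of [Inl a] - frag_of [Inl b]" "a \<in> carrier A" "b \<in> carrier A"
    then show ?thesis
      by (simp add: three s) (rule z3, simp_all add: square_zero_def)
  next
    fix a b assume "r = frag_of [Inl (a \<otimes>\<^bsub>A\<^esub> b)] - frag_of [Inl a, Inl b]" "a \<in> carrier A" "b \<in> carrier A"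
    then show ?thesis by (simp add: two s d) (rule z2, simp_all add: square_zero_def)
  next
    assume "r \<in> {frag_of [Inl \<one>\<^bsub>A\<^esub>] - frag_of []}"
    then show ?thesis by (simp add: two s) (rule z2, simp_all add: square_zero_def word_value_simps)
  next
    fix x y assume "r = frag_of [Inr (x \<oplus>\<^bsub>\<Gamma>\<^esub> y)] - frag_of [Inr x] - frag_of [Inr y]" "x \<in> carrier \<Gamma>" "y \<in> carrier \<Gamma>"
    then show ?thesis
      by (simp add: three s') (rule z3, simp_all add: square_zero_def)
  next
    fix a x assume "r = frag_of [Inr (lact \<Gamma> a x)] - frag_of [Inl a, Inr x]" "a \<in> carrier A" "x \<in> carrier \<Gamma>"
    then show ?thesis by (simp add: two s' d' lact_closed) (rule z2, simp_all add: square_zero_def lact_closed)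
  next
    fix a x assume "r = frag_of [Inr (ract \<Gamma> x a)] - frag_of [Inr x, Inl a]" "a \<in> carrier A" "x \<in> carrier \<Gamma>"
    then show ?thesis by (simp add: two s' d'' ract_closed) (rule z2, simp_all add: square_zero_def ract_closed)
  qed
  then show "r \<in> ker_ev" using r word_rel_W by (auto simp: ker_ev)
qed

lemma ideal_I1: "ideal I1 W" by (rule WR.genideal_ideal[OF word_rel_W])

lemma I1_ker: "I1 \<subseteq> ker_ev" by (rule WR.genideal_minimal[OF ideal_ker word_rel_ker])

lemma T_eq: "T = W Quot I1" by (simp add: tensor_algebra_def Let_def)

lemma class_eq: "tcls x = I1 +>\<^bsub>W\<^esub> x"
  by (simp add: tensor_algebra_class_def Let_def)

lemma class_hom: "(\<lambda>x. tcls x) \<in> ring_hom W T"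
  using ideal.rcos_ring_hom[OF ideal_I1] by (simp add: T_eq class_eq[abs_def])

sublocale TR: ring T unfolding T_eq by (rule ideal.quotient_is_ring[OF ideal_I1])

text \<open>This image of the evaluation kernel will be shown to contain \<open>I2\<close>, which
  carries the evaluation through the second quotient.\<close>

lemma ideal_J: "ideal (tcls ` ker_ev) T"
  using WR.ring_ideal_imp_quot_ideal[OF ideal_I1 ideal_ker] by (simp add: T_eq class_eq[abs_def])

text \<open>Each summand lies in the image of the kernel by itself, because a word of two form
  letters evaluates to zero.\<close>

lemma I2_generators:
  fixes n :: nat and a b :: "nat \<Rightarrow> 'a"
  assumes "a \<in> {..<n} \<rightarrow> carrier A" "b \<in> {..<n} \<rightarrow> carrier A"
  shows "finsum T (\<lambda>i. tcls (frag_of [Inr (dif \<Gamma> (a i))]) \<otimes>\<^bsub>T\<^esub>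
    tcls (frag_of [Inr (dif \<Gamma> (b i))])) {..<n} \<in> tcls ` ker_ev"
proof -
  interpret J: ideal "tcls ` ker_ev" T by (rule ideal_J)
  have pair: "tcls (frag_of [Inr x]) \<otimes>\<^bsub>T\<^esub> tcls (frag_of [Inr y])
      \<in> tcls ` ker_ev" if xy: "x \<in> carrier \<Gamma>" "y \<in> carrier \<Gamma>" for x y
  proof -
    have w: "frag_of [Inr x] \<in> carrier W" "frag_of [Inr y] \<in> carrier W" using xy by (auto intro!: W_of)
    have "tcls (frag_of [Inr x]) \<otimes>\<^bsub>T\<^esub> tcls (frag_of [Inr y]) =
        tcls (frag_of [Inr x, Inr y])"
      using ring_hom_mult[OF class_hom w] by (simp add: word_ring_sel word_mult_of)
    moreover have "frag_of [Inr x, Inr y] \<in> ker_ev"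
      using xy by (auto simp: ker_ev W_of ev_of word_value_simps)
        (simp add: square_zero_def act_zero bimodule_one)
    ultimately show ?thesis by simp
  qed
  have "finsum T f {..<n} \<in> tcls ` ker_ev"
    if "\<And>i. i < n \<Longrightarrow> f i \<in> tcls ` ker_ev" for f
    using that
  proof (induction n)
    case (Suc n)
    have "f \<in> {..<Suc n} \<rightarrow> carrier T" using J.Icarr Suc.prems by blast
    then have "finsum T f {..<Suc n} = f n \<oplus>\<^bsub>T\<^esub> finsum T f {..<n}"
      by (simp add: lessThan_Suc Pi_iff)
    then show ?case using Suc J.a_closed by simp
  qed simp
  then show ?thesis using assms pair dif_closed by (simp add: Pi_iff)
qed

lemma I2_gens_carrier: "{finsum T (\<lambda>i. tcls (frag_of [Inr (dif \<Gamma> (a i))]) \<otimes>\<^bsub>T\<^esub>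
      tcls (frag_of [Inr (dif \<Gamma> (b i))])) {..<n} | (n :: nat) a b.
        a \<in> {..<n} \<rightarrow> carrier A \<and> b \<in> {..<n} \<rightarrow> carrier A \<and>
        finsum \<Gamma> (\<lambda>i. lact \<Gamma> (a i) (dif \<Gamma> (b i))) {..<n} = \<zero>\<^bsub>\<Gamma>\<^esub>} \<subseteq> tcls ` ker_ev"
  using I2_generators by auto

lemma ideal_I2: "ideal I2 T"
proof -
  interpret J: ideal "tcls ` ker_ev" T by (rule ideal_J)
  show ?thesis
    unfolding prolongation_ideal_def Let_def
    by (rule TR.genideal_ideal[OF subset_trans[OF I2_gens_carrier J.a_subset]])
qed

lemma I2_J: "I2 \<subseteq> tcls ` ker_ev"
  unfolding prolongation_ideal_def Let_def
  by (rule TR.genideal_minimal[OF ideal_J I2_gens_carrier])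

sublocale QR: ring Q by (rule ideal.quotient_is_ring[OF ideal_I2])

lemma cls_hom: "cls \<in> ring_hom W Q"
  using ring_hom_trans[OF class_hom ideal.rcos_ring_hom[OF ideal_I2]] by (simp add: cls_def[abs_def] comp_def)

sublocale CLS: ring_hom_ring W Q cls
  by (rule ring_hom_ringI2[OF ring_word_ring QR.ring_axioms cls_hom])

lemma cls_one: "cls (frag_of []) = \<one>\<^bsub>Q\<^esub>"
  using CLS.hom_one unfolding word_ring_sel .

lemma cls_zero: "cls 0 = \<zero>\<^bsub>Q\<^esub>"
  using CLS.hom_zero unfolding word_ring_sel .

lemma cls_diff: "x \<in> carrier W \<Longrightarrow> y \<in> carrier W \<Longrightarrow> cls (x - y) = cls x \<ominus>\<^bsub>Q\<^esub> cls y"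
  by (simp add: minus_word_ring[symmetric] a_minus_def)

lemma cls_rel:
  assumes "x \<in> carrier W" "y \<in> carrier W" "x - y \<in> word_rel A \<Gamma>"
  shows "cls x = cls y"
proof -
  have "x \<ominus>\<^bsub>W\<^esub> y \<in> I1"
    using WR.genideal_self[OF word_rel_W] assms by (auto simp: minus_word_ring)
  then have "tcls x = tcls y"
    using WR.quotient_eq_iff_same_a_r_cos[OF ideal_I1 assms(1,2)] by (simp add: class_eq)
  then show ?thesis by (simp add: cls_def)
qed

text \<open>The evaluation factors through both quotients. No induced map on \<open>Q\<close> is
  constructed; an equality of classes is traced back through the two ideals instead.\<close>

lemma cls_eq_ev:
  assumes x: "x \<in> carrier W" and y: "y \<in> carrier W" and eq: "cls x = cls y"
  shows "ev x = ev y"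
proof -
  let ?t = "tcls"
  interpret tc: ring_hom_ring W T ?t
    by (rule ring_hom_ringI2[OF ring_word_ring TR.ring_axioms class_hom])
  have xy: "x \<ominus>\<^bsub>W\<^esub> y \<in> carrier W" using x y by simp
  have "?t x \<ominus>\<^bsub>T\<^esub> ?t y \<in> I2"
    using TR.quotient_eq_iff_same_a_r_cos[OF ideal_I2 tc.hom_closed[OF x] tc.hom_closed[OF y]] eq
    by (simp add: cls_def)
  \<comment> \<open>An element of \<open>I2\<close> is the class of some \<open>z\<close> in the
    kernel, so \<open>x - y\<close> differs from \<open>z\<close> by an element of
    \<open>I1\<close>, which lies in the kernel too.\<close>
  then have "?t (x \<ominus>\<^bsub>W\<^esub> y) \<in> ?t ` ker_ev"
    using I2_J x y by (auto simp: a_minus_def)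
  then obtain z where z: "z \<in> ker_ev" "?t (x \<ominus>\<^bsub>W\<^esub> y) = ?t z" by auto
  then have zW: "z \<in> carrier W" "ev z = \<zero>\<^bsub>E\<^esub>" by (simp_all add: ker_ev)
  have "(x \<ominus>\<^bsub>W\<^esub> y) \<ominus>\<^bsub>W\<^esub> z \<in> I1"
    using WR.quotient_eq_iff_same_a_r_cos[OF ideal_I1 xy zW(1)] z(2) by (simp add: class_eq)
  then have "ev ((x \<ominus>\<^bsub>W\<^esub> y) \<ominus>\<^bsub>W\<^esub> z) = \<zero>\<^bsub>E\<^esub>" using I1_ker by (auto simp: ker_ev)
  then have "ev x \<ominus>\<^bsub>E\<^esub> ev y = \<zero>\<^bsub>E\<^esub>"
    using x y zW ev_closed by (simp add: a_minus_def)
  moreover have "ev x = (ev x \<ominus>\<^bsub>E\<^esub> ev y) \<oplus>\<^bsub>E\<^esub> ev y"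
    using ev_closed[OF x] ev_closed[OF y] by (simp add: a_minus_def ER.a_assoc ER.l_neg)
  ultimately show ?thesis using ev_closed[OF y] by simp
qed

section \<open>The images of \<open>A\<close> and \<open>\<Gamma>\<close> in the maximal
  prolongation\<close>

definition \<alpha> :: "'a \<Rightarrow> (('a + 'g) list \<Rightarrow>\<^sub>0 int) set set" where "\<alpha> a = cls (frag_of [Inl a])"
definition \<iota> :: "'g \<Rightarrow> (('a + 'g) list \<Rightarrow>\<^sub>0 int) set set" where "\<iota> x = cls (frag_of [Inr x])"

lemma W_letters: "a \<in> carrier A \<Longrightarrow> frag_of [Inl a] \<in> carrier W" "x \<in> carrier \<Gamma> \<Longrightarrow> frag_of [Inr x] \<in> carrier W"
  by (auto intro!: W_of)

lemma cls_append:
  assumes "u \<in> words" "v \<in> words"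
  shows "cls (frag_of (u @ v)) = cls (frag_of u) \<otimes>\<^bsub>Q\<^esub> cls (frag_of v)"
  using CLS.hom_mult[OF W_of[OF assms(1)] W_of[OF assms(2)]] by (simp add: word_ring_sel word_mult_of)

lemma \<alpha>_closed: "a \<in> carrier A \<Longrightarrow> \<alpha> a \<in> carrier Q"
  and \<iota>_closed: "x \<in> carrier \<Gamma> \<Longrightarrow> \<iota> x \<in> carrier Q"
  by (simp_all add: \<alpha>_def \<iota>_def W_letters)

lemma cls_rel_add:
  assumes "x \<in> carrier W" "y \<in> carrier W" "z \<in> carrier W" "x - y - z \<in> word_rel A \<Gamma>"
  shows "cls x = cls y \<oplus>\<^bsub>Q\<^esub> cls z"
proof -
  have "y \<oplus>\<^bsub>W\<^esub> z \<in> carrier W" using assms by simp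
  then have "cls x = cls (y \<oplus>\<^bsub>W\<^esub> z)"
    using assms by (intro cls_rel) (simp_all add: word_ring_sel diff_diff_eq)
  then show ?thesis using assms by simp
qed

lemma \<alpha>_add:
  assumes "a \<in> carrier A" "b \<in> carrier A"
  shows "\<alpha> (a \<oplus>\<^bsub>A\<^esub> b) = \<alpha> a \<oplus>\<^bsub>Q\<^esub> \<alpha> b"
proof -
  have "frag_of [Inl (a \<oplus>\<^bsub>A\<^esub> b)] - frag_of [Inl a] - frag_of [Inl b] \<in> word_rel A \<Gamma>"
    using assms unfolding word_rel_def by blast
  then show ?thesis
    unfolding \<alpha>_def by (rule cls_rel_add[rotated 3]) (use assms in \<open>simp_all add: W_letters\<close>)
qed

lemma \<iota>_add:
  assumes "x \<in> carrier \<Gamma>" "y \<in> carrier \<Gamma>"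
  shows "\<iota> (x \<oplus>\<^bsub>\<Gamma>\<^esub> y) = \<iota> x \<oplus>\<^bsub>Q\<^esub> \<iota> y"
proof -
  have "frag_of [Inr (x \<oplus>\<^bsub>\<Gamma>\<^esub> y)] - frag_of [Inr x] - frag_of [Inr y] \<in> word_rel A \<Gamma>"
    using assms unfolding word_rel_def by blast
  then show ?thesis
    unfolding \<iota>_def by (rule cls_rel_add[rotated 3]) (use assms in \<open>simp_all add: W_letters\<close>)
qed

lemma \<alpha>_one: "\<alpha> \<one>\<^bsub>A\<^esub> = \<one>\<^bsub>Q\<^esub>"
proof -
  have "frag_of [Inl \<one>\<^bsub>A\<^esub>] - frag_of [] \<in> word_rel A \<Gamma>"
    unfolding word_rel_def by blast
  then have "\<alpha> \<one>\<^bsub>A\<^esub> = cls (frag_of [])"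
    unfolding \<alpha>_def by (rule cls_rel[rotated 2]) (simp_all add: W_of)
  then show ?thesis by (simp only: cls_one)
qed

lemma \<alpha>_mult:
  assumes "a \<in> carrier A" "b \<in> carrier A"
  shows "\<alpha> (a \<otimes>\<^bsub>A\<^esub> b) = \<alpha> a \<otimes>\<^bsub>Q\<^esub> \<alpha> b"
proof -
  have "frag_of [Inl (a \<otimes>\<^bsub>A\<^esub> b)] - frag_of [Inl a, Inl b] \<in> word_rel A \<Gamma>"
    using assms unfolding word_rel_def by blast
  then have "\<alpha> (a \<otimes>\<^bsub>A\<^esub> b) = cls (frag_of [Inl a, Inl b])"
    unfolding \<alpha>_def by (rule cls_rel[rotated 2]) (use assms in \<open>simp_all add: W_of\<close>)
  then show ?thesis using cls_append[of "[Inl a]" "[Inl b]"] assms by (simp add: \<alpha>_def)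
qed

lemma \<iota>_lact:
  assumes "a \<in> carrier A" "x \<in> carrier \<Gamma>"
  shows "\<iota> (lact \<Gamma> a x) = \<alpha> a \<otimes>\<^bsub>Q\<^esub> \<iota> x"
proof -
  have "frag_of [Inr (lact \<Gamma> a x)] - frag_of [Inl a, Inr x] \<in> word_rel A \<Gamma>"
    using assms unfolding word_rel_def by blast
  then have "\<iota> (lact \<Gamma> a x) = cls (frag_of [Inl a, Inr x])"
    unfolding \<iota>_def by (rule cls_rel[rotated 2]) (use assms in \<open>simp_all add: W_of lact_closed\<close>)
  then show ?thesis using cls_append[of "[Inl a]" "[Inr x]"] assms by (simp add: \<alpha>_def \<iota>_def)
qed

lemma \<iota>_ract:
  assumes "a \<in> carrier A" "x \<in> carrier \<Gamma>"
  shows "\<iota> (ract \<Gamma> x a) = \<iota> x \<otimes>\<^bsub>Q\<^esub> \<alpha> a"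
proof -
  have "frag_of [Inr (ract \<Gamma> x a)] - frag_of [Inr x, Inl a] \<in> word_rel A \<Gamma>"
    using assms unfolding word_rel_def by blast
  then have "\<iota> (ract \<Gamma> x a) = cls (frag_of [Inr x, Inl a])"
    unfolding \<iota>_def by (rule cls_rel[rotated 2]) (use assms in \<open>simp_all add: W_of ract_closed\<close>)
  then show ?thesis using cls_append[of "[Inr x]" "[Inl a]"] assms by (simp add: \<alpha>_def \<iota>_def)
qed

lemma \<iota>_zero: "\<iota> \<zero>\<^bsub>\<Gamma>\<^esub> = \<zero>\<^bsub>Q\<^esub>"
  using \<iota>_add[of "\<zero>\<^bsub>\<Gamma>\<^esub>" "\<zero>\<^bsub>\<Gamma>\<^esub>"] \<iota>_closed[of "\<zero>\<^bsub>\<Gamma>\<^esub>"] by (simp add: QR.add.l_cancel_one')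

lemma \<alpha>_zero: "\<alpha> \<zero>\<^bsub>A\<^esub> = \<zero>\<^bsub>Q\<^esub>"
  using \<alpha>_add[of "\<zero>\<^bsub>A\<^esub>" "\<zero>\<^bsub>A\<^esub>"] \<alpha>_closed[of "\<zero>\<^bsub>A\<^esub>"] by (simp add: QR.add.l_cancel_one')

text \<open>Evaluation recovers the letter of a one-letter word; the same argument serves for
  \<open>\<iota>\<close> below.\<close>

lemma inj_\<alpha>: "a \<in> carrier A \<Longrightarrow> b \<in> carrier A \<Longrightarrow> \<alpha> a = \<alpha> b \<Longrightarrow> a = b"
  using cls_eq_ev[of "frag_of [Inl a]" "frag_of [Inl b]"]
  by (simp add: \<alpha>_def W_letters ev_of word_value_simps) (simp add: square_zero_def)

lemma inj_\<iota>: "x \<in> carrier \<Gamma> \<Longrightarrow> y \<in> carrier \<Gamma> \<Longrightarrow> \<iota> x = \<iota> y \<Longrightarrow> x = y"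
  using cls_eq_ev[of "frag_of [Inr x]" "frag_of [Inr y]"]
  by (simp add: \<iota>_def W_letters ev_of word_value_simps) (simp add: square_zero_def act_zero bimodule_one)

text \<open>A word with at most one form letter collapses to one letter: letters from
  \<open>A\<close> multiply together and act on the form. The degree-one claim needs the degree-zero
  claim beside it, for the rest of the word after the form letter.\<close>

lemma cls_word:
  assumes "u \<in> words"
  shows "(length (filter (\<lambda>s. \<not> isl s) u) = 0 \<longrightarrow> cls (frag_of u) \<in> \<alpha> ` carrier A) \<and>
    (length (filter (\<lambda>s. \<not> isl s) u) = 1 \<longrightarrow> cls (frag_of u) \<in> \<iota> ` carrier \<Gamma>)"
  using assms
proof (induction u)
  case Nil
  have "cls (frag_of []) = \<alpha> \<one>\<^bsub>A\<^esub>" by (simp only: cls_one \<alpha>_one)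
  then show ?case by auto
next
  case (Cons s u)
  have c: "cls (frag_of (s # u)) = cls (frag_of [s]) \<otimes>\<^bsub>Q\<^esub> cls (frag_of u)"
    using cls_append[of "[s]" u] Cons.hyps by (auto simp del: lists_def)
  show ?case
  proof (cases s)
    case (Inl a)
    then have a: "a \<in> carrier A" using Cons.hyps by auto
    have c': "cls (frag_of (s # u)) = \<alpha> a \<otimes>\<^bsub>Q\<^esub> cls (frag_of u)" using c by (simp add: Inl \<alpha>_def)
    have "\<alpha> a \<otimes>\<^bsub>Q\<^esub> w \<in> \<alpha> ` carrier A" if "w \<in> \<alpha> ` carrier A" for w
      using that a by (auto simp: \<alpha>_mult[symmetric])
    moreover have "\<alpha> a \<otimes>\<^bsub>Q\<^esub> w \<in> \<iota> ` carrier \<Gamma>" if "w \<in> \<iota> ` carrier \<Gamma>" for w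
      using that a by (auto simp: \<iota>_lact[symmetric] lact_closed)
    ultimately show ?thesis using Cons.IH unfolding c' by (simp add: Inl)
  next
    case (Inr x)
    then have x: "x \<in> carrier \<Gamma>" using Cons.hyps by auto
    have c': "cls (frag_of (s # u)) = \<iota> x \<otimes>\<^bsub>Q\<^esub> cls (frag_of u)" using c by (simp add: Inr \<iota>_def)
    have "\<iota> x \<otimes>\<^bsub>Q\<^esub> w \<in> \<iota> ` carrier \<Gamma>" if "w \<in> \<alpha> ` carrier A" for w
      using that x by (auto simp: \<iota>_ract[symmetric] ract_closed)
    then show ?thesis using Cons.IH unfolding c' by (simp add: Inr)
  qed
qed

section \<open>Forms of degree one and the differential of functions\<close>

abbreviation "MP \<equiv> max_prolongation K A \<Gamma>"
abbreviation "\<Gamma>' \<equiv> truncation MP"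

lemma degr_one: "degr MP 1 = \<iota> ` carrier \<Gamma>"
proof -
  have eq: "degr MP 1 = {cls x | x. x \<in> carrier W \<and> (\<forall>u\<in>Poly_Mapping.keys x. length (filter (\<lambda>s. \<not> isl s) u) = 1)}"
    by (simp add: max_prolongation_def Let_def cls_def)
  show ?thesis
  proof (intro equalityI subsetI)
    fix w assume "w \<in> degr MP 1"
    then obtain x where x: "w = cls x" "x \<in> carrier W" "\<forall>u\<in>Poly_Mapping.keys x. length (filter (\<lambda>s. \<not> isl s) u) = 1"
      unfolding eq by blast
    \<comment> \<open>The induction runs over combinations supported on words with one form letter,
      so no other degree can appear in the differences on the way.\<close>
    let ?S = "{u \<in> words. length (filter (\<lambda>s. \<not> isl s) u) = 1}"
    have "Poly_Mapping.keys x \<subseteq> ?S" using x(2,3) by (auto simp: word_ring_sel)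
    then have "cls x \<in> \<iota> ` carrier \<Gamma>"
    proof (induction x rule: free_Abelian_group_induct[consumes 1, case_names zero diff of])
      case zero
      have "cls 0 = \<iota> \<zero>\<^bsub>\<Gamma>\<^esub>" by (simp only: cls_zero \<iota>_zero)
      then show ?case by auto
    next
      case (diff x y)
      have W: "x \<in> carrier W" "y \<in> carrier W" using diff(1,2) by (auto simp: word_ring_sel)
      obtain p q where pq: "p \<in> carrier \<Gamma>" "q \<in> carrier \<Gamma>" "cls x = \<iota> p" "cls y = \<iota> q" using diff by auto
      have "\<ominus>\<^bsub>Q\<^esub> \<iota> q = \<iota> (\<ominus>\<^bsub>\<Gamma>\<^esub> q)"
        using \<iota>_add[of "\<ominus>\<^bsub>\<Gamma>\<^esub> q" q] pq by (intro QR.minus_equality) (simp_all add: G.l_neg \<iota>_zero \<iota>_closed)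
      then have "cls (x - y) = \<iota> (p \<oplus>\<^bsub>\<Gamma>\<^esub> \<ominus>\<^bsub>\<Gamma>\<^esub> q)"
        using W pq by (simp add: cls_diff a_minus_def \<iota>_add)
      then show ?case using pq by simp
    next
      case (of u)
      then show ?case using cls_word[of u] by auto
    qed
    then show "w \<in> \<iota> ` carrier \<Gamma>" using x by simp
  next
    fix w assume "w \<in> \<iota> ` carrier \<Gamma>"
    then obtain x where "x \<in> carrier \<Gamma>" "w = cls (frag_of [Inr x])" by (auto simp: \<iota>_def)
    then show "w \<in> degr MP 1"
      unfolding eq by (intro CollectI exI[of _ "frag_of [Inr x]"]) (auto intro!: W_of)
  qed
qed

text \<open>\<open>dd\<close> is described through arbitrary presentations of an element. In degree
  0 a presentation collapses to a single summand, and the sum of the differentials collapses along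
  with it.\<close>

lemma sum_generators:
  fixes m :: nat and a :: "nat \<Rightarrow> 'a"
  assumes "\<And>i. i < m \<Longrightarrow> a i \<in> carrier A"
  shows "\<exists>s\<in>carrier A. finsum Q (\<lambda>i. \<alpha> (a i)) {..<m} = \<alpha> s \<and> finsum Q (\<lambda>i. \<iota> (dif \<Gamma> (a i))) {..<m} = \<iota> (dif \<Gamma> s)"
  using assms
proof (induction m)
  case 0
  have "dif \<Gamma> \<zero>\<^bsub>A\<^esub> = \<zero>\<^bsub>\<Gamma>\<^esub>"
    by (rule lin_map_zero[OF fodc_lin_dif[OF fodc] A.abelian_group_axioms module_abelian_group[OF fodc_module[OF fodc]]])
  then show ?case by (intro bexI[of _ "\<zero>\<^bsub>A\<^esub>"]) (simp_all add: \<alpha>_zero \<iota>_zero)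
next
  case (Suc m)
  then obtain s where s: "s \<in> carrier A" "finsum Q (\<lambda>i. \<alpha> (a i)) {..<m} = \<alpha> s"
      "finsum Q (\<lambda>i. \<iota> (dif \<Gamma> (a i))) {..<m} = \<iota> (dif \<Gamma> s)" by auto
  have am: "a m \<in> carrier A" using Suc.prems by simp
  have "finsum Q (\<lambda>i. \<alpha> (a i)) {..<Suc m} = \<alpha> (a m) \<oplus>\<^bsub>Q\<^esub> \<alpha> s"
    unfolding lessThan_Suc s(2)[symmetric]
    by (rule QR.finsum_insert) (use Suc.prems in \<open>auto simp: \<alpha>_closed\<close>)
  moreover have "finsum Q (\<lambda>i. \<iota> (dif \<Gamma> (a i))) {..<Suc m} = \<iota> (dif \<Gamma> (a m)) \<oplus>\<^bsub>Q\<^esub> \<iota> (dif \<Gamma> s)"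
    unfolding lessThan_Suc s(3)[symmetric]
    by (rule QR.finsum_insert) (use Suc.prems in \<open>auto simp: \<iota>_closed dif_closed\<close>)
  ultimately show ?case
    using s(1) am by (intro bexI[of _ "a m \<oplus>\<^bsub>A\<^esub> s"])
      (simp_all add: \<alpha>_add \<iota>_add lin_map_add[OF fodc_lin_dif[OF fodc]] dif_closed)
qed

text \<open>The definite description must be shown to be single valued: any presentation of
  \<open>\<alpha> a\<close> collapses to some \<open>\<alpha> s\<close>, and injectivity of
  \<open>\<alpha>\<close> forces \<open>s = a\<close>.\<close>

lemma dd_zero:
  assumes a: "a \<in> carrier A"
  shows "dd MP 0 (\<alpha> a) = \<iota> (dif \<Gamma> a)"
proof -
  let ?P = "\<lambda>w'. \<exists>m (b :: nat \<Rightarrow> 'a) as. (\<forall>i<m. b i \<in> carrier A \<and> as i \<in> lists (carrier A) \<and> length (as i) = 0) \<and>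
      \<alpha> a = finsum Q (\<lambda>i. \<alpha> (b i) \<otimes>\<^bsub>Q\<^esub> foldr (\<lambda>v w. v \<otimes>\<^bsub>Q\<^esub> w) (map (\<lambda>a. \<iota> (dif \<Gamma> a)) (as i)) \<one>\<^bsub>Q\<^esub>) {..<m} \<and>
      w' = finsum Q (\<lambda>i. \<iota> (dif \<Gamma> (b i)) \<otimes>\<^bsub>Q\<^esub> foldr (\<lambda>v w. v \<otimes>\<^bsub>Q\<^esub> w) (map (\<lambda>a. \<iota> (dif \<Gamma> a)) (as i)) \<one>\<^bsub>Q\<^esub>) {..<m}"
  have "dd MP 0 (\<alpha> a) = (THE w'. ?P w')"
    by (simp add: max_prolongation_def Let_def cls_def \<alpha>_def \<iota>_def)
  also have "\<dots> = \<iota> (dif \<Gamma> a)"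
  proof (rule the_equality)
    show "?P (\<iota> (dif \<Gamma> a))"
      \<comment> \<open>The presentation with one summand and an empty list of further
        differentials.\<close>
      using a by (intro exI[of _ "1 :: nat"] exI[of _ "\<lambda>_. a"] exI[of _ "\<lambda>_. []"])
        (simp add: \<alpha>_closed \<iota>_closed dif_closed lessThan_Suc)
    fix w' assume "?P w'"
    then obtain m and b :: "nat \<Rightarrow> 'a" and as where b: "\<And>i. i < m \<Longrightarrow> b i \<in> carrier A" and as: "\<And>i. i < m \<Longrightarrow> as i = []"
      and 1: "\<alpha> a = finsum Q (\<lambda>i. \<alpha> (b i) \<otimes>\<^bsub>Q\<^esub> foldr (\<lambda>v w. v \<otimes>\<^bsub>Q\<^esub> w) (map (\<lambda>a. \<iota> (dif \<Gamma> a)) (as i)) \<one>\<^bsub>Q\<^esub>) {..<m}"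
      and 2: "w' = finsum Q (\<lambda>i. \<iota> (dif \<Gamma> (b i)) \<otimes>\<^bsub>Q\<^esub> foldr (\<lambda>v w. v \<otimes>\<^bsub>Q\<^esub> w) (map (\<lambda>a. \<iota> (dif \<Gamma> a)) (as i)) \<one>\<^bsub>Q\<^esub>) {..<m}"
      by auto
    have "\<alpha> a = finsum Q (\<lambda>i. \<alpha> (b i)) {..<m}"
      unfolding 1 by (rule QR.finsum_cong') (use b as in \<open>auto simp: \<alpha>_closed\<close>)
    moreover have "w' = finsum Q (\<lambda>i. \<iota> (dif \<Gamma> (b i))) {..<m}"
      unfolding 2 by (rule QR.finsum_cong') (use b as in \<open>auto simp: \<iota>_closed dif_closed\<close>)
    moreover obtain s where "s \<in> carrier A" "finsum Q (\<lambda>i. \<alpha> (b i)) {..<m} = \<alpha> s"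
        "finsum Q (\<lambda>i. \<iota> (dif \<Gamma> (b i))) {..<m} = \<iota> (dif \<Gamma> s)"
      using sum_generators[of m b] b by blast
    ultimately show "w' = \<iota> (dif \<Gamma> a)" using inj_\<alpha>[OF a] by auto
  qed
  finally show ?thesis .
qed

lemma truncation_sel:
  "carrier \<Gamma>' = \<iota> ` carrier \<Gamma>" "add \<Gamma>' = add Q" "\<zero>\<^bsub>\<Gamma>'\<^esub> = \<zero>\<^bsub>Q\<^esub>"
  "c \<odot>\<^bsub>\<Gamma>'\<^esub> w = \<alpha> (c \<odot>\<^bsub>A\<^esub> \<one>\<^bsub>A\<^esub>) \<otimes>\<^bsub>Q\<^esub> w"
  "lact \<Gamma>' a w = \<alpha> a \<otimes>\<^bsub>Q\<^esub> w" "ract \<Gamma>' w a = w \<otimes>\<^bsub>Q\<^esub> \<alpha> a" "dif \<Gamma>' a = dd MP 0 (\<alpha> a)"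
  using degr_one by (simp_all add: truncation_def max_prolongation_def Let_def cls_def \<alpha>_def)

lemma bij_\<iota>: "bij_betw \<iota> (carrier \<Gamma>) (carrier \<Gamma>')"
  unfolding truncation_sel bij_betw_def by (auto intro!: inj_onI dest: inj_\<iota>)

text \<open>Scalars of the prolongation multiply by the class of \<open>c \<odot> 1\<close>. In
  \<open>\<Gamma>\<close> this gives the same result because \<open>lact\<close> is linear in its
  algebra argument.\<close>

lemma \<iota>_smult:
  assumes "c \<in> carrier K" "x \<in> carrier \<Gamma>"
  shows "\<iota> (c \<odot>\<^bsub>\<Gamma>\<^esub> x) = c \<odot>\<^bsub>\<Gamma>'\<^esub> \<iota> x"
proof -
  have "c \<odot>\<^bsub>\<Gamma>\<^esub> x = lact \<Gamma> (c \<odot>\<^bsub>A\<^esub> \<one>\<^bsub>A\<^esub>) x"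
    using lin_map_smult[OF bilin_left[OF fodc_lact[OF fodc] assms(2)] assms(1) A.one_closed] assms
    by (simp add: bimodule_one)
  then show ?thesis using assms by (simp add: truncation_sel \<iota>_lact)
qed

text \<open>The operations of the truncation are unfolded to those of \<open>Q\<close> to match the
  facts on \<open>\<iota>\<close>. Its carrier and its scalars stay folded because
  \<open>bij_\<iota>\<close> and \<open>\<iota>_smult\<close> are stated with them.\<close>

lemmas \<iota>_iso = fodc_iso[OF alg_A fodc bij_\<iota>, unfolded truncation_sel(2,3,5,6,7),
    OF \<iota>_add \<iota>_zero \<iota>_smult \<iota>_lact \<iota>_ract dd_zero[symmetric]]

end

section \<open>Transport along an isomorphism of calculi, and the two claims\<close>

context comodule_alg
begin

text \<open>The coaction is conjugated: go back along \<open>j\<close>, coact on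
  \<open>\<Gamma>\<close>, and push the form leg forward along \<open>\<iota>\<close>.\<close>

lemma right_covariant_iso:
  fixes \<Gamma> :: "('k, 'a, 'g) fodc" and \<Gamma>' :: "('k, 'a, 'w) fodc"
  assumes \<Gamma>: "is_fodc K A \<Gamma>" and \<Gamma>': "is_fodc K A \<Gamma>'"
    and \<iota>: "lin_map K \<Gamma> \<Gamma>' \<iota>" and j: "lin_map K \<Gamma>' \<Gamma> j"
    and j\<iota>: "\<And>x. x \<in> carrier \<Gamma> \<Longrightarrow> j (\<iota> x) = x"
    and \<iota>_gen: "\<And>a b. a \<in> carrier A \<Longrightarrow> b \<in> carrier A \<Longrightarrow> \<iota> (lact \<Gamma> a (dif \<Gamma> b)) = lact \<Gamma>' a (dif \<Gamma>' b)"
    and cov: "right_covariant K H A \<delta> \<Gamma>"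
  shows "right_covariant K H A \<delta> \<Gamma>'"
proof -
  let ?T = "tensor K \<Gamma> H" and ?T' = "tensor K \<Gamma>' H"
  note mG = fodc_module[OF \<Gamma>] and mG' = fodc_module[OF \<Gamma>']
  note bd = bilin_comp[OF fodc_lact[OF \<Gamma>] lin_map_ident fodc_lin_dif[OF \<Gamma>]]
  obtain \<rho> where \<rho>: "lin_map K \<Gamma> ?T \<rho>" and gen: "\<And>a b. a \<in> carrier A \<Longrightarrow> b \<in> carrier A \<Longrightarrow> \<rho> (lact \<Gamma> a (dif \<Gamma> b)) =
      tensor_bimap ?T (\<lambda>a x. lact \<Gamma> a (dif \<Gamma> x)) (\<lambda>h g. h \<otimes>\<^bsub>H\<^esub> g) (\<delta> a) (\<delta> b)"
    using cov unfolding right_covariant_def is_right_coaction_def Let_def tensor_bimap_def by blast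
  let ?\<rho>' = "\<lambda>w. tensor_map ?T' \<iota> (\<lambda>h. h) (\<rho> (j w))"
  have "is_right_coaction K H A \<delta> \<Gamma>' ?\<rho>'"
    unfolding is_right_coaction_def Let_def
  proof (intro conjI ballI)
    show "lin_map K \<Gamma>' ?T' ?\<rho>'"
      by (rule lin_map_comp[OF lin_map_tensor_map[OF mG mod_H mG' mod_H \<iota> lin_map_ident] lin_map_comp[OF \<rho> j]])
    fix a b assume a: "a \<in> carrier A" and b: "b \<in> carrier A"
    note c = coact_closed[OF a] coact_closed[OF b]
    have "lact \<Gamma> a (dif \<Gamma> b) \<in> carrier \<Gamma>" using bilin_closed[OF bd a b] .
    then have "j (lact \<Gamma>' a (dif \<Gamma>' b)) = lact \<Gamma> a (dif \<Gamma> b)"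
      using j\<iota> \<iota>_gen[OF a b] by metis
    then have "?\<rho>' (lact \<Gamma>' a (dif \<Gamma>' b)) = tensor_map ?T' \<iota> (\<lambda>h. h)
        (tensor_bimap ?T (\<lambda>a x. lact \<Gamma> a (dif \<Gamma> x)) (\<lambda>h g. h \<otimes>\<^bsub>H\<^esub> g) (\<delta> a) (\<delta> b))"
      by (simp add: gen a b)
    also have "\<dots> = tensor_bimap ?T' (\<lambda>a x. \<iota> (lact \<Gamma> a (dif \<Gamma> x))) (\<lambda>h g. h \<otimes>\<^bsub>H\<^esub> g) (\<delta> a) (\<delta> b)"
      by (rule tensor_map_bimap[OF mod_A mod_H mod_A mod_H mG mod_H mG' mod_H bd bilin_H \<iota> lin_map_ident c])
    also have "\<dots> = tensor_bimap ?T' (\<lambda>a x. lact \<Gamma>' a (dif \<Gamma>' x)) (\<lambda>h g. h \<otimes>\<^bsub>H\<^esub> g) (\<delta> a) (\<delta> b)"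
      by (rule bimap_cong[OF mod_A mod_H mod_A mod_H mG' mod_H
        bilin_comp[OF fodc_lact[OF \<Gamma>'] lin_map_ident fodc_lin_dif[OF \<Gamma>']] bilin_H \<iota>_gen refl c])
    finally show "?\<rho>' (lact \<Gamma>' a (dif \<Gamma>' b)) =
        tensor_lift ?T' (\<delta> a) (\<lambda>a\<^sub>0 a\<^sub>1. tensor_lift ?T' (\<delta> b) (\<lambda>a'\<^sub>0 a'\<^sub>1.
          pure_tensor ?T' (lact \<Gamma>' a\<^sub>0 (dif \<Gamma>' a'\<^sub>0)) (a\<^sub>1 \<otimes>\<^bsub>H\<^esub> a'\<^sub>1)))"
      by (simp add: tensor_bimap_def)
  qed
  then show ?thesis unfolding right_covariant_def by blast
qed

text \<open>The target of a vertical map does not involve the calculus on \<open>A\<close>, so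
  composing with \<open>j\<close> is enough.\<close>

lemma is_ver_iso:
  fixes \<Gamma> :: "('k, 'a, 'g) fodc" and \<Gamma>' :: "('k, 'a, 'w) fodc"
  assumes \<Gamma>: "is_fodc K A \<Gamma>" and j: "lin_map K \<Gamma>' \<Gamma> j"
    and j\<iota>: "\<And>x. x \<in> carrier \<Gamma> \<Longrightarrow> j (\<iota> x) = x"
    and \<iota>_gen: "\<And>a b. a \<in> carrier A \<Longrightarrow> b \<in> carrier A \<Longrightarrow> \<iota> (lact \<Gamma> a (dif \<Gamma> b)) = lact \<Gamma>' a (dif \<Gamma>' b)"
    and v: "is_ver K H A \<delta> \<Gamma>H \<Gamma> v"
  shows "is_ver K H A \<delta> \<Gamma>H \<Gamma>' (\<lambda>w. v (j w))"
proof -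
  have "j (lact \<Gamma>' a (dif \<Gamma>' b)) = lact \<Gamma> a (dif \<Gamma> b)" if "a \<in> carrier A" "b \<in> carrier A" for a b
    using j\<iota>[OF bilin_closed[OF fodc_lact[OF \<Gamma>] that(1) lin_map_closed[OF fodc_lin_dif[OF \<Gamma>] that(2)]]] \<iota>_gen[OF that]
    by simp
  then show ?thesis
    using v unfolding is_ver_def Let_def by (simp add: lin_map_comp[OF _ j])
qed

end

text \<open>Completeness concerns the truncation of the prolongation, so the right coaction and the
  vertical map of \<open>\<Gamma>A\<close> are first carried over to it along
  \<open>\<iota>\<close>; there the vertical map becomes a vertical coaction and the two coactions
  are paired.\<close>

lemma maximal_prolongation_first_order_complete:
  assumes hopf: "hopf_algebra K H" and comod: "comodule_algebra K H A \<delta>"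
    and bm: "bm_bundle K H A \<delta> \<Gamma>H \<Gamma>A"
  shows "first_order_complete K H A \<delta> \<Gamma>H (max_prolongation K A \<Gamma>A)"
proof -
  interpret C: comodule_alg K H A \<delta> by unfold_locales (rule hopf, rule comod)
  have b: "is_fodc K H \<Gamma>H" "bicovariant K H \<Gamma>H" "is_fodc K A \<Gamma>A" "right_covariant K H A \<delta> \<Gamma>A"
    using bm by (simp_all add: bm_bundle_def)
  obtain v where v: "is_ver K H A \<delta> \<Gamma>H \<Gamma>A v" using bm unfolding bm_bundle_def by blast
  interpret D: fodc_data K A \<Gamma>A by unfold_locales (rule C.alg_A, rule b(3))
  let ?j = "inv_into (carrier \<Gamma>A) D.\<iota>"
  have j\<iota>: "?j (D.\<iota> x) = x" if "x \<in> carrier \<Gamma>A" for x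
    using bij_betw_inv_into_left[OF D.bij_\<iota> that] .
  have gen: "D.\<iota> (lact \<Gamma>A a (dif \<Gamma>A b)) = lact D.\<Gamma>' a (dif D.\<Gamma>' b)" if "a \<in> carrier A" "b \<in> carrier A" for a b
    using that by (simp add: D.truncation_sel D.\<iota>_lact D.dif_closed D.dd_zero)
  interpret F: comodule_fodc K H A \<delta> \<Gamma>H D.\<Gamma>'
    by unfold_locales (rule b(1), rule b(2), rule D.\<iota>_iso(1))
  obtain \<rho> where "is_right_coaction K H A \<delta> D.\<Gamma>' \<rho>"
    using C.right_covariant_iso[OF b(3) D.\<iota>_iso(1,2,3) j\<iota> gen b(4)] unfolding right_covariant_def by blast
  from F.coactions_fodc_map[OF this F.ver_to_vertical_coaction[OF C.is_ver_iso[OF b(3) D.\<iota>_iso(3) j\<iota> gen v]]]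
  show ?thesis unfolding first_order_complete_def is_first_order_coaction_def by blast
qed

lemma bm_bundle_iff_base_forms_horizontal:
  assumes hopf: "hopf_algebra K H" and comod: "comodule_algebra K H A \<delta>" and galois: "hopf_galois K H A \<delta>"
    and \<Omega>H: "diff_calculus K H \<Omega>H" and bicov: "bicovariant K H (truncation \<Omega>H)"
    and \<Omega>A: "diff_calculus K A \<Omega>A" and complete: "first_order_complete K H A \<delta> (truncation \<Omega>H) \<Omega>A"
  shows "bm_bundle K H A \<delta> (truncation \<Omega>H) (truncation \<Omega>A) \<longleftrightarrow>
    base_forms K H A \<delta> (truncation \<Omega>A) = horizontal_forms K H A \<delta> (truncation \<Omega>H) \<Omega>A"
proof -
  interpret C: comodule_alg K H A \<delta> by unfold_locales (rule hopf, rule comod)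
  interpret F: comodule_fodc K H A \<delta> "truncation \<Omega>H" "truncation \<Omega>A"
    by unfold_locales (rule fodc_truncation[OF C.alg_H \<Omega>H], rule bicov, rule fodc_truncation[OF C.alg_A \<Omega>A])
  \<comment> \<open>The same choice as in \<open>horizontal_forms\<close>; completeness makes it a
    genuine first order coaction.\<close>
  let ?\<Phi> = "SOME \<Phi>. is_first_order_coaction K H A \<delta> (truncation \<Omega>H) \<Omega>A \<Phi>"
  have "is_first_order_coaction K H A \<delta> (truncation \<Omega>H) \<Omega>A ?\<Phi>"
    using complete unfolding first_order_complete_def by (rule someI_ex)
  then have "fodc_map K A \<delta> (truncation \<Omega>A) F.\<Theta> ?\<Phi>"
    by (simp add: is_first_order_coaction_def)
  moreover have "carrier (truncation \<Omega>A) = degr \<Omega>A 1" by (simp add: truncation_def)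
  ultimately show ?thesis
    using F.bm_bundle_iff[OF galois] by (simp add: horizontal_forms_def Let_def)
qed

theorem proposition3p30:
  fixes K :: "'k ring"
    and H :: "('k, 'h) hopf"
    and A :: "('k, 'a) module"
    and \<delta> :: "'a \<Rightarrow> ('a \<times> 'h \<Rightarrow>\<^sub>0 int) set"
  assumes "field K"
    and "hopf_algebra K H"
    and "ff_hopf_galois K H A \<delta>"
  shows "(\<forall>(\<Gamma>H :: ('k, 'h, 'gh) fodc) (\<Gamma>A :: ('k, 'a, 'ga) fodc).
            bm_bundle K H A \<delta> \<Gamma>H \<Gamma>A \<longrightarrow>
            first_order_complete K H A \<delta> \<Gamma>H (max_prolongation K A \<Gamma>A)) \<and>
         (\<forall>(\<Omega>H :: ('k, 'h, 'wh) dcalc) (\<Omega>A :: ('k, 'a, 'wa) dcalc).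
            diff_calculus K H \<Omega>H \<and> bicovariant K H (truncation \<Omega>H) \<and>
            diff_calculus K A \<Omega>A \<and> first_order_complete K H A \<delta> (truncation \<Omega>H) \<Omega>A \<longrightarrow>
            (bm_bundle K H A \<delta> (truncation \<Omega>H) (truncation \<Omega>A) \<longleftrightarrow>
             base_forms K H A \<delta> (truncation \<Omega>A) = horizontal_forms K H A \<delta> (truncation \<Omega>H) \<Omega>A))"
proof -
  have "comodule_algebra K H A \<delta>" "hopf_galois K H A \<delta>"
    using assms(3) by (simp_all add: ff_hopf_galois_def)
  with assms(2) show ?thesis
    using maximal_prolongation_first_order_complete bm_bundle_iff_base_forms_horizontal by blast
qed

end
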